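(* Let $n\ge0$ and, for $0\le p\le n$, let $\mathcal F_p=\{f_p^1,\dots,f_p^{d_p}\}\subset\mathcal B(E_p)$ be finite sets of functions, $d_p\ge1$. Let $(\alpha(N))_{N\ge1}$ be a nondecreasing sequence of positive numbers with $\alpha(N)\to\infty$ and $\alpha(N)/N\to0$. Then the random sequence $[\pi_{\mathcal F_0}(V_0^N),\dots,\pi_{\mathcal F_n}(V_n^N)]$, where $\pi_{\mathcal F_p}(V_p^N)=(V_p^N(f_p^i))_{1\le i\le d_p}$, satisfies a moderate deviation principle in $\mathbb R^{d_0+\dots+d_n}$ with speed $\alpha(N)$ and good rate function given for $v=(v_0,\dots,v_n)\in\mathbb R^{d_0+\dots+d_n}$ by $$I^{V_{[0,n]}}_{\mathcal F_{[0,n]}}(v)=\sum_{p=0}^nI^{V_p}_{\mathcal F_p}(v_p),\qquad I^{V_p}_{\mathcal F_p}(v_p)=\sup_{u\in\mathbb R^{d_p}}\Big(\langle u,v_p\rangle-\frac12\,\mathbb E\Big(\Big(\sum_{i=1}^{d_p}u^iV_p(f_p^i)\Big)^2\Big)\Big).$$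
   Context: Notation. For a measurable space $(E,\mathcal E)$: $\mathcal P(E)$ is the set of probability measures, $\mathcal M(E)$ the set of finite signed measures, $\mathcal B(E)$ the bounded measurable real functions with the sup norm $\|\cdot\|$, $\mathrm{osc}(f)=\sup_{x,y}|f(x)-f(y)|$, $\mathrm{Osc}_1(E)=\{f\text{ measurable}:\mathrm{osc}(f)\le 1\}$, $\mu(f)=\int f\,d\mu$. A bounded integral operator $M$ from $E$ into $F$ is an operator $f\mapsto M(f)(x)=\int_F M(x,dy)f(y)$ from $\mathcal B(F)$ into $\mathcal B(E)$; $(\mu M)(f):=\mu(M(f))$; $\beta(M):=\sup\{\mathrm{osc}(M(f)):f\in\mathrm{Osc}_1(F)\}$. Model. $(E_n,\mathcal E_n)_{n\ge0}$ are measurable spaces; for $n\ge1$ and $\eta\in\mathcal P(E_{n-1})$, $K_{n,\eta}$ is a Markov kernel from $E_{n-1}$ to $E_n$; $\Phi_n(\eta):=\eta K_{n,\eta}\in\mathcal P(E_n)$; $\eta_0\in\mathcal P(E_0)$ is given and $\eta_n=\Phi_n(\eta_{n-1})$. The maps $(x^i)_{1\le i\le N}\mapsto K_{n+1,\frac1N\sum_j\delta_{x^j}}(x^i,A)$ are measurable for every measurable $A\subset E_{n+1}$. For $N\ge1$, the particle system $\xi_n=(\xi_n^{1},\dots,\xi_n^{N})\in E_n^N$ is a Markov chain: $\xi_0$ consists of $N$ i.i.d. variables of law $\eta_0$, and given $\xi_0,\dots,\xi_{n-1}$ the $\xi_n^{i}$ are independent with respective laws $K_{n,\eta^N_{n-1}}(\xi_{n-1}^{i},\cdot)$,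 where $\eta^N_n:=\frac1N\sum_{j=1}^N\delta_{\xi_n^{j}}$. Set $V_n^N:=\sqrt N(\eta_n^N-\eta^N_{n-1}K_{n,\eta^N_{n-1}})$ for $n\ge1$ and $V^N_0:=\sqrt N(\eta^N_0-\eta_0)$. Regularity class $\Upsilon(E_1,E_2)$: mappings $\Phi:\mathcal P(E_1)\to\mathcal P(E_2)$ with $\Phi(\mu)-\Phi(\eta)=(\mu-\eta)D_\eta\Phi+\mathcal R^\Phi(\mu,\eta)$ for all $\mu,\eta$, where (i) $D_\eta\Phi$ are bounded integral operators from $E_1$ into $E_2$ with $D_\eta\Phi(1)=0$ and $\sup_\eta\beta(D_\eta\Phi)<\infty$; (ii) $|\mathcal R^\Phi(\mu,\eta)(f)|\le\int|(\mu-\eta)^{\otimes2}(g)|\,R^\Phi_\eta(f,dg)$, where for each $f\in\mathcal B(E_2)$, $R^\Phi_\eta(f,\cdot)$ is a nonnegative measure on functions $g=g_1\otimes g_2$, $(g_1,g_2)\in\mathrm{Osc}_1(E_1)^2$, with $\sup_\eta\int\mathrm{osc}(g_1)\mathrm{osc}(g_2)R^\Phi_\eta(f,d(g_1\otimes g_2))\le\mathrm{osc}(f)\,\delta(R^\Phi)$ and $\delta(R^\Phi)<\infty$. Condition (K) for a family $K_\eta$, $\eta\in\mathcal P(E_1)$, of Markov kernels from $E_1$ to $E_2$: for all $f\in\mathrm{Osc}_1(E_2)$, $\|[K_\mu-K_\eta](f)\|\le\int|(\mu-\eta)(h)|\,T^K_\eta(f,dh)$ for some nonnegative measures $T^K_\eta(f,\cdot)$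 on $\mathcal B(E_1)$ with $\sup_\eta\int\mathrm{osc}(h)T^K_\eta(f,dh)\le\mathrm{osc}(f)\,\delta(T^K)$, $\delta(T^K)<\infty$. Standing assumption (H1): for every $n\ge1$ the family $K_{n,\eta}$ satisfies (K) and $\Phi_n\in\Upsilon(E_{n-1},E_n)$. Limit fields. $(V_n)_{n\ge0}$ are independent centered Gaussian random fields on $\mathcal B(E_n)$ with $\mathbb E(V_n(f)V_n(g))=\int\eta_{n-1}(dx)\int K_{n,\eta_{n-1}}(x,dy)[f(y)-K_{n,\eta_{n-1}}(f)(x)][g(y)-K_{n,\eta_{n-1}}(g)(x)]$, with the convention for $n=0$ that $K_{0,\eta_{-1}}(x,dy)=\eta_0(dy)$ (so $\mathbb E(V_0(f)V_0(g))$ is the covariance of $f,g$ under $\eta_0$). LDP/MDP. Let $S$ be a topological space with a $\sigma$-field $\mathcal S$. Random variables $\mathcal X^N$ with values in $(S,\mathcal S)$ satisfy an LDP with speed $\alpha(N)\to\infty$ and good rate function $I:S\to[0,\infty]$ if all level sets $\{I\le a\}$, $a<\infty$, are compact and, for every $A\in\mathcal S$ with interior $A^\circ$ and closure $\overline A$, $-\inf_{A^\circ}I\le\liminf_N\frac1{\alpha(N)}\log\mathbb P(\mathcal X^N\in A)\le\limsup_N\frac1{\alpha(N)}\log\mathbb P(\mathcal X^N\in A)\le-\inf_{\overline A}I$. A sequence $\mathcal Y^N$ satisfies an MDP with speed $\alpha(N)$ and good rate function $I$ if $\mathcal Y^N/\sqrt{\alpha(N)}$ satisfies an LDP with speed $\alpha(N)$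 and good rate function $I$.
   Formalization: The measures T(f,dh) and R(f,dg) on functions, whose σ-algebra the paper leaves unspecified, are required to make the evaluations (h,x)↦h(x) and (g1,g2,x,y)↦g1(x)g2(y) jointly measurable; with only the displayed integrals meaningful, the claim can fail. *)

theory Defs
  imports "HOL-Probability.Probability"
begin

section \<open>Function spaces, oscillations and integral operators\<close>

text \<open>A measurable space is a measure space whose measure is ignored. Functions are total on
  the type; only their values on \<open>space E\<close> matter. The set of probability measures on
  \<open>E\<close> is \<open>space (prob_algebra E)\<close>.\<close>

definition bounded_meas :: "'a measure \<Rightarrow> ('a \<Rightarrow> real) set" where
  "bounded_meas E = {f \<in> borel_measurable E. bounded (f ` space E)}"

text \<open>The oscillation is \<open>ennreal\<close>-valued, so that it is \<open>\<infinity>\<close> for an unbounded function.\<close>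

definition osc :: "'a measure \<Rightarrow> ('a \<Rightarrow> real) \<Rightarrow> ennreal" where
  "osc E f = (SUP x\<in>space E. SUP y\<in>space E. ennreal \<bar>f x - f y\<bar>)"

definition Osc1 :: "'a measure \<Rightarrow> ('a \<Rightarrow> real) set" where
  "Osc1 E = {f \<in> borel_measurable E. osc E f \<le> 1}"

definition sup_norm :: "'a measure \<Rightarrow> ('a \<Rightarrow> real) \<Rightarrow> ennreal" where
  "sup_norm E f = (SUP x\<in>space E. ennreal \<bar>f x\<bar>)"

text \<open>The finite signed measure \<open>M(x, dy)\<close> is given as a difference \<open>Kp x - Km x\<close> of two finite
  measures (Hahn--Jordan).\<close>

definition bounded_integral_operator ::
    "'a measure \<Rightarrow> 'b measure \<Rightarrow> (('b \<Rightarrow> real) \<Rightarrow> ('a \<Rightarrow> real)) \<Rightarrow> bool" where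
  "bounded_integral_operator E F M \<longleftrightarrow>
    (\<exists>Kp Km. (\<forall>x\<in>space E. finite_measure (Kp x) \<and> sets (Kp x) = sets F \<and>
                          finite_measure (Km x) \<and> sets (Km x) = sets F) \<and>
       (\<forall>f\<in>bounded_meas F. \<forall>x\<in>space E.
          M f x = (\<integral>y. f y \<partial>Kp x) - (\<integral>y. f y \<partial>Km x))) \<and>
    (\<forall>f\<in>bounded_meas F. M f \<in> bounded_meas E) \<and>
    (\<exists>C<\<infinity>. \<forall>f\<in>bounded_meas F. sup_norm E (M f) \<le> C * sup_norm F f)"

definition beta :: "'a measure \<Rightarrow> 'b measure \<Rightarrow> (('b \<Rightarrow> real) \<Rightarrow> ('a \<Rightarrow> real)) \<Rightarrow> ennreal" where
  "beta E F M = (SUP f\<in>Osc1 F. osc E (M f))"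


section \<open>Regularity conditions\<close>

text \<open>
  A nonnegative measure on functions carries its own \<open>\<sigma>\<close>-algebra, which may be the trace on a
  subset of the function space. It is required that the evaluation map
  \<open>(h, x) \<mapsto> h x\<close> is jointly measurable and that the oscillation is measurable. Then all
  integrals below are integrals of measurable functions and the integrals over \<open>x\<close> and over
  \<open>h\<close> may be exchanged. If \<open>h \<mapsto> \<mu>(h)\<close> is only measurable for each fixed \<open>\<mu>\<close>, this
  exchange fails (Sierpinski's example, under the continuum hypothesis).
\<close>

definition function_measure :: "'a measure \<Rightarrow> ('a \<Rightarrow> real) measure \<Rightarrow> bool" where
  "function_measure E T \<longleftrightarrow>
     space T \<subseteq> bounded_meas E \<and>
     (\<lambda>(h, x). h x) \<in> borel_measurable (T \<Otimes>\<^sub>M E) \<and>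
     osc E \<in> borel_measurable T"

text \<open>A tensor product \<open>g1 \<otimes> g2\<close> is represented by the pair \<open>(g1, g2)\<close>.\<close>

definition tensor_measure :: "'a measure \<Rightarrow> (('a \<Rightarrow> real) \<times> ('a \<Rightarrow> real)) measure \<Rightarrow> bool" where
  "tensor_measure E R \<longleftrightarrow>
     space R \<subseteq> Osc1 E \<times> Osc1 E \<and>
     (\<lambda>((g1, g2), (x, y)). g1 x * g2 y) \<in> borel_measurable (R \<Otimes>\<^sub>M (E \<Otimes>\<^sub>M E)) \<and>
     (\<lambda>(g1, g2). osc E g1 * osc E g2) \<in> borel_measurable R"

text \<open>The class \<open>\<Upsilon>(E1, E2)\<close>. The remainder \<open>Rem \<mu> \<eta> f\<close> is defined by the first order expansion
  of \<open>\<Phi>\<close>; \<open>(\<mu> - \<eta>)\<^sup>\<otimes>\<^sup>2(g1 \<otimes> g2)\<close> is the product of \<open>(\<mu> - \<eta>)(g1)\<close> and \<open>(\<mu> - \<eta>)(g2)\<close>.\<close>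

definition Upsilon :: "'a measure \<Rightarrow> 'b measure \<Rightarrow> ('a measure \<Rightarrow> 'b measure) \<Rightarrow> bool" where
  "Upsilon E1 E2 \<Phi> \<longleftrightarrow>
     (\<forall>\<mu>\<in>space (prob_algebra E1). \<Phi> \<mu> \<in> space (prob_algebra E2)) \<and>
     (\<exists>(D :: 'a measure \<Rightarrow> ('b \<Rightarrow> real) \<Rightarrow> 'a \<Rightarrow> real)
       (Rem :: 'a measure \<Rightarrow> 'a measure \<Rightarrow> ('b \<Rightarrow> real) \<Rightarrow> real)
       (R :: 'a measure \<Rightarrow> ('b \<Rightarrow> real) \<Rightarrow> (('a \<Rightarrow> real) \<times> ('a \<Rightarrow> real)) measure)
       (\<delta> :: ennreal).
        (\<forall>\<mu>\<in>space (prob_algebra E1). \<forall>\<eta>\<in>space (prob_algebra E1). \<forall>f\<in>bounded_meas E2.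
           (\<integral>y. f y \<partial>\<Phi> \<mu>) - (\<integral>y. f y \<partial>\<Phi> \<eta>) =
             ((\<integral>x. D \<eta> f x \<partial>\<mu>) - (\<integral>x. D \<eta> f x \<partial>\<eta>)) + Rem \<mu> \<eta> f) \<and>
        (\<forall>\<eta>\<in>space (prob_algebra E1).
           bounded_integral_operator E1 E2 (D \<eta>) \<and>
           (\<forall>x\<in>space E1. D \<eta> (\<lambda>_. 1) x = 0)) \<and>
        (SUP \<eta>\<in>space (prob_algebra E1). beta E1 E2 (D \<eta>)) < \<infinity> \<and>
        (\<forall>\<eta>\<in>space (prob_algebra E1). \<forall>f\<in>bounded_meas E2. tensor_measure E1 (R \<eta> f)) \<and>
        (\<forall>\<mu>\<in>space (prob_algebra E1). \<forall>\<eta>\<in>space (prob_algebra E1). \<forall>f\<in>bounded_meas E2.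
           ennreal \<bar>Rem \<mu> \<eta> f\<bar> \<le>
             (\<integral>\<^sup>+ (g1, g2). ennreal \<bar>((\<integral>x. g1 x \<partial>\<mu>) - (\<integral>x. g1 x \<partial>\<eta>)) *
                                ((\<integral>x. g2 x \<partial>\<mu>) - (\<integral>x. g2 x \<partial>\<eta>))\<bar> \<partial>R \<eta> f)) \<and>
        (\<forall>f\<in>bounded_meas E2.
           (SUP \<eta>\<in>space (prob_algebra E1). \<integral>\<^sup>+ (g1, g2). osc E1 g1 * osc E1 g2 \<partial>R \<eta> f)
             \<le> osc E2 f * \<delta>) \<and>
        \<delta> < \<infinity>)"

definition cond_K ::
    "'a measure \<Rightarrow> 'b measure \<Rightarrow> ('a measure \<Rightarrow> 'a \<Rightarrow> 'b measure) \<Rightarrow> bool" where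
  "cond_K E1 E2 K \<longleftrightarrow>
     (\<exists>(T :: 'a measure \<Rightarrow> ('b \<Rightarrow> real) \<Rightarrow> ('a \<Rightarrow> real) measure) (\<delta> :: ennreal).
        (\<forall>\<eta>\<in>space (prob_algebra E1). \<forall>f\<in>Osc1 E2. function_measure E1 (T \<eta> f)) \<and>
        (\<forall>\<mu>\<in>space (prob_algebra E1). \<forall>\<eta>\<in>space (prob_algebra E1). \<forall>f\<in>Osc1 E2.
           sup_norm E1 (\<lambda>x. (\<integral>y. f y \<partial>K \<mu> x) - (\<integral>y. f y \<partial>K \<eta> x)) \<le>
             (\<integral>\<^sup>+ h. ennreal \<bar>(\<integral>x. h x \<partial>\<mu>) - (\<integral>x. h x \<partial>\<eta>)\<bar> \<partial>T \<eta> f)) \<and>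
        (\<forall>f\<in>Osc1 E2.
           (SUP \<eta>\<in>space (prob_algebra E1). \<integral>\<^sup>+ h. osc E1 h \<partial>T \<eta> f) \<le> osc E2 f * \<delta>) \<and>
        \<delta> < \<infinity>)"


section \<open>The mean field model and its particle approximation\<close>

definition Phi :: "(nat \<Rightarrow> 'a measure \<Rightarrow> 'a \<Rightarrow> 'a measure) \<Rightarrow> nat \<Rightarrow> 'a measure \<Rightarrow> 'a measure" where
  "Phi K n \<eta> = \<eta> \<bind> K n \<eta>"

primrec flow :: "(nat \<Rightarrow> 'a measure \<Rightarrow> 'a \<Rightarrow> 'a measure) \<Rightarrow> 'a measure \<Rightarrow> nat \<Rightarrow> 'a measure" where
  "flow K \<eta>0 0 = \<eta>0"
| "flow K \<eta>0 (Suc n) = Phi K (Suc n) (flow K \<eta>0 n)"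

text \<open>Pushing the uniform distribution on \<open>{1..N}\<close> forward along \<open>i \<mapsto> x i\<close> gives
  \<open>1/N * (\<Sum>j=1..N. \<delta>(x j))\<close>.\<close>

definition empirical :: "'a measure \<Rightarrow> nat \<Rightarrow> (nat \<Rightarrow> 'a) \<Rightarrow> 'a measure" where
  "empirical E N x = distr (uniform_count_measure {1..N}) E x"

text \<open>All the \<open>E n\<close> live on one type, which is no restriction since they need not have the same
  carrier. Only the kernels \<open>K n\<close> with \<open>n \<ge> 1\<close> are used.\<close>

definition mean_field_model ::
    "(nat \<Rightarrow> 'a measure) \<Rightarrow> (nat \<Rightarrow> 'a measure \<Rightarrow> 'a \<Rightarrow> 'a measure) \<Rightarrow> 'a measure \<Rightarrow> bool" where
  "mean_field_model E K \<eta>0 \<longleftrightarrow>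
     \<eta>0 \<in> space (prob_algebra (E 0)) \<and>
     (\<forall>n. \<forall>\<eta>\<in>space (prob_algebra (E n)). K (Suc n) \<eta> \<in> E n \<rightarrow>\<^sub>M prob_algebra (E (Suc n))) \<and>
     (\<forall>n. \<forall>N\<ge>1. \<forall>i\<in>{1..N}. \<forall>A\<in>sets (E (Suc n)).
        (\<lambda>x. measure (K (Suc n) (empirical (E n) N x) (x i)) A)
          \<in> borel_measurable (PiM {1..N} (\<lambda>_. E n)))"

text \<open>The \<open>\<sigma>\<close>-algebra generated by \<open>\<xi> 0, \<dots>, \<xi> n\<close>.\<close>

definition history :: "(nat \<Rightarrow> 'a measure) \<Rightarrow> nat \<Rightarrow> 'w measure \<Rightarrow> (nat \<Rightarrow> 'w \<Rightarrow> nat \<Rightarrow> 'a) \<Rightarrow> nat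
    \<Rightarrow> 'w measure" where
  "history E N M \<xi> n =
     vimage_algebra (space M) (\<lambda>\<omega>. \<lambda>k\<in>{0..n}. \<xi> k \<omega>)
       (PiM {0..n} (\<lambda>k. PiM {1..N} (\<lambda>_. E k)))"

text \<open>\<open>\<xi> n \<omega> i\<close> is the \<open>i\<close>-th particle at time \<open>n\<close>. Conditional independence with the given
  marginals is expressed by the conditional probabilities of product sets.\<close>

definition particle_system ::
    "(nat \<Rightarrow> 'a measure) \<Rightarrow> (nat \<Rightarrow> 'a measure \<Rightarrow> 'a \<Rightarrow> 'a measure) \<Rightarrow> 'a measure \<Rightarrow> nat
      \<Rightarrow> 'w measure \<Rightarrow> (nat \<Rightarrow> 'w \<Rightarrow> nat \<Rightarrow> 'a) \<Rightarrow> bool" where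
  "particle_system E K \<eta>0 N M \<xi> \<longleftrightarrow>
     prob_space M \<and>
     (\<forall>n. \<xi> n \<in> M \<rightarrow>\<^sub>M PiM {1..N} (\<lambda>_. E n)) \<and>
     prob_space.indep_vars M (\<lambda>_. E 0) (\<lambda>i \<omega>. \<xi> 0 \<omega> i) {1..N} \<and>
     (\<forall>i\<in>{1..N}. distr M (E 0) (\<lambda>\<omega>. \<xi> 0 \<omega> i) = \<eta>0) \<and>
     (\<forall>n A. (\<forall>i\<in>{1..N}. A i \<in> sets (E (Suc n))) \<longrightarrow>
        (AE \<omega> in M.
           real_cond_exp M (history E N M \<xi> n)
               (indicat_real {\<omega>'\<in>space M. \<forall>i\<in>{1..N}. \<xi> (Suc n) \<omega>' i \<in> A i}) \<omega> =
           (\<Prod>i\<in>{1..N}. measure (K (Suc n) (empirical (E n) N (\<xi> n \<omega>)) (\<xi> n \<omega> i)) (A i))))"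

text \<open>The fluctuation field \<open>V\<^sub>n\<^sup>N(f)\<close> as a function of a particle trajectory \<open>x\<close>.\<close>

fun fluctuation ::
    "(nat \<Rightarrow> 'a measure) \<Rightarrow> (nat \<Rightarrow> 'a measure \<Rightarrow> 'a \<Rightarrow> 'a measure) \<Rightarrow> 'a measure \<Rightarrow> nat
      \<Rightarrow> (nat \<Rightarrow> nat \<Rightarrow> 'a) \<Rightarrow> nat \<Rightarrow> ('a \<Rightarrow> real) \<Rightarrow> real" where
  "fluctuation E K \<eta>0 N x 0 f =
     sqrt (real N) * ((\<integral>y. f y \<partial>empirical (E 0) N (x 0)) - (\<integral>y. f y \<partial>\<eta>0))"
| "fluctuation E K \<eta>0 N x (Suc n) f =
     sqrt (real N) * ((\<integral>y. f y \<partial>empirical (E (Suc n)) N (x (Suc n))) -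
                      (\<integral>y. f y \<partial>Phi K (Suc n) (empirical (E n) N (x n))))"


section \<open>The limiting Gaussian fields\<close>

fun limit_cov ::
    "(nat \<Rightarrow> 'a measure \<Rightarrow> 'a \<Rightarrow> 'a measure) \<Rightarrow> 'a measure \<Rightarrow> nat
      \<Rightarrow> ('a \<Rightarrow> real) \<Rightarrow> ('a \<Rightarrow> real) \<Rightarrow> real" where
  "limit_cov K \<eta>0 0 f g =
     (\<integral>y. (f y - (\<integral>z. f z \<partial>\<eta>0)) * (g y - (\<integral>z. g z \<partial>\<eta>0)) \<partial>\<eta>0)"
| "limit_cov K \<eta>0 (Suc n) f g =
     (let \<eta> = flow K \<eta>0 n; k = K (Suc n) \<eta> in
      \<integral>x. (\<integral>y. (f y - (\<integral>z. f z \<partial>k x)) * (g y - (\<integral>z. g z \<partial>k x)) \<partial>k x) \<partial>\<eta>)"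

text \<open>The degenerate law \<open>\<delta>\<^sub>0\<close> counts as Gaussian.\<close>

definition centered_gaussian :: "'v measure \<Rightarrow> ('v \<Rightarrow> real) \<Rightarrow> bool" where
  "centered_gaussian \<Omega> X \<longleftrightarrow>
     X \<in> borel_measurable \<Omega> \<and>
     ((\<exists>\<sigma>>0. distributed \<Omega> lborel X (normal_density 0 \<sigma>)) \<or> (AE \<omega> in \<Omega>. X \<omega> = 0))"

definition centered_gaussian_field ::
    "'v measure \<Rightarrow> 'i set \<Rightarrow> ('i \<Rightarrow> 'v \<Rightarrow> real) \<Rightarrow> bool" where
  "centered_gaussian_field \<Omega> B W \<longleftrightarrow>
     (\<forall>F c. finite F \<and> F \<subseteq> B \<longrightarrow> centered_gaussian \<Omega> (\<lambda>\<omega>. \<Sum>f\<in>F. c f * W f \<omega>))"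

definition limit_fields ::
    "(nat \<Rightarrow> 'a measure) \<Rightarrow> (nat \<Rightarrow> 'a measure \<Rightarrow> 'a \<Rightarrow> 'a measure) \<Rightarrow> 'a measure
      \<Rightarrow> 'v measure \<Rightarrow> (nat \<Rightarrow> ('a \<Rightarrow> real) \<Rightarrow> 'v \<Rightarrow> real) \<Rightarrow> bool" where
  "limit_fields E K \<eta>0 \<Omega> V \<longleftrightarrow>
     prob_space \<Omega> \<and>
     (\<forall>n. centered_gaussian_field \<Omega> (bounded_meas (E n)) (V n)) \<and>
     prob_space.indep_vars \<Omega> (\<lambda>n. PiM (bounded_meas (E n)) (\<lambda>_. borel))
       (\<lambda>n \<omega>. \<lambda>f\<in>bounded_meas (E n). V n f \<omega>) UNIV \<and>
     (\<forall>n. \<forall>f\<in>bounded_meas (E n). \<forall>g\<in>bounded_meas (E n).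
        (\<integral>\<omega>. V n f \<omega> * V n g \<omega> \<partial>\<Omega>) = limit_cov K \<eta>0 n f g)"


section \<open>Large and moderate deviations\<close>

definition log_prob :: "real \<Rightarrow> ereal" where
  "log_prob p = (if p = 0 then -\<infinity> else ereal (ln p))"

text \<open>\<open>X N\<close> is defined on its own probability space \<open>M N\<close>; only indices \<open>N \<ge> 1\<close> matter.\<close>

definition LDP ::
    "'s topology \<Rightarrow> 's measure \<Rightarrow> (nat \<Rightarrow> 'w measure) \<Rightarrow> (nat \<Rightarrow> 'w \<Rightarrow> 's)
      \<Rightarrow> (nat \<Rightarrow> real) \<Rightarrow> ('s \<Rightarrow> ereal) \<Rightarrow> bool" where
  "LDP T S M X \<alpha> I \<longleftrightarrow>
     filterlim \<alpha> at_top sequentially \<and>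
     (\<forall>N\<ge>1. X N \<in> M N \<rightarrow>\<^sub>M S) \<and>
     (\<forall>x\<in>topspace T. 0 \<le> I x) \<and>
     (\<forall>a::real. compactin T {x\<in>topspace T. I x \<le> ereal a}) \<and>
     (\<forall>A\<in>sets S.
        (let r = (\<lambda>N. log_prob (measure (M N) (X N -` A \<inter> space (M N))) / ereal (\<alpha> N)) in
           - (INF x\<in>T interior_of A. I x) \<le> liminf r \<and>
           liminf r \<le> limsup r \<and>
           limsup r \<le> - (INF x\<in>T closure_of A. I x)))"

text \<open>Moderate deviations in the Euclidean space \<open>\<real>\<^sup>J\<close>, \<open>J\<close> a finite index set, realised as the
  extensional functions on \<open>J\<close> with the product topology and its Borel \<open>\<sigma>\<close>-algebra.\<close>

definition MDP ::
    "'j set \<Rightarrow> (nat \<Rightarrow> 'w measure) \<Rightarrow> (nat \<Rightarrow> 'w \<Rightarrow> 'j \<Rightarrow> real)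
      \<Rightarrow> (nat \<Rightarrow> real) \<Rightarrow> (('j \<Rightarrow> real) \<Rightarrow> ereal) \<Rightarrow> bool" where
  "MDP J M Y \<alpha> I \<longleftrightarrow>
     LDP (product_topology (\<lambda>_. euclideanreal) J) (PiM J (\<lambda>_. borel)) M
       (\<lambda>N \<omega>. \<lambda>j\<in>J. Y N \<omega> j / sqrt (\<alpha> N)) \<alpha> I"

text \<open>\<open>I\<^sup>V\<^sub>\<F>(v)\<close> for the random field \<open>W\<close> and the finite family \<open>\<F> = (f 1, \<dots>, f d)\<close>.\<close>

definition rate ::
    "'v measure \<Rightarrow> (('a \<Rightarrow> real) \<Rightarrow> 'v \<Rightarrow> real) \<Rightarrow> nat \<Rightarrow> (nat \<Rightarrow> 'a \<Rightarrow> real)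
      \<Rightarrow> (nat \<Rightarrow> real) \<Rightarrow> ereal" where
  "rate \<Omega> W d f v =
     (SUP u\<in>{1..d} \<rightarrow>\<^sub>E UNIV.
        ereal ((\<Sum>i=1..d. u i * v i) - 1/2 * (\<integral>\<omega>. (\<Sum>i=1..d. u i * W (f i) \<omega>)\<^sup>2 \<partial>\<Omega>)))"

end

theory Submission
  imports Defs
begin

text \<open>
  By induction over the time \<open>p\<close>, the scaled logarithm of the Laplace transform of
  \<open>(V\<^sub>0\<^sup>N, \<dots>, V\<^sub>n\<^sup>N)\<close> converges to half the limiting variance: given the past, the
  fluctuation \<open>V\<^sub>p\<^sup>N(f)\<close> is a sum of independent centered terms, so a second order expansion
  yields the factor \<open>exp (\<alpha>(N) \<sigma>\<^sub>N\<^sup>2 / 2 + o(\<alpha>(N)))\<close> with a random conditional variance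
  \<open>\<sigma>\<^sub>N\<^sup>2\<close>. This variance is exponentially close, at speed \<open>N\<close> and hence superexponentially at speed
  \<open>\<alpha>(N)\<close>, to its deterministic limit: sub-Gaussian bounds \<open>E exp (t |X|) \<le> C exp (c t\<^sup>2 / N)\<close>
  are transported from \<open>\<eta>\<^sub>p\<^sup>N\<close> to \<open>\<eta>\<^sub>p\<^sub>+\<^sub>1\<^sup>N\<close> by Hoeffding's lemma and the expansion of
  \<open>\<Phi>\<^sub>p\<^sub>+\<^sub>1\<close>, and Jensen's inequality moves them inside the integrals against the measures on
  functions in the regularity conditions. The limit being quadratic, the Gaertner--Ellis argument
  (half-spaces for the upper bound, exponential tilting for the lower bound) gives the deviation
  principle even when the covariance is degenerate.
\<close>

section \<open>Large deviations from a quadratic limit of Laplace transforms\<close>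

text \<open>The conditional variance stands under the same expectation as the weight of the earlier
  times, so it cannot simply be replaced by its limit. It is traded for the limit by means of the
  second moment of the earlier weight. That moment has a rate of its own: squaring the weight
  amounts to doubling the test functions, and the induction runs over all test functions at once.
  The trade is free because \<open>\<alpha> N / real N\<close> tends to 0: an exponential moment of
  order \<open>t = k * \<alpha> N\<close> of a quantity with bound \<open>exp (c * t^2 / N)\<close>
  costs only exp(o(\<alpha> N)). Here k is arbitrary, so the sub-Gaussian bounds are needed for
  every order t and not just for small t. The quadratic remainder of the expansion of
  \<open>Phi\<close> threatens exactly this, since squares of sub-Gaussian variables have no such
  moments. As each factor of the remainder is bounded by an oscillation, one factor is given up and
  the rest is linear in the deviation. Logarithmic limits are written with exponentials
  (\<open>exp_rate\<close>), the form that can be used directly under integrals and finite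
  sums.\<close>

definition exp_rate :: "(nat \<Rightarrow> real) \<Rightarrow> (nat \<Rightarrow> real) \<Rightarrow> real \<Rightarrow> bool" where
  "exp_rate \<alpha> L l \<longleftrightarrow> (\<forall>\<epsilon>>0. \<forall>\<^sub>F N in sequentially.
     exp (\<alpha> N * (l - \<epsilon>)) \<le> L N \<and> L N \<le> exp (\<alpha> N * (l + \<epsilon>)))"

lemma exp_rateD_le:
  assumes "exp_rate \<alpha> L l" "l < c"
  shows "\<forall>\<^sub>F N in sequentially. L N \<le> exp (\<alpha> N * c)"
  using assms(1)[unfolded exp_rate_def, rule_format, of "c - l"] assms(2)
  by (auto elim: eventually_mono)

lemma exp_rateD_ge:
  assumes "exp_rate \<alpha> L l" "c < l"
  shows "\<forall>\<^sub>F N in sequentially. exp (\<alpha> N * c) \<le> L N"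
  using assms(1)[unfolded exp_rate_def, rule_format, of "l - c"] assms(2)
  by (auto elim: eventually_mono)

lemma exp_rate_cong:
  assumes "exp_rate \<alpha> L l" "\<forall>\<^sub>F N in sequentially. L N = L' N"
  shows "exp_rate \<alpha> L' l"
  unfolding exp_rate_def
proof (intro allI impI)
  fix \<epsilon> :: real assume "0 < \<epsilon>"
  with assms(1) have "\<forall>\<^sub>F N in sequentially. exp (\<alpha> N * (l - \<epsilon>)) \<le> L N \<and> L N \<le> exp (\<alpha> N * (l + \<epsilon>))"
    by (simp add: exp_rate_def)
  with assms(2) show "\<forall>\<^sub>F N in sequentially. exp (\<alpha> N * (l - \<epsilon>)) \<le> L' N \<and> L' N \<le> exp (\<alpha> N * (l + \<epsilon>))"
    by eventually_elim simp
qed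

text \<open>Constant prefactors, such as the number of half-spaces in a cover, are invisible at
  speed \<alpha>.\<close>

lemma eventually_const_le_exp:
  assumes "filterlim \<alpha> at_top sequentially" "e > 0"
  shows "\<forall>\<^sub>F N in sequentially. C \<le> exp (\<alpha> N * e :: real)"
proof -
  have "filterlim (\<lambda>N. exp (\<alpha> N * e)) at_top sequentially"
    by (intro filterlim_compose[OF exp_at_top] filterlim_at_top_mult_tendsto_pos[OF tendsto_const] assms)
  then show ?thesis by (simp add: filterlim_at_top)
qed

section \<open>Positive semidefinite forms and their Legendre transforms\<close>

definition inner_on :: "'j set \<Rightarrow> ('j \<Rightarrow> real) \<Rightarrow> ('j \<Rightarrow> real) \<Rightarrow> real" where
  "inner_on J u v = (\<Sum>j\<in>J. u j * v j)"

definition mat_vec :: "'j set \<Rightarrow> ('j \<Rightarrow> 'j \<Rightarrow> real) \<Rightarrow> ('j \<Rightarrow> real) \<Rightarrow> 'j \<Rightarrow> real" where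
  "mat_vec J S u i = (\<Sum>j\<in>J. S i j * u j)"

abbreviation unit_vec :: "'j \<Rightarrow> 'j \<Rightarrow> real" where
  "unit_vec j \<equiv> (\<lambda>i. if i = j then 1 else 0)"

lemma inner_on_add_scaled:
  "inner_on J (\<lambda>i. u i + c * w i) v = inner_on J u v + c * inner_on J w v"
  by (simp add: inner_on_def algebra_simps sum.distrib sum_distrib_left)

lemma inner_on_scaled: "inner_on J (\<lambda>i. c * w i) v = c * inner_on J w v"
  by (simp add: inner_on_def algebra_simps sum_distrib_left)

lemma inner_on_unit_vec: "finite J \<Longrightarrow> j \<in> J \<Longrightarrow> inner_on J (unit_vec j) v = v j"
  by (simp add: inner_on_def if_distrib[of "\<lambda>x. x * _"] cong: if_cong)

lemma inner_on_cong: "(\<And>j. j \<in> J \<Longrightarrow> u j = u' j) \<Longrightarrow> (\<And>j. j \<in> J \<Longrightarrow> v j = v' j) \<Longrightarrow> inner_on J u v = inner_on J u' v'"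
  by (simp add: inner_on_def)

lemma mat_vec_cong: "(\<And>j. j \<in> J \<Longrightarrow> u j = u' j) \<Longrightarrow> mat_vec J S u = mat_vec J S u'"
  by (simp add: mat_vec_def fun_eq_iff)

lemma mat_vec_add_scaled: "mat_vec J S (\<lambda>i. u i + c * w i) = (\<lambda>i. mat_vec J S u i + c * mat_vec J S w i)"
  by (simp add: mat_vec_def fun_eq_iff algebra_simps sum.distrib sum_distrib_left)

lemma mat_vec_unit_vec: "finite J \<Longrightarrow> j \<in> J \<Longrightarrow> mat_vec J S (unit_vec j) i = S i j"
  by (simp add: mat_vec_def if_distrib[of "\<lambda>x. _ * x"] cong: if_cong)

locale psd_form =
  fixes J :: "'j set" and S :: "'j \<Rightarrow> 'j \<Rightarrow> real"
  assumes finite_J: "finite J"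
    and symmetric: "i \<in> J \<Longrightarrow> j \<in> J \<Longrightarrow> S i j = S j i"
    and psd: "0 \<le> inner_on J u (mat_vec J S u)"
begin

abbreviation ip where "ip \<equiv> inner_on J"

definition quad :: "('j \<Rightarrow> real) \<Rightarrow> real" where
  "quad u = ip u (mat_vec J S u)"

lemma quad_cong: "(\<And>j. j \<in> J \<Longrightarrow> u j = u' j) \<Longrightarrow> quad u = quad u'"
  unfolding quad_def using mat_vec_cong[of J u u' S] by (auto intro: inner_on_cong)

lemma quad_nonneg: "0 \<le> quad u"
  by (simp add: quad_def psd)

lemma ip_mat_vec_commute: "ip u (mat_vec J S w) = ip w (mat_vec J S u)"
proof -
  have "ip u (mat_vec J S w) = (\<Sum>i\<in>J. \<Sum>j\<in>J. u i * (S i j * w j))"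
    by (simp add: inner_on_def mat_vec_def sum_distrib_left)
  also have "\<dots> = (\<Sum>j\<in>J. \<Sum>i\<in>J. u i * (S i j * w j))"
    by (rule sum.swap)
  also have "\<dots> = ip w (mat_vec J S u)"
    by (auto simp: inner_on_def mat_vec_def sum_distrib_left symmetric intro!: sum.cong)
  finally show ?thesis .
qed

text \<open>The exact second-order expansion along a line. It governs both the perturbation of
  near-maximisers and the choice of the tilts in the lower bound.\<close>

lemma quad_add_scaled:
  "quad (\<lambda>i. u i + c * w i) = quad u + 2 * c * ip w (mat_vec J S u) + c\<^sup>2 * quad w"
proof -
  have r: "ip v (\<lambda>i. a i + c * b i) = ip v a + c * ip v b" for v a b
    by (simp add: inner_on_def algebra_simps sum.distrib sum_distrib_left)
  show ?thesis
    unfolding quad_def mat_vec_add_scaled inner_on_add_scaled r ip_mat_vec_commute[of u w]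
    by (simp add: algebra_simps power2_eq_square)
qed

lemma quad_unit_vec: "j \<in> J \<Longrightarrow> quad (unit_vec j) = S j j"
  by (simp add: quad_def inner_on_unit_vec mat_vec_unit_vec finite_J)

lemma quad_scaled: "quad (\<lambda>i. c * w i) = c\<^sup>2 * quad w"
  by (simp add: quad_def inner_on_def mat_vec_def sum_distrib_left power2_eq_square mult_ac)

lemma diag_nonneg: "j \<in> J \<Longrightarrow> 0 \<le> S j j"
  using quad_nonneg[of "unit_vec j"] by (simp add: quad_unit_vec)

definition legendre :: "('j \<Rightarrow> real) \<Rightarrow> ereal" where
  "legendre v = (SUP u\<in>J \<rightarrow>\<^sub>E UNIV. ereal (ip u v - 1/2 * quad u))"

text \<open>Frees the test vectors from being extensional, since \<open>ip\<close> and
  \<open>quad\<close> read only the coordinates in J.\<close>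

lemma legendre_ge: "ereal (ip u v - 1/2 * quad u) \<le> legendre v"
proof -
  have "ip u v - 1/2 * quad u = ip (restrict u J) v - 1/2 * quad (restrict u J)"
    using quad_cong[of "restrict u J" u] inner_on_cong[of J "restrict u J" u v v] by simp
  then show ?thesis
    unfolding legendre_def by (intro SUP_upper2[of "restrict u J"]) auto
qed

lemma legendre_nonneg: "0 \<le> legendre v"
  using legendre_ge[of "\<lambda>_. 0" v] by (simp add: quad_def inner_on_def zero_ereal_def)

abbreviation JT where "JT \<equiv> product_topology (\<lambda>_. euclideanreal) J"

lemma continuous_ip: "continuous_map JT euclideanreal (\<lambda>v. ip u v - c)"
  unfolding inner_on_def
  by (intro continuous_intros continuous_map_sum continuous_map_real_mult_left finite_J
      continuous_map_product_projection)

lemma open_halfspace: "openin JT {v \<in> topspace JT. a < ip u v - c}"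
  using openin_continuous_map_preimage[OF continuous_ip, of "{a<..}"] by simp

lemma closed_halfspace: "closedin JT {v \<in> topspace JT. ip u v - c \<le> a}"
  using closedin_continuous_map_preimage[OF continuous_ip, of "{..a}"] by simp

lemma compact_box: "compactin JT (\<Pi>\<^sub>E j\<in>J. {- L j..L j})"
  by (simp add: compactin_PiE)

text \<open>Far from the origin the signed unit vectors suffice as test vectors: they give the value
  \<open>\<bar>v j\<bar> - S j j / 2\<close>, which explains the half-width of the box. These
  finitely many vectors do the work of exponential tightness.\<close>

lemma outside_boxE:
  assumes v: "v \<in> topspace JT" "v \<notin> (\<Pi>\<^sub>E j\<in>J. {- (b + 1/2 * S j j)..b + 1/2 * S j j})"
  obtains j s where "j \<in> J" "s \<in> {1, -1}"
    "b < ip (\<lambda>i. s * unit_vec j i) v - 1/2 * quad (\<lambda>i. s * unit_vec j i)"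
proof -
  from v obtain j where j: "j \<in> J" "\<not> \<bar>v j\<bar> \<le> b + 1/2 * S j j"
    by (force simp: PiE_def Pi_def abs_le_iff)
  show ?thesis
  proof (rule that[OF j(1), of "if v j \<ge> 0 then 1 else -1"])
    show "b < ip (\<lambda>i. (if v j \<ge> 0 then 1 else -1) * unit_vec j i) v
        - 1/2 * quad (\<lambda>i. (if v j \<ge> 0 then 1 else -1) * unit_vec j i)"
      using j unfolding quad_scaled inner_on_scaled
      by (auto simp: inner_on_unit_vec finite_J quad_unit_vec)
  qed auto
qed

text \<open>As a supremum of continuous functions \<open>legendre\<close> has closed level sets, and
  by \<open>outside_boxE\<close> these lie in a compact box.\<close>

lemma compact_legendre_level: "compactin JT {v \<in> topspace JT. legendre v \<le> ereal a}"
proof (rule closed_compactin[OF compact_box])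
  let ?b = "\<lambda>j. a + 1/2 * S j j"
  show "{v \<in> topspace JT. legendre v \<le> ereal a} \<subseteq> (\<Pi>\<^sub>E j\<in>J. {- ?b j..?b j})"
  proof
    fix v assume v: "v \<in> {v \<in> topspace JT. legendre v \<le> ereal a}"
    show "v \<in> (\<Pi>\<^sub>E j\<in>J. {- ?b j..?b j})"
    proof (rule ccontr)
      assume "v \<notin> (\<Pi>\<^sub>E j\<in>J. {- ?b j..?b j})"
      with v obtain u where u: "a < ip u v - 1/2 * quad u"
        by (metis (no_types, lifting) mem_Collect_eq outside_boxE)
      with legendre_ge[of u v] v have "ereal (ip u v - 1/2 * quad u) \<le> ereal a"
        by (blast intro: order_trans)
      with u show False by simp
    qed
  qed
  have "{v \<in> topspace JT. legendre v \<le> ereal a}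
      = (\<Inter>u\<in>J \<rightarrow>\<^sub>E UNIV. {v \<in> topspace JT. ip u v - 1/2 * quad u \<le> a})"
    unfolding legendre_def SUP_le_iff ereal_less_eq
    using PiE_eq_empty_iff[of J "\<lambda>_. UNIV::real set"] by auto
  also have "closedin JT \<dots>"
    by (intro closedin_INT closed_halfspace) (auto simp: PiE_eq_empty_iff)
  finally show "closedin JT {v \<in> topspace JT. legendre v \<le> ereal a}" .
qed

text \<open>Compactness gives finitely many half-spaces for the part of F inside the box; outside
  the box the signed unit vectors are enough. Thus closed sets that are not compact need no separate
  treatment in the upper bound.\<close>

lemma closed_halfspace_cover:
  assumes F: "closedin JT F" and a: "\<And>v. v \<in> F \<Longrightarrow> ereal a < legendre v"
  obtains U where "finite U" "\<And>v. v \<in> F \<Longrightarrow> \<exists>u\<in>U. a < ip u v - 1/2 * quad u"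
proof -
  define B where "B = (\<Pi>\<^sub>E j\<in>J. {- (a + 1/2 * S j j)..a + 1/2 * S j j})"
  define H where "H u = {v \<in> topspace JT. a < ip u v - 1/2 * quad u}" for u
  have FB: "compactin JT (F \<inter> B)"
    unfolding B_def by (rule closed_Int_compactin[OF F compact_box])
  have "F \<inter> B \<subseteq> \<Union> (range H)"
  proof
    fix v assume v: "v \<in> F \<inter> B"
    with a have "ereal a < legendre v" by auto
    then obtain u where "a < ip u v - 1/2 * quad u"
      by (auto simp: legendre_def less_SUP_iff)
    moreover have "v \<in> topspace JT" using F v closedin_subset by blast
    ultimately show "v \<in> \<Union> (range H)" by (auto simp: H_def)
  qed
  moreover have "openin JT W" if "W \<in> range H" for W
    using that open_halfspace by (auto simp: H_def)
  ultimately obtain \<F> where \<F>: "finite \<F>" "\<F> \<subseteq> range H" "F \<inter> B \<subseteq> \<Union> \<F>"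
    using FB unfolding compactin_def by (metis (no_types, lifting))
  then obtain U0 where U0: "finite U0" "\<F> = H ` U0"
    by (meson finite_subset_image)
  define U1 where "U1 = (\<lambda>(j, s) i. s * unit_vec j i) ` (J \<times> {1, -1::real})"
  show ?thesis
  proof (rule that[of "U0 \<union> U1"])
    show "finite (U0 \<union> U1)" using U0 finite_J by (simp add: U1_def)
    fix v assume v: "v \<in> F"
    have vT: "v \<in> topspace JT" using F v closedin_subset by blast
    show "\<exists>u\<in>U0 \<union> U1. a < ip u v - 1/2 * quad u"
    proof (cases "v \<in> B")
      case True
      then show ?thesis using \<F> U0 v by (auto simp: H_def)
    next
      case False
      with vT obtain j s where "j \<in> J" "s \<in> {1, -1}"
          "a < ip (\<lambda>i. s * unit_vec j i) v - 1/2 * quad (\<lambda>i. s * unit_vec j i)"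
        unfolding B_def by (elim outside_boxE)
      then show ?thesis by (intro bexI[of _ "\<lambda>i. s * unit_vec j i"]) (auto simp: U1_def)
    qed
  qed
qed



text \<open>Near-maximisers of the concave function \<open>u \<mapsto> \<langle>u, v\<rangle> - quad u / 2\<close> replace an inversion of the
  possibly singular matrix \<open>S\<close>.\<close>

lemma near_maximiser:
  assumes r: "legendre v = ereal r" and d: "0 < \<delta>" and e: "0 < \<epsilon>"
  obtains u where "\<And>j. j \<in> J \<Longrightarrow> \<bar>v j - mat_vec J S u j\<bar> < \<delta>" "1/2 * quad u \<le> r + \<epsilon>"
proof -
  have r0: "0 \<le> r" using legendre_nonneg[of v] r by simp
  \<comment> \<open>This s solves \<open>r + s = (r + \<epsilon>) * (1 - s)\<close>, which is what
    the last estimate on \<open>quad u\<close> requires.\<close>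
  define s where "s = \<epsilon> / (1 + r + \<epsilon>)"
  have s: "0 < s" "s < 1" "r + s \<le> (r + \<epsilon>) * (1 - s)"
    using e r0 by (auto simp: s_def field_simps)
  \<comment> \<open>The added 1 keeps the divisor \<open>S j j + 1\<close> used below positive when
    the variance in direction j is zero.\<close>
  define D where "D = (\<Sum>j\<in>J. S j j) + 1"
  have SD: "S j j + 1 \<le> D" if "j \<in> J" for j
    using member_le_sum[OF that, of "\<lambda>j. S j j"] finite_J diag_nonneg by (auto simp: D_def)
  have D0: "1 \<le> D" by (simp add: D_def sum_nonneg diag_nonneg)
  \<comment> \<open>The accuracy of the near-maximiser. The bound \<open>s^2\<close> serves the
    perturbation along u itself, the other one the perturbations along unit vectors.\<close>
  define \<kappa> where "\<kappa> = min (s\<^sup>2) (\<delta>\<^sup>2 / (4 * D))"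
  have k: "0 < \<kappa>" "\<kappa> \<le> s\<^sup>2" "\<kappa> * (4 * D) \<le> \<delta>\<^sup>2"
    using s d D0 by (auto simp: \<kappa>_def min_def field_simps)
  have "ereal (r - \<kappa>) < legendre v" using r k by simp
  then obtain u where u: "r - \<kappa> < ip u v - 1/2 * quad u"
    by (auto simp: legendre_def less_SUP_iff)
  \<comment> \<open>The value at u is within \<kappa> of the supremum, so no displacement of u can
    gain more than \<kappa>. Both conclusions follow by choosing the displacement.\<close>
  have pert: "t * (ip w v - ip w (mat_vec J S u)) - 1/2 * t\<^sup>2 * quad w \<le> \<kappa>" for t w
    using legendre_ge[of "\<lambda>i. u i + t * w i" v] r u
    by (simp add: inner_on_add_scaled quad_add_scaled algebra_simps)
  show ?thesis
  proof
    fix j assume j: "j \<in> J"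
    define x where "x = v j - mat_vec J S u j"
    \<comment> \<open>A nearly optimal step in direction j: it gains at least
      \<open>t * x / 2\<close>, which bounds \<open>x^2\<close> by a multiple of \<kappa>.\<close>
    define t where "t = x / (S j j + 1)"
    have Sj: "0 \<le> S j j" using diag_nonneg[OF j] .
    have "t * x - 1/2 * t\<^sup>2 * S j j \<le> \<kappa>"
      using pert[of t "unit_vec j"] j by (simp add: inner_on_unit_vec finite_J quad_unit_vec x_def)
    moreover have "t\<^sup>2 * S j j \<le> t\<^sup>2 * (S j j + 1)" by (simp add: mult_left_mono)
    moreover have "t\<^sup>2 * (S j j + 1) = t * x" using Sj by (simp add: t_def power2_eq_square)
    ultimately have "t * x \<le> 2 * \<kappa>" by linarith
    moreover have "x\<^sup>2 = t * x * (S j j + 1)" using Sj by (simp add: t_def power2_eq_square)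
    ultimately have "x\<^sup>2 \<le> 2 * \<kappa> * (S j j + 1)" using Sj by (simp add: mult_right_mono)
    also have "\<dots> \<le> 2 * \<kappa> * D" using SD[OF j] k by (simp add: mult_left_mono)
    also have "\<dots> < \<delta>\<^sup>2" using k(3) mult_pos_pos[of \<kappa> D] k(1) D0 by linarith
    finally show "\<bar>v j - mat_vec J S u j\<bar> < \<delta>"
      using d power2_less_imp_less[of "\<bar>x\<bar>" \<delta>] by (simp add: x_def)
  next
    define y where "y = ip u v - quad u"
    have val: "1/2 * quad u + y \<le> r"
      using legendre_ge[of u v] r by (simp add: y_def)
    \<comment> \<open>Shrinking u to \<open>(1 - s) * u\<close> must not gain much either. This
      bounds y, the derivative along u, from below, and \<open>val\<close> then turns it into an
      upper bound for \<open>quad u\<close>.\<close>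
    have "- s * y - 1/2 * s\<^sup>2 * quad u \<le> \<kappa>"
      using pert[of "-s" u] by (simp add: y_def quad_def)
    then have "s * (- y - 1/2 * s * quad u) \<le> s * s"
      using k by (simp add: algebra_simps power2_eq_square)
    then have "- y - 1/2 * s * quad u \<le> s" using s by simp
    with val have "1/2 * quad u * (1 - s) \<le> r + s" by (simp add: algebra_simps)
    also note s(3)
    finally show "1/2 * quad u \<le> r + \<epsilon>" using s by simp
  qed
qed

lemma open_contains_box:
  assumes G: "openin JT G" "v \<in> G"
  obtains \<delta> where "\<delta> > 0" "\<And>w. w \<in> extensional J \<Longrightarrow> (\<And>j. j \<in> J \<Longrightarrow> \<bar>w j - v j\<bar> < \<delta>) \<Longrightarrow> w \<in> G"
proof -
  from G(1)[unfolded openin_product_topology_alt, rule_format, OF G(2)]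
  obtain U where U: "\<And>i. i \<in> J \<Longrightarrow> openin euclideanreal (U i)" "v \<in> Pi\<^sub>E J U" "Pi\<^sub>E J U \<subseteq> G"
    by auto
  have "\<forall>j\<in>J. \<exists>d>0. \<forall>y. \<bar>y - v j\<bar> < d \<longrightarrow> y \<in> U j"
  proof
    fix j assume "j \<in> J"
    with U have "open (U j)" "v j \<in> U j" by (auto simp: PiE_def)
    then show "\<exists>d>0. \<forall>y. \<bar>y - v j\<bar> < d \<longrightarrow> y \<in> U j"
      by (auto simp: open_dist dist_real_def)
  qed
  then obtain d where d: "\<And>j. j \<in> J \<Longrightarrow> 0 < d j" "\<And>j y. j \<in> J \<Longrightarrow> \<bar>y - v j\<bar> < d j \<Longrightarrow> y \<in> U j"
    by metis
  show ?thesis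
  proof (rule that[of "Min (insert 1 (d ` J))"])
    show "0 < Min (insert 1 (d ` J))" using d finite_J by (subst Min_gr_iff) auto
    fix w assume w: "w \<in> extensional J" "\<And>j. j \<in> J \<Longrightarrow> \<bar>w j - v j\<bar> < Min (insert 1 (d ` J))"
    have "\<bar>w j - v j\<bar> < d j" if "j \<in> J" for j
      using w(2)[OF that] Min_le[of "insert 1 (d ` J)" "d j"] that finite_J by auto
    then have "w \<in> Pi\<^sub>E J U" using w(1) d(2) by (auto simp: PiE_def)
    then show "w \<in> G" using U by auto
  qed
qed

end

section \<open>Upper and lower deviation bounds for a quadratic limit\<close>

locale gaussian_mgf_limit = psd_form J S
  for J :: "'j set" and S :: "'j \<Rightarrow> 'j \<Rightarrow> real" +
  fixes M :: "nat \<Rightarrow> 'w measure" and Z :: "nat \<Rightarrow> 'w \<Rightarrow> 'j \<Rightarrow> real" and \<alpha> :: "nat \<Rightarrow> real"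
  assumes prob_M: "N \<ge> 1 \<Longrightarrow> prob_space (M N)"
    and meas_Z: "N \<ge> 1 \<Longrightarrow> Z N \<in> M N \<rightarrow>\<^sub>M PiM J (\<lambda>_. borel)"
    and alpha_pos: "N \<ge> 1 \<Longrightarrow> 0 < \<alpha> N"
    and alpha_lim: "filterlim \<alpha> at_top sequentially"
    and integrable_mgf: "N \<ge> 1 \<Longrightarrow> integrable (M N) (\<lambda>\<omega>. exp (\<alpha> N * inner_on J u (Z N \<omega>)))"
    and mgf_rate: "exp_rate \<alpha> (\<lambda>N. \<integral>\<omega>. exp (\<alpha> N * inner_on J u (Z N \<omega>)) \<partial>M N)
        (1/2 * inner_on J u (mat_vec J S u))"
begin

definition mgf :: "('j \<Rightarrow> real) \<Rightarrow> nat \<Rightarrow> real" where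
  "mgf u N = (\<integral>\<omega>. exp (\<alpha> N * ip u (Z N \<omega>)) \<partial>M N)"

lemma mgf_exp_rate: "exp_rate \<alpha> (mgf u) (1/2 * quad u)"
  using mgf_rate[of u] by (simp add: mgf_def[abs_def] quad_def)

lemma measurable_coord: "N \<ge> 1 \<Longrightarrow> j \<in> J \<Longrightarrow> (\<lambda>\<omega>. Z N \<omega> j) \<in> borel_measurable (M N)"
  using measurable_compose[OF meas_Z measurable_component_singleton] by auto

lemma space_Z: "N \<ge> 1 \<Longrightarrow> \<omega> \<in> space (M N) \<Longrightarrow> Z N \<omega> \<in> topspace JT"
  using measurable_space[OF meas_Z] by (auto simp: space_PiM)

lemma measurable_ip[measurable]: "N \<ge> 1 \<Longrightarrow> (\<lambda>\<omega>. ip u (Z N \<omega>)) \<in> borel_measurable (M N)"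
  unfolding inner_on_def by (intro borel_measurable_sum borel_measurable_times measurable_coord) auto

text \<open>The exponential Markov inequality in direction u.\<close>

lemma halfspace_prob_le:
  assumes N: "N \<ge> 1"
  shows "measure (M N) {\<omega>\<in>space (M N). c < ip u (Z N \<omega>)} \<le> exp (- \<alpha> N * c) * mgf u N"
proof -
  interpret prob_space "M N" using prob_M[OF N] .
  note [measurable] = measurable_ip[OF N]
  have "prob {\<omega>\<in>space (M N). c < ip u (Z N \<omega>)}
      = (\<integral>\<omega>. indicator {\<omega>\<in>space (M N). c < ip u (Z N \<omega>)} \<omega> \<partial>M N)"
    by simp
  also have "\<dots> \<le> (\<integral>\<omega>. exp (- \<alpha> N * c) * exp (\<alpha> N * ip u (Z N \<omega>)) \<partial>M N)"
  proof (rule integral_mono)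
    show "integrable (M N) (indicat_real {\<omega> \<in> space (M N). c < ip u (Z N \<omega>)})"
      by (intro integrable_real_indicator) (auto simp: emeasure_eq_measure)
    show "integrable (M N) (\<lambda>\<omega>. exp (- \<alpha> N * c) * exp (\<alpha> N * ip u (Z N \<omega>)))"
      by (intro integrable_mult_right integrable_mgf N)
    show "indicator {\<omega> \<in> space (M N). c < ip u (Z N \<omega>)} \<omega> \<le> exp (- \<alpha> N * c) * exp (\<alpha> N * ip u (Z N \<omega>))"
      for \<omega> using alpha_pos[OF N] by (auto split: split_indicator simp: exp_add[symmetric])
  qed
  also have "\<dots> = exp (- \<alpha> N * c) * mgf u N" by (simp add: mgf_def)
  finally show ?thesis .
qed

text \<open>The closure of A is covered by finitely many half-spaces on which
  \<open>ip u v - quad u / 2\<close> exceeds a level just below the infimum of the rate. By the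
  exponential Markov inequality each has probability about \<open>exp (- \<alpha> N * a)\<close>,
  and the union bound costs nothing at this speed.\<close>

lemma upper_bound:
  assumes A: "A \<in> sets (PiM J (\<lambda>_. borel))"
  shows "limsup (\<lambda>N. log_prob (measure (M N) (Z N -` A \<inter> space (M N))) / ereal (\<alpha> N))
      \<le> - (INF v\<in>JT closure_of A. legendre v)"
proof (rule ereal_le_real)
  let ?P = "\<lambda>N. measure (M N) (Z N -` A \<inter> space (M N))"
  \<comment> \<open>Comparing with real bounds z treats finite and infinite infima alike.\<close>
  fix z assume "- (INF v\<in>JT closure_of A. legendre v) \<le> ereal z"
  then have z: "ereal (- z) \<le> (INF v\<in>JT closure_of A. legendre v)"
    by (metis ereal_uminus_le_reorder uminus_ereal.simps(1))
  show "limsup (\<lambda>N. log_prob (?P N) / ereal (\<alpha> N)) \<le> ereal z"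
  proof (rule ereal_le_epsilon2)
    show "limsup (\<lambda>N. log_prob (?P N) / ereal (\<alpha> N)) \<le> ereal z + ereal e" if e: "0 < e" for e
    proof -
      \<comment> \<open>The slack e is spent in three equal portions: on the strict inequality in
        the cover, on the convergence of the Laplace transforms, and on the number of
        half-spaces.\<close>
      define a where "a = - z - e / 3"
      have "ereal a < legendre v" if "v \<in> JT closure_of A" for v
      proof -
        have "ereal a < ereal (- z)" using e by (simp add: a_def)
        also note z
        also have "(INF v\<in>JT closure_of A. legendre v) \<le> legendre v" by (intro INF_lower that)
        finally show ?thesis .
      qed
      then obtain U where U: "finite U" "\<And>v. v \<in> JT closure_of A \<Longrightarrow> \<exists>u\<in>U. a < ip u v - 1/2 * quad u"
        using closed_halfspace_cover[OF closedin_closure_of] by metis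
      have AT: "A \<subseteq> JT closure_of A"
        using sets.sets_into_space[OF A] by (intro closure_of_subset) (auto simp: space_PiM)
      have ev: "\<forall>\<^sub>F N in sequentially. \<forall>u\<in>U. mgf u N \<le> exp (\<alpha> N * (1/2 * quad u + e/3))"
        using e by (intro eventually_ball_finite U(1) ballI exp_rateD_le[OF mgf_exp_rate]) simp
      have ev2: "\<forall>\<^sub>F N in sequentially. real (card U) \<le> exp (\<alpha> N * (e/3))"
        using e by (intro eventually_const_le_exp alpha_lim) simp
      have "\<forall>\<^sub>F N in sequentially. log_prob (?P N) / ereal (\<alpha> N) \<le> ereal (z + e)"
        using ev ev2 eventually_ge_at_top[of 1]
      proof eventually_elim
        case (elim N)
        interpret prob_space "M N" using prob_M elim by simp
        have a0: "0 < \<alpha> N" using alpha_pos elim by simp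
        have "?P N \<le> prob (\<Union>u\<in>U. {\<omega>\<in>space (M N). a + 1/2 * quad u < ip u (Z N \<omega>)})"
        proof (rule finite_measure_mono)
          show "Z N -` A \<inter> space (M N) \<subseteq> (\<Union>u\<in>U. {\<omega>\<in>space (M N). a + 1/2 * quad u < ip u (Z N \<omega>)})"
          proof
            fix \<omega> assume w: "\<omega> \<in> Z N -` A \<inter> space (M N)"
            then have "Z N \<omega> \<in> JT closure_of A" using AT by auto
            from U(2)[OF this] obtain u where "u \<in> U" "a < ip u (Z N \<omega>) - 1/2 * quad u" ..
            then show "\<omega> \<in> (\<Union>u\<in>U. {\<omega>\<in>space (M N). a + 1/2 * quad u < ip u (Z N \<omega>)})"
              using w by (intro UN_I[of u]) auto
          qed
          show "(\<Union>u\<in>U. {\<omega>\<in>space (M N). a + 1/2 * quad u < ip u (Z N \<omega>)}) \<in> sets (M N)"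
            using measurable_ip[OF elim(3)] U(1) by (intro sets.finite_UN) auto
        qed
        also have "\<dots> \<le> (\<Sum>u\<in>U. prob {\<omega>\<in>space (M N). a + 1/2 * quad u < ip u (Z N \<omega>)})"
          using measurable_ip[OF elim(3)] by (intro finite_measure_subadditive_finite U) auto
        also have "\<dots> \<le> (\<Sum>u\<in>U. exp (\<alpha> N * (e/3 - a)))"
        proof (rule sum_mono)
          fix u assume u: "u \<in> U"
          have "prob {\<omega>\<in>space (M N). a + 1/2 * quad u < ip u (Z N \<omega>)}
              \<le> exp (- \<alpha> N * (a + 1/2 * quad u)) * mgf u N"
            by (rule halfspace_prob_le) fact
          also have "\<dots> \<le> exp (- \<alpha> N * (a + 1/2 * quad u)) * exp (\<alpha> N * (1/2 * quad u + e/3))"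
            using elim u by (intro mult_left_mono) auto
          also have "\<dots> = exp (\<alpha> N * (e/3 - a))" by (simp add: exp_add[symmetric] algebra_simps)
          finally show "prob {\<omega>\<in>space (M N). a + 1/2 * quad u < ip u (Z N \<omega>)} \<le> exp (\<alpha> N * (e/3 - a))" .
        qed
        also have "\<dots> \<le> exp (\<alpha> N * (e/3)) * exp (\<alpha> N * (e/3 - a))"
          using elim by simp
        also have "\<dots> = exp (\<alpha> N * (z + e))"
          by (simp add: exp_add[symmetric] a_def algebra_simps)
        finally have P: "?P N \<le> exp (\<alpha> N * (z + e))" .
        show ?case
        proof (cases "?P N = 0")
          case True
          then show ?thesis using a0 by (simp add: log_prob_def)
        next
          case False
          then have "0 < ?P N" by (simp add: zero_less_measure_iff)
          then have "ln (?P N) \<le> \<alpha> N * (z + e)" using P by (metis ln_exp ln_le_cancel_iff exp_gt_zero)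
          then show ?thesis using False a0 by (simp add: log_prob_def field_simps)
        qed
      qed
      then have "limsup (\<lambda>N. log_prob (?P N) / ereal (\<alpha> N)) \<le> ereal (z + e)"
        by (rule Limsup_bounded)
      then show "limsup (\<lambda>N. log_prob (?P N) / ereal (\<alpha> N)) \<le> ereal z + ereal e" by simp
    qed
  qed
qed

text \<open>Exponential tilting: on the complement of the box around \<open>S u\<close> one of the tilted
  exponentials on the right is larger than \<open>exp (\<alpha> \<langle>u, Z\<rangle>)\<close>.\<close>

lemma box_prob_ge:
  assumes \<rho>: "0 < \<rho>" and \<epsilon>: "0 < \<epsilon>"
  shows "\<forall>\<^sub>F N in sequentially. exp (- \<alpha> N * (1/2 * quad u + \<epsilon>)) \<le>
     measure (M N) {\<omega>\<in>space (M N). \<forall>j\<in>J. \<bar>Z N \<omega> j - mat_vec J S u j\<bar> < \<rho>}"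
proof -
  define m where "m = mat_vec J S u"
  define D where "D = (\<Sum>j\<in>J. S j j) + 1"
  have SD: "S j j \<le> D" if "j \<in> J" for j
    using member_le_sum[OF that, of "\<lambda>j. S j j"] finite_J diag_nonneg by (auto simp: D_def)
  have D0: "1 \<le> D" by (simp add: D_def sum_nonneg diag_nonneg)
  define U where "U = (\<Sum>j\<in>J. \<bar>u j\<bar>) + 1"
  have U0: "1 \<le> U" by (simp add: U_def sum_nonneg)
  \<comment> \<open>On a box of this size around \<open>S u\<close> the exponent
    \<open>ip u (Z N \<omega>)\<close> differs from its value \<open>quad u\<close> at the centre by
    at most \<epsilon>/2.\<close>
  define \<rho>' where "\<rho>' = min \<rho> (\<epsilon> / (2 * U))"
  have r': "0 < \<rho>'" "\<rho>' \<le> \<rho>" "\<rho>' * U \<le> \<epsilon> / 2"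
    using \<rho> \<epsilon> U0 by (auto simp: \<rho>'_def min_def field_simps)
  \<comment> \<open>The strength of the additional tilt. With it the loss
    \<open>s^2 * S j j / 2\<close> is at most half of the gain \<open>s * \<rho>'\<close>.\<close>
  define s where "s = \<rho>' / D"
  have s0: "0 < s" using r' D0 by (simp add: s_def)
  define \<gamma> where "\<gamma> = min (\<epsilon> / 3) (s * \<rho>' / 4)"
  have g: "0 < \<gamma>" "\<gamma> \<le> \<epsilon> / 3" "4 * \<gamma> \<le> s * \<rho>'" using \<epsilon> s0 r' by (auto simp: \<gamma>_def)
  \<comment> \<open>Chosen so that \<open>ip (W (j, t)) z - c (j, t)\<close> equals
    \<open>ip u z + s * (t * (z j - m j) - \<rho>')\<close>, which is at least \<open>ip u z\<close>
    as soon as z leaves the box in direction j with sign t.\<close>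
  define W where "W = (\<lambda>(j, t::real) i. u i + (t * s) * unit_vec j i)"
  define c where "c = (\<lambda>(j, t::real). s * (t * m j + \<rho>'))"
  define I where "I = J \<times> {1, -1::real}"
  have finI: "finite I" using finite_J by (simp add: I_def)
  \<comment> \<open>This is why the box is centred at \<open>m = S u\<close>: the linear term
    \<open>t * s * m j\<close> produced by \<open>quad (W x)\<close> cancels against the one in c.
    What remains is \<open>s^2 * S j j / 2 - s * \<rho>'\<close>, at most
    \<open>- 2 * \<gamma>\<close>.\<close>
  have quadW: "1/2 * quad (W x) - c x \<le> 1/2 * quad u - 2 * \<gamma>" if x: "x \<in> I" for x
  proof -
    obtain j t where xe: "x = (j, t)" and j: "j \<in> J" and t: "t = 1 \<or> t = -1"
      using x by (auto simp: I_def)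
    have t2: "t\<^sup>2 = 1" using t by auto
    have "quad (W x) = quad u + 2 * (t * s) * m j + s\<^sup>2 * S j j"
      by (simp add: W_def xe quad_add_scaled inner_on_unit_vec finite_J j quad_unit_vec m_def
          power_mult_distrib t2)
    moreover have "s\<^sup>2 * S j j \<le> s\<^sup>2 * D" using SD[OF j] by (simp add: mult_left_mono)
    moreover have "s\<^sup>2 * D = s * \<rho>'" using D0 by (simp add: s_def power2_eq_square)
    ultimately show ?thesis using g by (simp add: c_def xe algebra_simps)
  qed
  have ev1: "\<forall>\<^sub>F N in sequentially. \<forall>x\<in>I. mgf (W x) N \<le> exp (\<alpha> N * (1/2 * quad (W x) + \<gamma>/2))"
    using g by (intro eventually_ball_finite finI ballI exp_rateD_le[OF mgf_exp_rate]) simp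
  have ev2: "\<forall>\<^sub>F N in sequentially. exp (\<alpha> N * (1/2 * quad u - \<gamma>/2)) \<le> mgf u N"
    using g by (intro exp_rateD_ge[OF mgf_exp_rate]) simp
  show ?thesis
    \<comment> \<open>The outer terms are smaller than the lower bound for \<open>mgf u N\<close> by
      a factor \<open>exp (- \<alpha> N * \<gamma>)\<close>. Asking for \<open>card I + 1\<close>
      instead of \<open>card I\<close> leaves one such term over after the subtraction, which is the
      mass attributed to the box.\<close>
    using ev1 ev2 eventually_const_le_exp[OF alpha_lim g(1), of "real (card I) + 1"]
      eventually_ge_at_top[of 1]
  proof (eventually_elim, goal_cases)
    case (1 N)
    note N = 1(4)
    interpret prob_space "M N" using prob_M N by simp
    have a0: "0 < \<alpha> N" using alpha_pos N by simp
    let ?B = "{\<omega>\<in>space (M N). \<forall>j\<in>J. \<bar>Z N \<omega> j - m j\<bar> < \<rho>'}"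
    have Bm: "?B \<in> sets (M N)" using measurable_coord[OF N] finite_J by measurable
    let ?f = "\<lambda>x \<omega>. exp (\<alpha> N * (ip (W x) (Z N \<omega>) - c x))"
    have fe: "?f x \<omega> = exp (- \<alpha> N * c x) * exp (\<alpha> N * ip (W x) (Z N \<omega>))" for x \<omega>
      by (simp add: exp_add[symmetric] algebra_simps)
    have intf: "integrable (M N) (?f x)" for x
      unfolding fe by (intro integrable_mult_right integrable_mgf N)
    have pt: "exp (\<alpha> N * ip u (Z N \<omega>)) \<le>
        exp (\<alpha> N * (quad u + \<epsilon> / 2)) * indicator ?B \<omega> + (\<Sum>x\<in>I. ?f x \<omega>)" if w: "\<omega> \<in> space (M N)" for \<omega>
    proof (cases "\<omega> \<in> ?B")
      case True
      have "ip u (Z N \<omega>) - quad u = (\<Sum>j\<in>J. u j * (Z N \<omega> j - m j))"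
        by (simp add: inner_on_def quad_def m_def algebra_simps sum_subtractf)
      also have "\<dots> \<le> (\<Sum>j\<in>J. \<bar>u j\<bar> * \<rho>')"
      proof (rule sum_mono)
        fix j assume "j \<in> J"
        then have "\<bar>Z N \<omega> j - m j\<bar> \<le> \<rho>'" using True by auto
        then have "\<bar>u j\<bar> * \<bar>Z N \<omega> j - m j\<bar> \<le> \<bar>u j\<bar> * \<rho>'" by (intro mult_left_mono) auto
        then show "u j * (Z N \<omega> j - m j) \<le> \<bar>u j\<bar> * \<rho>'"
          by (metis abs_le_D1 abs_mult)
      qed
      also have "\<dots> = \<rho>' * U - \<rho>'" by (simp add: U_def sum_distrib_left sum_distrib_right algebra_simps)
      also have "\<dots> \<le> \<epsilon> / 2" using r' by linarith
      finally have "\<alpha> N * ip u (Z N \<omega>) \<le> \<alpha> N * (quad u + \<epsilon> / 2)"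
        using a0 by (simp add: mult_left_mono)
      then have "exp (\<alpha> N * ip u (Z N \<omega>)) \<le> exp (\<alpha> N * (quad u + \<epsilon> / 2)) * indicator ?B \<omega>"
        using True by simp
      moreover have "0 \<le> (\<Sum>x\<in>I. ?f x \<omega>)" by (intro sum_nonneg) simp
      ultimately show ?thesis by linarith
    next
      case False
      then obtain j where j: "j \<in> J" "\<rho>' \<le> \<bar>Z N \<omega> j - m j\<bar>" using w by force
      define t where "t = (if Z N \<omega> j - m j \<ge> 0 then 1 else -1 :: real)"
      have tt: "t \<in> {1, -1}" "\<rho>' \<le> t * (Z N \<omega> j - m j)" using j(2) by (auto simp: t_def)
      have x: "(j, t) \<in> I" using j tt by (auto simp: I_def)
      have "ip (W (j, t)) (Z N \<omega>) - c (j, t) = ip u (Z N \<omega>) + s * (t * (Z N \<omega> j - m j) - \<rho>')"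
        unfolding W_def c_def split
        by (subst inner_on_add_scaled) (simp add: inner_on_unit_vec finite_J j algebra_simps)
      also have "\<dots> \<ge> ip u (Z N \<omega>)" using s0 tt by simp
      finally have "exp (\<alpha> N * ip u (Z N \<omega>)) \<le> ?f (j, t) \<omega>"
        using a0 by (simp add: mult_left_mono)
      also have "\<dots> \<le> (\<Sum>x\<in>I. ?f x \<omega>)"
        using x finI by (intro member_le_sum) auto
      finally show ?thesis using False by simp
    qed
    have "mgf u N \<le> (\<integral>\<omega>. exp (\<alpha> N * (quad u + \<epsilon> / 2)) * indicator ?B \<omega> + (\<Sum>x\<in>I. ?f x \<omega>) \<partial>M N)"
      unfolding mgf_def
      using Bm by (intro integral_mono pt integrable_mgf N Bochner_Integration.integrable_add
          Bochner_Integration.integrable_sum intf integrable_mult_right)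
        (auto intro!: integrable_real_indicator simp: emeasure_eq_measure)
    also have "\<dots> = exp (\<alpha> N * (quad u + \<epsilon> / 2)) * prob ?B + (\<Sum>x\<in>I. exp (- \<alpha> N * c x) * mgf (W x) N)"
    proof -
      have "(\<integral>\<omega>. (\<Sum>x\<in>I. ?f x \<omega>) \<partial>M N) = (\<Sum>x\<in>I. exp (- \<alpha> N * c x) * mgf (W x) N)"
        by (subst Bochner_Integration.integral_sum[OF intf])
          (simp only: fe mgf_def integral_mult_right_zero)
      then show ?thesis using Bm
        by (subst Bochner_Integration.integral_add)
          (auto intro!: integrable_real_indicator Bochner_Integration.integrable_sum intf
            integrable_mult_right simp: emeasure_eq_measure)
    qed
    also have "(\<Sum>x\<in>I. exp (- \<alpha> N * c x) * mgf (W x) N) \<le> (\<Sum>x\<in>I. exp (\<alpha> N * (1/2 * quad u - 3/2 * \<gamma>)))"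
    proof (rule sum_mono)
      fix x assume x: "x \<in> I"
      have "exp (- \<alpha> N * c x) * mgf (W x) N \<le> exp (- \<alpha> N * c x) * exp (\<alpha> N * (1/2 * quad (W x) + \<gamma>/2))"
        using 1(1) x by (intro mult_left_mono) auto
      also have "\<dots> = exp (\<alpha> N * ((1/2 * quad (W x) - c x) + \<gamma>/2))"
        by (simp add: exp_add[symmetric] algebra_simps)
      also have "\<dots> \<le> exp (\<alpha> N * (1/2 * quad u - 3/2 * \<gamma>))"
        using quadW[OF x] a0 by (simp add: mult_left_mono)
      finally show "exp (- \<alpha> N * c x) * mgf (W x) N \<le> exp (\<alpha> N * (1/2 * quad u - 3/2 * \<gamma>))" .
    qed
    also have "\<dots> \<le> (exp (\<alpha> N * \<gamma>) - 1) * exp (\<alpha> N * (1/2 * quad u - 3/2 * \<gamma>))"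
      using 1(3) by (simp add: mult_right_mono)
    also have "\<dots> = exp (\<alpha> N * (1/2 * quad u - \<gamma>/2)) - exp (\<alpha> N * (1/2 * quad u - 3/2 * \<gamma>))"
      by (simp add: left_diff_distrib exp_add[symmetric] algebra_simps)
    finally have "exp (\<alpha> N * (1/2 * quad u - 3/2 * \<gamma>)) \<le> exp (\<alpha> N * (quad u + \<epsilon> / 2)) * prob ?B"
      using 1(2) by simp
    then have q: "exp (\<alpha> N * (1/2 * quad u - 3/2 * \<gamma>)) / exp (\<alpha> N * (quad u + \<epsilon> / 2)) \<le> prob ?B"
      by (simp add: pos_divide_le_eq mult.commute)
    have "\<alpha> N * (- 1/2 * quad u - \<epsilon> / 2 - 3/2 * \<gamma>)
        = \<alpha> N * (1/2 * quad u - 3/2 * \<gamma>) - \<alpha> N * (quad u + \<epsilon> / 2)"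
      by (simp add: algebra_simps)
    then have B: "exp (\<alpha> N * (- 1/2 * quad u - \<epsilon> / 2 - 3/2 * \<gamma>)) \<le> prob ?B"
      by (simp only: exp_diff q)
    have "\<epsilon> / 2 + 3/2 * \<gamma> \<le> \<epsilon>" using g(2) by linarith
    then have "\<alpha> N * (- (1/2 * quad u + \<epsilon>)) \<le> \<alpha> N * (- 1/2 * quad u - \<epsilon> / 2 - 3/2 * \<gamma>)"
      using a0 by (intro mult_left_mono) linarith+
    then have "exp (- \<alpha> N * (1/2 * quad u + \<epsilon>)) \<le> exp (\<alpha> N * (- 1/2 * quad u - \<epsilon> / 2 - 3/2 * \<gamma>))"
      by (simp only: exp_le_cancel_iff minus_mult_commute)
    also note B
    also have "prob ?B \<le> prob {\<omega>\<in>space (M N). \<forall>j\<in>J. \<bar>Z N \<omega> j - mat_vec J S u j\<bar> < \<rho>}"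
    proof (rule finite_measure_mono)
      show "{\<omega>\<in>space (M N). \<forall>j\<in>J. \<bar>Z N \<omega> j - mat_vec J S u j\<bar> < \<rho>} \<in> sets (M N)"
        using measurable_coord[OF N] finite_J by measurable
      have "\<bar>x\<bar> < \<rho>" if "\<bar>x\<bar> < \<rho>'" for x using that r'(2) by linarith
      then show "?B \<subseteq> {\<omega>\<in>space (M N). \<forall>j\<in>J. \<bar>Z N \<omega> j - mat_vec J S u j\<bar> < \<rho>}"
        unfolding m_def by blast
    qed
    finally show ?case .
  qed
qed

text \<open>For v in the interior with finite rate, a near-maximiser u puts the centre
  \<open>S u\<close> close to v, so a small box around \<open>S u\<close> still lies in A, and its
  cost \<open>quad u / 2\<close> hardly exceeds the rate of v. Points of infinite rate impose no
  bound.\<close>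

lemma lower_bound:
  assumes A: "A \<in> sets (PiM J (\<lambda>_. borel))"
  shows "- (INF v\<in>JT interior_of A. legendre v)
      \<le> liminf (\<lambda>N. log_prob (measure (M N) (Z N -` A \<inter> space (M N))) / ereal (\<alpha> N))"
proof -
  let ?P = "\<lambda>N. measure (M N) (Z N -` A \<inter> space (M N))"
  let ?l = "liminf (\<lambda>N. log_prob (?P N) / ereal (\<alpha> N))"
  have "- ?l \<le> legendre v" if v: "v \<in> JT interior_of A" for v
  proof (cases "legendre v")
    case (real r)
    have "ereal (- r) \<le> ?l"
    proof (rule ereal_le_epsilon2)
      fix e :: real assume e: "0 < e"
      obtain \<delta> where d: "\<delta> > 0"
        "\<And>w. w \<in> extensional J \<Longrightarrow> (\<And>j. j \<in> J \<Longrightarrow> \<bar>w j - v j\<bar> < \<delta>) \<Longrightarrow> w \<in> JT interior_of A"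
        using open_contains_box[OF openin_interior_of v] by blast
      have "0 < \<delta> / 2" "0 < e / 2" using d e by auto
      from near_maximiser[OF real this] obtain u where
        u: "\<And>j. j \<in> J \<Longrightarrow> \<bar>v j - mat_vec J S u j\<bar> < \<delta> / 2" "1/2 * quad u \<le> r + e / 2"
        by auto
      have "\<forall>\<^sub>F N in sequentially. ereal (- r - e) \<le> log_prob (?P N) / ereal (\<alpha> N)"
        using box_prob_ge[OF \<open>0 < \<delta> / 2\<close> \<open>0 < e / 2\<close>, of u] eventually_ge_at_top[of 1]
      proof eventually_elim
        case (elim N)
        interpret prob_space "M N" using prob_M elim by simp
        have a0: "0 < \<alpha> N" using alpha_pos elim by simp
        have "{\<omega>\<in>space (M N). \<forall>j\<in>J. \<bar>Z N \<omega> j - mat_vec J S u j\<bar> < \<delta> / 2} \<subseteq> Z N -` A \<inter> space (M N)"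
        proof (intro subsetI IntI vimageI2)
          fix \<omega> assume w: "\<omega> \<in> {\<omega>\<in>space (M N). \<forall>j\<in>J. \<bar>Z N \<omega> j - mat_vec J S u j\<bar> < \<delta> / 2}"
          then show "\<omega> \<in> space (M N)" by simp
          have "Z N \<omega> \<in> JT interior_of A"
          proof (rule d(2))
            show "Z N \<omega> \<in> extensional J" using space_Z[of N \<omega>] w elim by (auto simp: PiE_def)
            show "\<bar>Z N \<omega> j - v j\<bar> < \<delta>" if "j \<in> J" for j
            proof -
              have "\<bar>Z N \<omega> j - mat_vec J S u j\<bar> < \<delta> / 2" using w that by blast
              with u(1)[OF that] show ?thesis by linarith
            qed
          qed
          then show "Z N \<omega> \<in> A" using interior_of_subset[of JT A] by (rule set_mp[rotated])
        qed
        then have "prob {\<omega>\<in>space (M N). \<forall>j\<in>J. \<bar>Z N \<omega> j - mat_vec J S u j\<bar> < \<delta> / 2} \<le> ?P N"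
          using measurable_sets[OF meas_Z A] elim by (intro finite_measure_mono) auto
        with elim have P: "exp (- \<alpha> N * (1/2 * quad u + e / 2)) \<le> ?P N" by simp
        then have P0: "0 < ?P N" using exp_gt_zero less_le_trans by blast
        have "- \<alpha> N * (r + e) \<le> - \<alpha> N * (1/2 * quad u + e / 2)"
          using u(2) a0 by simp
        also have "\<dots> \<le> ln (?P N)" using P P0 by (simp add: ln_ge_iff)
        finally have "\<alpha> N * (- r - e) \<le> ln (?P N)" by (simp add: algebra_simps)
        then show ?case using P0 a0 by (simp add: log_prob_def field_simps)
      qed
      then have "ereal (- r - e) \<le> ?l" by (rule Liminf_bounded)
      then have "ereal (- r - e) + ereal e \<le> ?l + ereal e" by (rule add_right_mono)
      then show "ereal (- r) \<le> ?l + ereal e" by simp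
    qed
    then show ?thesis using real by (metis ereal_uminus_le_reorder uminus_ereal.simps(1))
  qed (use legendre_nonneg[of v] in auto)
  then have "- ?l \<le> (INF v\<in>JT interior_of A. legendre v)" by (rule INF_greatest)
  then show ?thesis by (simp add: ereal_uminus_le_reorder)
qed

theorem gaussian_LDP: "LDP JT (PiM J (\<lambda>_. borel)) M Z \<alpha> legendre"
  unfolding LDP_def Let_def
  using alpha_lim meas_Z legendre_nonneg compact_legendre_level lower_bound upper_bound
  by (intro conjI allI impI ballI Liminf_le_Limsup sequentially_bot; assumption?) blast+

end

section \<open>Exponential moments\<close>

lemma exp_taylor_cubic:
  fixes y :: real
  assumes "\<bar>y\<bar> \<le> 1"
  shows "\<bar>exp y - (1 + y + y\<^sup>2 / 2)\<bar> \<le> \<bar>y\<bar> ^ 3"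
proof -
  obtain t where t: "\<bar>t\<bar> \<le> \<bar>y\<bar>" "exp y = (\<Sum>m<3. y ^ m / fact m) + exp t / fact 3 * y ^ 3"
    using Maclaurin_exp_le[of y 3] by auto
  have "exp t \<le> exp 1" using t assms by simp
  also have "\<dots> \<le> (3::real)" by (rule exp_le)
  finally have e: "exp t / 6 \<le> 1" by simp
  have "exp y - (1 + y + y\<^sup>2 / 2) = exp t / 6 * y ^ 3"
    using t(2) by (simp add: eval_nat_numeral)
  then have "\<bar>exp y - (1 + y + y\<^sup>2 / 2)\<bar> = exp t / 6 * \<bar>y\<bar> ^ 3"
    by (simp only: abs_mult power_abs) simp
  also have "\<dots> \<le> 1 * \<bar>y\<bar> ^ 3" by (intro mult_right_mono e) simp
  finally show ?thesis by simp
qed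

lemma (in prob_space) integrable_bounded:
  fixes f :: "'a \<Rightarrow> real"
  assumes "f \<in> borel_measurable M" "\<And>x. x \<in> space M \<Longrightarrow> \<bar>f x\<bar> \<le> b"
  shows "integrable M f"
  using assms by (intro integrable_const_bound[where B=b]) auto

lemma (in prob_space) expectation_bounded:
  fixes f :: "'a \<Rightarrow> real"
  assumes "f \<in> borel_measurable M" "\<And>x. x \<in> space M \<Longrightarrow> \<bar>f x\<bar> \<le> b"
  shows "\<bar>expectation f\<bar> \<le> b"
proof -
  note int = integrable_bounded[OF assms]
  have "- b \<le> f x \<and> f x \<le> b" if "x \<in> space M" for x using assms(2)[OF that] by linarith
  then have "expectation f \<le> b" "- b \<le> expectation f"
    by (intro integral_le_const integral_ge_const int AE_I2; simp)+
  then show ?thesis by linarith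
qed

text \<open>Both bounds have exponential form so that products over the particles become sums of
  exponents. With \<open>t = 2 * b * s\<close> the centred variable satisfies
  \<open>\<bar>s * X\<bar> \<le> t \<le> 1/2\<close>, and the Taylor error is at most
  \<open>t^3\<close>. The lower bound also uses \<open>ln (1 + y) \<ge> y - 2 * y^2\<close> with
  \<open>y^2 \<le> t^3\<close>; altogether \<open>3 * t^3 = 24 * b^3 * s^3\<close>.\<close>

lemma (in prob_space) centered_mgf_bounds:
  fixes f :: "'a \<Rightarrow> real"
  assumes f: "f \<in> borel_measurable M" "\<And>x. x \<in> space M \<Longrightarrow> \<bar>f x\<bar> \<le> b"
    and s: "0 \<le> s" "4 * b * s \<le> 1"
  defines "m \<equiv> expectation f"
  shows "exp (s\<^sup>2 / 2 * expectation (\<lambda>x. (f x - m)\<^sup>2) - 24 * b ^ 3 * s ^ 3)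
      \<le> expectation (\<lambda>x. exp (s * (f x - m)))"
    and "expectation (\<lambda>x. exp (s * (f x - m)))
      \<le> exp (s\<^sup>2 / 2 * expectation (\<lambda>x. (f x - m)\<^sup>2) + 24 * b ^ 3 * s ^ 3)"
proof -
  note [measurable] = f(1)
  obtain x0 where "x0 \<in> space M" using not_empty by blast
  then have b0: "0 \<le> b" using f(2)[of x0] by linarith
  define X where "X x = f x - m" for x
  have m: "\<bar>m\<bar> \<le> b" unfolding m_def by (rule expectation_bounded[OF f])
  have X: "\<bar>X x\<bar> \<le> 2 * b" if "x \<in> space M" for x using f(2)[OF that] m by (simp add: X_def)
  have [measurable]: "X \<in> borel_measurable M" unfolding X_def by measurable
  define t where "t = 2 * b * s"
  have t: "0 \<le> t" "t \<le> 1 / 2" using s b0 by (auto simp: t_def)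
  have sX: "\<bar>s * X x\<bar> \<le> t" if "x \<in> space M" for x
    using mult_left_mono[OF X[OF that] s(1)] s(1) by (simp add: t_def abs_mult mult_ac)
  define V where "V = expectation (\<lambda>x. (X x)\<^sup>2)"
  define L where "L = expectation (\<lambda>x. exp (s * X x))"
  have X2: "\<bar>(X x)\<^sup>2\<bar> \<le> (2 * b)\<^sup>2" if "x \<in> space M" for x
    using power_mono[OF X[OF that], of 2] by simp
  have V: "0 \<le> V" "V \<le> (2 * b)\<^sup>2"
    using expectation_bounded[OF _ X2] by (auto simp: V_def intro!: integral_nonneg)
  have intX: "integrable M X" using X by (intro integrable_bounded) auto
  have intX2: "integrable M (\<lambda>x. (X x)\<^sup>2)" using X2 by (intro integrable_bounded) auto
  have EX: "expectation X = 0"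
    using integrable_bounded[OF f] unfolding X_def
    by (subst Bochner_Integration.integral_diff) (simp_all add: m_def prob_space)
  have "\<bar>exp (s * X x)\<bar> \<le> exp t" if "x \<in> space M" for x using sX[OF that] by simp
  then have inte: "integrable M (\<lambda>x. exp (s * X x))" by (intro integrable_bounded) auto
  have "L - (1 + s\<^sup>2 / 2 * V) = expectation (\<lambda>x. exp (s * X x) - (1 + s * X x + (s * X x)\<^sup>2 / 2))"
    unfolding L_def V_def using intX intX2 inte EX by (simp add: power_mult_distrib prob_space)
  also have "\<bar>\<dots>\<bar> \<le> t ^ 3"
  proof (rule expectation_bounded)
    fix x assume x: "x \<in> space M"
    have "\<bar>exp (s * X x) - (1 + s * X x + (s * X x)\<^sup>2 / 2)\<bar> \<le> \<bar>s * X x\<bar> ^ 3"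
      using sX[OF x] t by (intro exp_taylor_cubic) linarith
    also have "\<dots> \<le> t ^ 3" using sX[OF x] by (intro power_mono) auto
    finally show "\<bar>exp (s * X x) - (1 + s * X x + (s * X x)\<^sup>2 / 2)\<bar> \<le> t ^ 3" .
  qed measurable
  finally have L: "\<bar>L - (1 + s\<^sup>2 / 2 * V)\<bar> \<le> t ^ 3" .
  have t3: "t ^ 3 = 8 * b ^ 3 * s ^ 3" by (simp add: t_def power_mult_distrib)
  have t30: "0 \<le> t ^ 3" using t by simp
  define y where "y = s\<^sup>2 / 2 * V - t ^ 3"
  have sV: "s\<^sup>2 / 2 * V \<le> t\<^sup>2 / 2"
    using mult_left_mono[OF V(2), of "s\<^sup>2 / 2"] by (simp add: t_def power_mult_distrib mult_ac)
  have sV0: "0 \<le> s\<^sup>2 / 2 * V" using V by simp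
  have t32: "t ^ 3 \<le> t\<^sup>2 / 2"
    using mult_right_mono[OF t(2), of "t\<^sup>2"] by (simp add: power3_eq_cube power2_eq_square mult_ac)
  have yt: "\<bar>y\<bar> \<le> t\<^sup>2 / 2" unfolding y_def using sV sV0 t32 t30 by linarith
  have t24: "t\<^sup>2 \<le> 1 / 4" using power_mono[OF t(2) t(1), of 2] by (simp add: power2_eq_square)
  have "y\<^sup>2 \<le> (t\<^sup>2 / 2)\<^sup>2" using yt by (metis abs_ge_zero power2_abs power_mono)
  also have "\<dots> = t ^ 3 * (t / 4)" by (simp add: power2_eq_square power3_eq_cube)
  also have "\<dots> \<le> t ^ 3 * 1" using t t30 by (intro mult_left_mono) auto
  finally have y2: "y\<^sup>2 \<le> t ^ 3" by simp
  have "y - 2 * y\<^sup>2 \<le> ln (1 + y)"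
    using abs_ln_one_plus_x_minus_x_bound[of y] yt t24 by (simp add: abs_le_iff)
  then have "exp (y - 2 * y\<^sup>2) \<le> 1 + y"
    using yt t24 by (subst (asm) ln_ge_iff) auto
  also have "\<dots> \<le> L" using L by (simp add: y_def abs_le_iff)
  finally have "exp (y - 2 * y\<^sup>2) \<le> L" .
  moreover have "s\<^sup>2 / 2 * V - 3 * t ^ 3 \<le> y - 2 * y\<^sup>2" using y2 by (simp add: y_def)
  ultimately have "exp (s\<^sup>2 / 2 * V - 3 * t ^ 3) \<le> L" by (meson exp_le_cancel_iff order_trans)
  then show "exp (s\<^sup>2 / 2 * expectation (\<lambda>x. (f x - m)\<^sup>2) - 24 * b ^ 3 * s ^ 3)
      \<le> expectation (\<lambda>x. exp (s * (f x - m)))"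
    by (simp add: V_def L_def X_def t3 mult.assoc)
  have "L \<le> 1 + (s\<^sup>2 / 2 * V + t ^ 3)" using L by (simp add: abs_le_iff)
  also have "\<dots> \<le> exp (s\<^sup>2 / 2 * V + t ^ 3)" by (rule exp_ge_add_one_self)
  also have "\<dots> \<le> exp (s\<^sup>2 / 2 * V + 3 * t ^ 3)" using t30 by simp
  finally show "expectation (\<lambda>x. exp (s * (f x - m)))
      \<le> exp (s\<^sup>2 / 2 * expectation (\<lambda>x. (f x - m)\<^sup>2) + 24 * b ^ 3 * s ^ 3)"
    by (simp add: V_def L_def X_def t3 mult.assoc)
qed

text \<open>Jensen's inequality for the normalised measure \<open>w dR\<close>. The measure \<open>R\<close> itself need not be
  \<open>\<sigma>\<close>-finite.\<close>

lemma exp_mixture_le: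
  fixes \<psi> :: "'g \<Rightarrow> 'w \<Rightarrow> real" and w :: "'g \<Rightarrow> real"
  assumes M: "prob_space M"
    and \<psi>[measurable]: "(\<lambda>(g, \<omega>). \<psi> g \<omega>) \<in> borel_measurable (R \<Otimes>\<^sub>M M)"
    and w[measurable]: "w \<in> borel_measurable R"
    and bnd: "\<And>g \<omega>. g \<in> space R \<Longrightarrow> \<omega> \<in> space M \<Longrightarrow> 0 \<le> \<psi> g \<omega> \<and> \<psi> g \<omega> \<le> w g"
    and B: "(\<integral>\<^sup>+g. ennreal (w g) \<partial>R) \<le> ennreal B" and t: "0 \<le> t" "0 \<le> B"
    and A: "\<And>g. g \<in> space R \<Longrightarrow> 0 < w g \<Longrightarrow>
      (\<integral>\<^sup>+\<omega>. ennreal (exp (t * (B * (\<psi> g \<omega> / w g)))) \<partial>M) \<le> A"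
    and A1: "1 \<le> A"
  shows "(\<integral>\<^sup>+\<omega>. ennreal (exp (t * enn2real (\<integral>\<^sup>+g. ennreal (\<psi> g \<omega>) \<partial>R))) \<partial>M) \<le> A"
proof -
  interpret M: prob_space M by fact
  obtain \<omega>0 where \<omega>0: "\<omega>0 \<in> space M" using M.not_empty by blast
  have w0: "0 \<le> w g" if "g \<in> space R" for g using bnd[OF that \<omega>0] by linarith
  define c where "c = enn2real (\<integral>\<^sup>+g. ennreal (w g) \<partial>R)"
  have "(\<integral>\<^sup>+g. ennreal (w g) \<partial>R) < top" using B by (rule le_less_trans) simp
  then have wc: "(\<integral>\<^sup>+g. ennreal (w g) \<partial>R) = ennreal c"
    by (simp add: c_def)
  have c: "0 \<le> c" by (simp add: c_def)
  have "c \<le> B" using B t by (simp add: wc)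
  note c = c this
  show ?thesis
  proof (cases "c = 0")
    \<comment> \<open>A weight of total mass zero cannot be normalised, but then the integral of
      \<open>\<psi> g \<omega>\<close> vanishes for every \<omega>.\<close>
    case True
    have "(\<integral>\<^sup>+g. ennreal (\<psi> g \<omega>) \<partial>R) = 0" if "\<omega> \<in> space M" for \<omega>
    proof -
      have "(\<integral>\<^sup>+g. ennreal (\<psi> g \<omega>) \<partial>R) \<le> (\<integral>\<^sup>+g. ennreal (w g) \<partial>R)"
        using bnd that by (intro nn_integral_mono ennreal_leI) auto
      then show ?thesis using wc True by simp
    qed
    then have "(\<integral>\<^sup>+\<omega>. ennreal (exp (t * enn2real (\<integral>\<^sup>+g. ennreal (\<psi> g \<omega>) \<partial>R))) \<partial>M) = (\<integral>\<^sup>+\<omega>. 1 \<partial>M)"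
      by (intro nn_integral_cong) simp
    then show ?thesis using A1 by (simp add: M.emeasure_space_1)
  next
    case False
    then have c0: "0 < c" using c by simp
    define Q where "Q = density R (\<lambda>g. ennreal (w g / c))"
    have spQ[simp]: "space Q = space R" and seQ[measurable_cong, simp]: "sets Q = sets R"
      by (auto simp: Q_def)
    have "emeasure Q (space Q) = (\<integral>\<^sup>+g. ennreal (1 / c) * ennreal (w g) \<partial>R)"
      unfolding Q_def using c0 w0
      by (subst emeasure_density)
         (auto intro!: nn_integral_cong simp: ennreal_mult[symmetric])
    also have "\<dots> = ennreal (1 / c) * ennreal c"
      by (subst nn_integral_cmult) (auto simp: wc)
    also have "\<dots> = 1" using c0 by (simp add: ennreal_mult[symmetric])
    finally interpret Q: prob_space Q by (rule prob_spaceI)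
    interpret QM: pair_sigma_finite Q M ..
    \<comment> \<open>Where \<open>w g = 0\<close> the division convention gives 0, in accordance
      with \<open>\<psi> g \<omega> = 0\<close> there.\<close>
    define \<rho> where "\<rho> g \<omega> = \<psi> g \<omega> / w g" for g \<omega>
    have [measurable]: "(\<lambda>(g, \<omega>). \<rho> g \<omega>) \<in> borel_measurable (Q \<Otimes>\<^sub>M M)"
      unfolding \<rho>_def by measurable
    have \<rho>: "0 \<le> \<rho> g \<omega>" "\<rho> g \<omega> \<le> 1" if "g \<in> space R" "\<omega> \<in> space M" for g \<omega>
      using bnd[OF that] by (auto simp: \<rho>_def divide_le_eq_1)
    have pt: "ennreal (exp (t * enn2real (\<integral>\<^sup>+g. ennreal (\<psi> g \<omega>) \<partial>R)))
        \<le> (\<integral>\<^sup>+g. ennreal (exp (t * (B * \<rho> g \<omega>))) \<partial>Q)" if \<omega>: "\<omega> \<in> space M" for \<omega>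
    proof -
      have [measurable]: "(\<lambda>g. \<rho> g \<omega>) \<in> borel_measurable Q" using \<omega> by measurable
      have intr: "integrable Q (\<lambda>g. \<rho> g \<omega>)"
        using \<rho> \<omega> by (intro Q.integrable_bounded[where b=1]) auto
      have "\<psi> g \<omega> = w g / c * (c * \<rho> g \<omega>)" if "g \<in> space R" for g
        using c0 bnd[OF that \<omega>] by (auto simp: \<rho>_def)
      then have "(\<integral>\<^sup>+g. ennreal (\<psi> g \<omega>) \<partial>R) = (\<integral>\<^sup>+g. ennreal (w g / c) * ennreal (c * \<rho> g \<omega>) \<partial>R)"
        using c0 w0 \<rho>(1) \<omega> by (intro nn_integral_cong) (simp add: ennreal_mult[symmetric])
      also have "\<dots> = (\<integral>\<^sup>+g. ennreal (c * \<rho> g \<omega>) \<partial>Q)"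
        unfolding Q_def by (subst nn_integral_density) (use \<omega> in \<open>auto simp: \<rho>_def\<close>)
      also have "\<dots> = ennreal (\<integral>g. c * \<rho> g \<omega> \<partial>Q)"
        using intr \<rho> \<omega> c0 by (intro nn_integral_eq_integral) auto
      finally have ei: "(\<integral>\<^sup>+g. ennreal (\<psi> g \<omega>) \<partial>R) = ennreal (\<integral>g. c * \<rho> g \<omega> \<partial>Q)" .
      then have e: "enn2real (\<integral>\<^sup>+g. ennreal (\<psi> g \<omega>) \<partial>R) = c * (\<integral>g. \<rho> g \<omega> \<partial>Q)"
      proof -
        have "0 \<le> (\<integral>g. \<rho> g \<omega> \<partial>Q)" using \<rho>(1) \<omega> by (intro integral_nonneg_AE AE_I2) simp
        then show ?thesis using c0 by (simp add: ei)
      qed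
      have be: "\<bar>exp (t * (a * \<rho> g \<omega>))\<bar> \<le> exp (t * a)" if "g \<in> space R" "0 \<le> a" for a g
        using mult_left_le[OF \<rho>(2)[OF that(1) \<omega>] that(2)] t by (simp add: mult_left_mono)
      have "exp (t * (c * Q.expectation (\<lambda>g. \<rho> g \<omega>))) = exp (Q.expectation (\<lambda>g. t * (c * \<rho> g \<omega>)))"
        by simp
      also have "\<dots> \<le> Q.expectation (\<lambda>g. exp (t * (c * \<rho> g \<omega>)))"
        using be[OF _ c(1)]
        by (intro Q.jensens_inequality[where I=UNIV] Q.integrable_bounded[where b="exp (t * c)"]
            integrable_mult_right intr) (auto intro: exp_convex)
      also have "\<dots> \<le> Q.expectation (\<lambda>g. exp (t * (B * \<rho> g \<omega>)))"
        using be[OF _ c(1)] be[OF _ t(2)] \<rho> \<omega> t c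
        by (intro integral_mono Q.integrable_bounded[where b="exp (t * c)"]
            Q.integrable_bounded[where b="exp (t * B)"]) (auto intro!: mult_left_mono mult_right_mono)
      finally have "ennreal (exp (t * enn2real (\<integral>\<^sup>+g. ennreal (\<psi> g \<omega>) \<partial>R)))
          \<le> ennreal (Q.expectation (\<lambda>g. exp (t * (B * \<rho> g \<omega>))))"
        by (simp add: e)
      also have "\<dots> = (\<integral>\<^sup>+g. ennreal (exp (t * (B * \<rho> g \<omega>))) \<partial>Q)"
        using be[OF _ t(2)]
        by (intro nn_integral_eq_integral[symmetric] Q.integrable_bounded[where b="exp (t * B)"]) auto
      finally show ?thesis .
    qed
    have "(\<integral>\<^sup>+\<omega>. ennreal (exp (t * enn2real (\<integral>\<^sup>+g. ennreal (\<psi> g \<omega>) \<partial>R))) \<partial>M)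
        \<le> (\<integral>\<^sup>+\<omega>. \<integral>\<^sup>+g. ennreal (exp (t * (B * \<rho> g \<omega>))) \<partial>Q \<partial>M)"
      by (intro nn_integral_mono pt)
    also have "\<dots> = (\<integral>\<^sup>+g. \<integral>\<^sup>+\<omega>. ennreal (exp (t * (B * \<rho> g \<omega>))) \<partial>M \<partial>Q)"
      by (rule QM.Fubini') measurable
    also have "\<dots> \<le> (\<integral>\<^sup>+g. A \<partial>Q)"
    proof (rule nn_integral_mono)
      fix g assume g: "g \<in> space Q"
      show "(\<integral>\<^sup>+\<omega>. ennreal (exp (t * (B * \<rho> g \<omega>))) \<partial>M) \<le> A"
      proof (cases "0 < w g")
        case True then show ?thesis using A[of g] g by (simp add: \<rho>_def)
      next
        case False
        then have "w g = 0" using w0 g by force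
        then show ?thesis using A1 by (simp add: \<rho>_def M.emeasure_space_1)
      qed
    qed
    also have "\<dots> = A" using Q.emeasure_space_1 by simp
    finally show ?thesis .
  qed
qed

text \<open>Parameter integrals are measurable for \<sigma>-finite measures. The finite measure
  \<open>w dR\<close> with integrand \<open>\<psi> / w\<close> takes the place of R, which is
  legitimate since \<psi> vanishes wherever w does.\<close>

lemma borel_measurable_mixture:
  fixes \<psi> :: "'g \<Rightarrow> 'w \<Rightarrow> real" and w :: "'g \<Rightarrow> real"
  assumes \<psi>[measurable]: "(\<lambda>(g, \<omega>). \<psi> g \<omega>) \<in> borel_measurable (R \<Otimes>\<^sub>M M)"
    and w[measurable]: "w \<in> borel_measurable R"
    and bnd: "\<And>g \<omega>. g \<in> space R \<Longrightarrow> \<omega> \<in> space M \<Longrightarrow> 0 \<le> \<psi> g \<omega> \<and> \<psi> g \<omega> \<le> w g"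
    and fin: "(\<integral>\<^sup>+g. ennreal (w g) \<partial>R) < \<infinity>"
  shows "(\<lambda>\<omega>. \<integral>\<^sup>+g. ennreal (\<psi> g \<omega>) \<partial>R) \<in> borel_measurable M"
proof -
  define Q where "Q = density R (\<lambda>g. ennreal (w g))"
  have [measurable_cong, simp]: "sets Q = sets R" and spQ[simp]: "space Q = space R"
    by (auto simp: Q_def)
  have "emeasure Q (space Q) = (\<integral>\<^sup>+g. ennreal (w g) \<partial>R)"
    unfolding Q_def by (subst emeasure_density) (auto intro!: nn_integral_cong)
  then interpret Q: finite_measure Q using fin by (intro finite_measureI) auto
  have [measurable]: "(\<lambda>(\<omega>, g). \<psi> g \<omega> / w g) \<in> borel_measurable (M \<Otimes>\<^sub>M Q)"
    by measurable
  have "(\<lambda>\<omega>. \<integral>\<^sup>+g. ennreal (\<psi> g \<omega> / w g) \<partial>Q) \<in> borel_measurable M"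
    by (rule Q.borel_measurable_nn_integral) measurable
  also have "?this \<longleftrightarrow> ?thesis"
  proof (rule measurable_cong)
    fix \<omega> assume \<omega>: "\<omega> \<in> space M"
    have "(\<integral>\<^sup>+g. ennreal (\<psi> g \<omega> / w g) \<partial>Q) = (\<integral>\<^sup>+g. ennreal (w g) * ennreal (\<psi> g \<omega> / w g) \<partial>R)"
      unfolding Q_def using \<omega> by (subst nn_integral_density) auto
    also have "\<dots> = (\<integral>\<^sup>+g. ennreal (\<psi> g \<omega>) \<partial>R)"
    proof (rule nn_integral_cong)
      fix g assume "g \<in> space R"
      from bnd[OF this \<omega>] show "ennreal (w g) * ennreal (\<psi> g \<omega> / w g) = ennreal (\<psi> g \<omega>)"
        by (cases "w g = 0") (auto simp: ennreal_mult[symmetric])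
    qed
    finally show "(\<integral>\<^sup>+g. ennreal (\<psi> g \<omega> / w g) \<partial>Q) = (\<integral>\<^sup>+g. ennreal (\<psi> g \<omega>) \<partial>R)" .
  qed
  finally show ?thesis .
qed

section \<open>Perturbing an exponent by a concentrated error\<close>

lemma exp_sum_le_squares: "exp (p + q) \<le> (exp (2 * p) + exp (2 * q)) / 2" for p q :: real
proof -
  have "2 * exp p * exp q \<le> (exp p)\<^sup>2 + (exp q)\<^sup>2" by (rule sum_squares_bound)
  then show ?thesis unfolding exp_double exp_add by simp
qed

text \<open>Where \<open>x \<le> e\<close> the first summand dominates; elsewhere \<open>exp (l * (x - e)) \<ge> 1\<close> and the
  remaining product is split by the inequality of arithmetic and geometric means.\<close>

lemma exp_perturbation_pointwise:
  fixes s x e :: real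
  assumes x: "0 \<le> x" and l: "0 \<le> l"
  shows "exp (s + x) \<le> exp (s + e) + (exp (2 * s - a) + exp (2 * x + 2 * l * (x - e) + a)) / 2"
proof -
  have pos: "0 \<le> (exp (2 * s - a) + exp (2 * x + 2 * l * (x - e) + a)) / 2" by simp
  show "exp (s + x) \<le> exp (s + e) + (exp (2 * s - a) + exp (2 * x + 2 * l * (x - e) + a)) / 2"
  proof (cases "x \<le> e")
    case True
    then have "exp (s + x) \<le> exp (s + e)" by simp
    with pos show ?thesis by linarith
  next
    case False
    then have "0 \<le> l * (x - e)" using l by simp
    then have "exp (s + x) \<le> exp ((s - a / 2) + (x + l * (x - e) + a / 2))" by simp
    also have "\<dots> \<le> (exp (2 * (s - a / 2)) + exp (2 * (x + l * (x - e) + a / 2))) / 2"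
      by (rule exp_sum_le_squares)
    also have "\<dots> = (exp (2 * s - a) + exp (2 * x + 2 * l * (x - e) + a)) / 2"
      by (simp add: algebra_simps)
    finally show ?thesis using exp_ge_zero[of "s + e"] by linarith
  qed
qed

text \<open>Where the error X is at most \<epsilon>, the exponent changes by at most
  \<open>\<alpha> N * \<epsilon>\<close>. The rest is bounded by an exponential moment of X of order
  \<open>const * \<alpha> N\<close> with a constant as large as desired, and by the second moment of
  \<open>exp (S N \<omega>)\<close>. Since \<Lambda> is nonnegative, a remainder that decays
  exponentially at speed \<alpha> is negligible.\<close>

lemma exp_rate_perturb:
  fixes \<alpha> :: "nat \<Rightarrow> real" and S Y X :: "nat \<Rightarrow> 'w \<Rightarrow> real"
  assumes lim: "filterlim \<alpha> at_top sequentially" "(\<lambda>N. \<alpha> N / real N) \<longlonglongrightarrow> 0"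
    and M: "\<And>N. N \<ge> 1 \<Longrightarrow> prob_space (M N)"
    and SYX: "\<And>N \<omega>. N \<ge> 1 \<Longrightarrow> \<omega> \<in> space (M N) \<Longrightarrow> 0 \<le> X N \<omega> \<and> \<bar>Y N \<omega> - S N \<omega>\<bar> \<le> \<alpha> N * X N \<omega>"
    and int: "\<And>N. N \<ge> 1 \<Longrightarrow> integrable (M N) (\<lambda>\<omega>. exp (S N \<omega>))"
      "\<And>N. N \<ge> 1 \<Longrightarrow> integrable (M N) (\<lambda>\<omega>. exp (2 * S N \<omega>))"
      "\<And>N. N \<ge> 1 \<Longrightarrow> integrable (M N) (\<lambda>\<omega>. exp (Y N \<omega>))"
    and X: "\<And>N. N \<ge> 1 \<Longrightarrow> X N \<in> borel_measurable (M N)"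
    and conc: "\<And>N t. N \<ge> 1 \<Longrightarrow> 0 \<le> t \<Longrightarrow>
       (\<integral>\<^sup>+\<omega>. ennreal (exp (t * X N \<omega>)) \<partial>M N) \<le> ennreal (C * exp (c * t\<^sup>2 / real N))"
    and Cc: "0 \<le> C" "0 \<le> c"
    and r: "exp_rate \<alpha> (\<lambda>N. \<integral>\<omega>. exp (S N \<omega>) \<partial>M N) \<Lambda>" "0 \<le> \<Lambda>"
    and r2: "exp_rate \<alpha> (\<lambda>N. \<integral>\<omega>. exp (2 * S N \<omega>) \<partial>M N) \<Lambda>2"
  shows "exp_rate \<alpha> (\<lambda>N. \<integral>\<omega>. exp (Y N \<omega>) \<partial>M N) \<Lambda>"
  unfolding exp_rate_def
proof (intro allI impI)
  fix \<epsilon>' :: real assume e': "0 < \<epsilon>'"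
  define \<epsilon> where "\<epsilon> = \<epsilon>' / 3"
  have e: "0 < \<epsilon>" using e' by (simp add: \<epsilon>_def)
  \<comment> \<open>The remainder is to decay like \<open>exp (- \<alpha> N * b)\<close>. The weight
    a of the arithmetic-geometric split pulls \<open>exp (2 * S N \<omega>)\<close> below this
    level, the 1 in a covering the approximation of the rate \<Lambda>2. Then l is taken large
    enough to beat \<open>a + b\<close> together with the factor \<open>exp (\<alpha> N)\<close>
    allowed by \<open>ev1\<close>.\<close>
  define b where "b = 2 * \<epsilon>"
  define a where "a = \<bar>\<Lambda>2\<bar> + 1 + b"
  define l where "l = (a + b + 1) / (2 * \<epsilon>)"
  have b0: "0 < b" and a0: "0 < a" using e by (auto simp: a_def b_def)
  have l0: "0 \<le> l" using e a0 b0 by (simp add: l_def)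
  have le: "2 * l * \<epsilon> = a + b + 1" using e by (simp add: l_def)
  have ev0: "\<forall>\<^sub>F N in sequentially. 1 \<le> \<alpha> N"
    using lim(1) by (simp add: filterlim_at_top)
  \<comment> \<open>The only place where \<alpha> has to be small compared with N: with
    \<open>t = \<alpha> N * (2 + 2 * l)\<close> the sub-Gaussian exponent
    \<open>c * t^2 / real N\<close> is at most \<open>\<alpha> N\<close>, whatever l is.\<close>
  have ev1: "\<forall>\<^sub>F N in sequentially. c * (2 + 2 * l)\<^sup>2 * (\<alpha> N / real N) \<le> 1"
  proof -
    have "(\<lambda>N. c * (2 + 2 * l)\<^sup>2 * (\<alpha> N / real N)) \<longlonglongrightarrow> c * (2 + 2 * l)\<^sup>2 * 0"
      by (intro tendsto_intros lim)
    then have "\<forall>\<^sub>F N in sequentially. c * (2 + 2 * l)\<^sup>2 * (\<alpha> N / real N) < 1"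
      by (rule order_tendstoD) simp
    then show ?thesis by eventually_elim simp
  qed
  have ev2: "\<forall>\<^sub>F N in sequentially. 1 + C \<le> exp (\<alpha> N * \<epsilon>)"
    and ev2': "\<forall>\<^sub>F N in sequentially. 2 \<le> exp (\<alpha> N * \<epsilon>)"
    using lim(1) e by (auto intro: eventually_const_le_exp)
  have ev3: "\<forall>\<^sub>F N in sequentially. (\<integral>\<omega>. exp (2 * S N \<omega>) \<partial>M N) \<le> exp (\<alpha> N * (\<bar>\<Lambda>2\<bar> + 1))"
    by (intro exp_rateD_le[OF r2]) simp
  have ev4: "\<forall>\<^sub>F N in sequentially. (\<integral>\<omega>. exp (S N \<omega>) \<partial>M N) \<le> exp (\<alpha> N * (\<Lambda> + \<epsilon>))"
    using e by (intro exp_rateD_le[OF r(1)]) simp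
  have ev5: "\<forall>\<^sub>F N in sequentially. exp (\<alpha> N * (\<Lambda> - \<epsilon>)) \<le> (\<integral>\<omega>. exp (S N \<omega>) \<partial>M N)"
    using e by (intro exp_rateD_ge[OF r(1)]) simp
  show "\<forall>\<^sub>F N in sequentially. exp (\<alpha> N * (\<Lambda> - \<epsilon>')) \<le> (\<integral>\<omega>. exp (Y N \<omega>) \<partial>M N)
      \<and> (\<integral>\<omega>. exp (Y N \<omega>) \<partial>M N) \<le> exp (\<alpha> N * (\<Lambda> + \<epsilon>'))"
    using ev0 ev1 ev2 ev2' ev3 ev4 ev5 eventually_ge_at_top[of 1]
  proof eventually_elim
    case (elim N)
    note N = elim(8)
    interpret prob_space "M N" using M N by simp
    note [measurable] = X[OF N]
    let ?x = "\<lambda>\<omega>. \<alpha> N * X N \<omega>"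
    define e1 where "e1 = \<alpha> N * \<epsilon>"
    define a1 where "a1 = \<alpha> N * a"
    define T where "T \<omega> = exp (2 * ?x \<omega> + 2 * l * (?x \<omega> - e1) + a1)" for \<omega>
    define Rm where "Rm \<omega> = (exp (2 * S N \<omega> - a1) + T \<omega>) / 2" for \<omega>
    define t where "t = \<alpha> N * (2 + 2 * l)"
    have t0: "0 \<le> t" using elim(1) l0 by (simp add: t_def)
    have Te: "T \<omega> = exp (a1 - 2 * l * e1) * exp (t * X N \<omega>)" for \<omega>
      by (simp add: T_def t_def exp_add[symmetric] algebra_simps)
    have [simp]: "integrable (M N) (\<lambda>\<omega>. exp (t * X N \<omega>))"
      using conc[OF N t0] by (intro integrableI_bounded) (auto simp: le_less_trans)
    then have intT: "integrable (M N) T" unfolding Te by simp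
    have "ennreal (expectation (\<lambda>\<omega>. exp (t * X N \<omega>))) \<le> ennreal (C * exp (c * t\<^sup>2 / real N))"
      using conc[OF N t0] by (subst nn_integral_eq_integral[symmetric]) auto
    then have "expectation (\<lambda>\<omega>. exp (t * X N \<omega>)) \<le> C * exp (c * t\<^sup>2 / real N)"
      using Cc by (subst (asm) ennreal_le_iff) auto
    also have "c * t\<^sup>2 / real N = \<alpha> N * (c * (2 + 2 * l)\<^sup>2 * (\<alpha> N / real N))"
      by (simp add: t_def power_mult_distrib power2_eq_square)
    also have "C * exp \<dots> \<le> C * exp (\<alpha> N * 1)"
    proof -
      have "\<alpha> N * (c * (2 + 2 * l)\<^sup>2 * (\<alpha> N / real N)) \<le> \<alpha> N * 1"
        using elim(1,2) by (intro mult_left_mono) auto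
      then show ?thesis using Cc by (intro mult_left_mono) auto
    qed
    finally have "expectation T \<le> exp (a1 - 2 * l * e1) * (C * exp (\<alpha> N * 1))"
      unfolding Te by (simp add: mult_left_mono)
    also have "\<dots> = C * (exp (a1 - 2 * l * e1) * exp (\<alpha> N * 1))" by simp
    also have "exp (a1 - 2 * l * e1) * exp (\<alpha> N * 1) = exp (\<alpha> N * (a - 2 * l * \<epsilon> + 1))"
      by (simp add: exp_add[symmetric] a1_def e1_def algebra_simps)
    also have "\<alpha> N * (a - 2 * l * \<epsilon> + 1) = - \<alpha> N * b" unfolding le by (simp add: algebra_simps)
    finally have ET: "expectation T \<le> C * exp (- \<alpha> N * b)" .
    have intRm: "integrable (M N) Rm" unfolding Rm_def using intT int(2)[OF N]
      by (auto simp: exp_diff)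
    have "expectation Rm = (expectation (\<lambda>\<omega>. exp (2 * S N \<omega>)) * exp (- a1) + expectation T) / 2"
      unfolding Rm_def using intT int(2)[OF N] by (simp add: exp_diff exp_minus field_simps)
    also have "\<dots> \<le> (exp (\<alpha> N * (\<bar>\<Lambda>2\<bar> + 1)) * exp (- a1) + C * exp (- \<alpha> N * b)) / 2"
      using elim(5) ET by (intro divide_right_mono add_mono mult_right_mono) auto
    also have "exp (\<alpha> N * (\<bar>\<Lambda>2\<bar> + 1)) * exp (- a1) = exp (- \<alpha> N * b)"
      by (simp add: exp_add[symmetric] a1_def a_def algebra_simps)
    also have "(exp (- \<alpha> N * b) + C * exp (- \<alpha> N * b)) / 2 = (1 + C) * exp (- \<alpha> N * b) / 2"
      by (simp add: algebra_simps)
    also have "\<dots> \<le> exp (\<alpha> N * \<epsilon>) * exp (- \<alpha> N * b) / 2"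
      using elim(3) by (intro divide_right_mono mult_right_mono) auto
    also have "\<dots> = exp (\<alpha> N * (- \<epsilon>)) / 2"
      by (simp add: exp_add[symmetric] b_def algebra_simps)
    finally have ERm: "expectation Rm \<le> exp (\<alpha> N * (- \<epsilon>)) / 2" .
    \<comment> \<open>Here \<open>0 \<le> \<Lambda>\<close> makes the remainder small compared with
      the lower bound for the integral of \<open>exp (S N \<omega>)\<close>.\<close>
    have al: "\<alpha> N * (- \<epsilon>) \<le> \<alpha> N * (\<Lambda> - \<epsilon>)" using elim(1) r(2) by (intro mult_left_mono) auto
    have pt1: "exp (Y N \<omega>) \<le> exp e1 * exp (S N \<omega>) + Rm \<omega>" if "\<omega> \<in> space (M N)" for \<omega>
    proof -
      have "Y N \<omega> \<le> S N \<omega> + ?x \<omega>" using SYX[OF N that] by linarith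
      then have "exp (Y N \<omega>) \<le> exp (S N \<omega> + ?x \<omega>)" by simp
      also have "\<dots> \<le> exp (S N \<omega> + e1) + Rm \<omega>"
        unfolding Rm_def T_def using SYX[OF N that] elim(1) l0
        by (intro exp_perturbation_pointwise) auto
      finally show ?thesis by (simp add: exp_add mult.commute)
    qed
    \<comment> \<open>The reverse comparison uses the same remainder \<open>Rm\<close>, so the
      second moment of \<open>exp (S N \<omega>)\<close> suffices for both directions and none of
      \<open>exp (Y N \<omega>)\<close> is needed.\<close>
    have pt2: "exp (S N \<omega>) \<le> exp e1 * exp (Y N \<omega>) + Rm \<omega>" if "\<omega> \<in> space (M N)" for \<omega>
    proof (cases "?x \<omega> \<le> e1")
      case True
      have "S N \<omega> \<le> Y N \<omega> + ?x \<omega>" using SYX[OF N that] by linarith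
      then have "exp (S N \<omega>) \<le> exp (Y N \<omega> + ?x \<omega>)" by simp
      also have "\<dots> \<le> exp (Y N \<omega> + e1)" using True by simp
      also have "\<dots> = exp e1 * exp (Y N \<omega>)" by (simp add: exp_add)
      finally show ?thesis by (simp add: Rm_def T_def add_increasing2)
    next
      case False
      have x0: "0 \<le> ?x \<omega>" using SYX[OF N that] elim(1) by simp
      have "0 \<le> l * (?x \<omega> - e1)" using False l0 by simp
      then have "exp (S N \<omega>) \<le> exp ((S N \<omega> - a1 / 2) + (?x \<omega> + l * (?x \<omega> - e1) + a1 / 2))"
        using x0 by simp
      also have "\<dots> \<le> (exp (2 * (S N \<omega> - a1 / 2)) + exp (2 * (?x \<omega> + l * (?x \<omega> - e1) + a1 / 2))) / 2"
        by (rule exp_sum_le_squares)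
      also have "\<dots> = Rm \<omega>" by (simp add: Rm_def T_def algebra_simps)
      finally show ?thesis by (simp add: add_increasing)
    qed
    have "expectation (\<lambda>\<omega>. exp (Y N \<omega>)) \<le> expectation (\<lambda>\<omega>. exp e1 * exp (S N \<omega>) + Rm \<omega>)"
      using int[OF N] intRm by (intro integral_mono pt1) auto
    also have "\<dots> = exp e1 * expectation (\<lambda>\<omega>. exp (S N \<omega>)) + expectation Rm"
      using int[OF N] intRm by simp
    also have "\<dots> \<le> exp e1 * exp (\<alpha> N * (\<Lambda> + \<epsilon>)) + exp (\<alpha> N * (- \<epsilon>)) / 2"
      using elim(6) ERm by (intro add_mono mult_left_mono) auto
    also have "\<dots> \<le> exp e1 * exp (\<alpha> N * (\<Lambda> + \<epsilon>)) + exp (\<alpha> N * (\<Lambda> + 2 * \<epsilon>))"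
    proof (rule add_left_mono)
      have "\<alpha> N * (- \<epsilon>) \<le> \<alpha> N * (\<Lambda> + 2 * \<epsilon>)" using elim(1) r(2) e by (intro mult_left_mono) auto
      then have "exp (\<alpha> N * (- \<epsilon>)) \<le> exp (\<alpha> N * (\<Lambda> + 2 * \<epsilon>))" by simp
      then show "exp (\<alpha> N * (- \<epsilon>)) / 2 \<le> exp (\<alpha> N * (\<Lambda> + 2 * \<epsilon>))"
        using exp_gt_zero[of "\<alpha> N * (- \<epsilon>)"] by linarith
    qed
    also have "exp e1 * exp (\<alpha> N * (\<Lambda> + \<epsilon>)) = exp (\<alpha> N * (\<Lambda> + 2 * \<epsilon>))"
      by (simp add: e1_def exp_add[symmetric] algebra_simps)
    also have "exp (\<alpha> N * (\<Lambda> + 2 * \<epsilon>)) + exp (\<alpha> N * (\<Lambda> + 2 * \<epsilon>)) = 2 * exp (\<alpha> N * (\<Lambda> + 2 * \<epsilon>))"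
      by simp
    also have "\<dots> \<le> exp (\<alpha> N * \<epsilon>) * exp (\<alpha> N * (\<Lambda> + 2 * \<epsilon>))"
      using elim(4) by (intro mult_right_mono) auto
    also have "\<dots> = exp (\<alpha> N * (\<Lambda> + \<epsilon>'))" by (simp add: \<epsilon>_def exp_add[symmetric] algebra_simps)
    finally have up: "expectation (\<lambda>\<omega>. exp (Y N \<omega>)) \<le> exp (\<alpha> N * (\<Lambda> + \<epsilon>'))" .
    have "exp (\<alpha> N * (\<Lambda> - \<epsilon>)) \<le> expectation (\<lambda>\<omega>. exp (S N \<omega>))" by (fact elim(7))
    also have "\<dots> \<le> expectation (\<lambda>\<omega>. exp e1 * exp (Y N \<omega>) + Rm \<omega>)"
      using int[OF N] intRm by (intro integral_mono pt2) auto
    also have "\<dots> = exp e1 * expectation (\<lambda>\<omega>. exp (Y N \<omega>)) + expectation Rm"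
      using int[OF N] intRm by simp
    also have "\<dots> \<le> exp e1 * expectation (\<lambda>\<omega>. exp (Y N \<omega>)) + exp (\<alpha> N * (\<Lambda> - \<epsilon>)) / 2"
    proof (rule add_left_mono)
      have "exp (\<alpha> N * (- \<epsilon>)) \<le> exp (\<alpha> N * (\<Lambda> - \<epsilon>))" using al by simp
      with ERm show "expectation Rm \<le> exp (\<alpha> N * (\<Lambda> - \<epsilon>)) / 2" by linarith
    qed
    finally have "exp (\<alpha> N * (\<Lambda> - \<epsilon>)) \<le> 2 * (exp e1 * expectation (\<lambda>\<omega>. exp (Y N \<omega>)))" by simp
    also have "\<dots> \<le> exp e1 * (exp e1 * expectation (\<lambda>\<omega>. exp (Y N \<omega>)))"
      using elim(4) by (intro mult_right_mono) (auto simp: e1_def)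
    finally have "exp (\<alpha> N * (\<Lambda> - \<epsilon>)) \<le> exp (2 * e1) * expectation (\<lambda>\<omega>. exp (Y N \<omega>))"
      by (simp add: mult.assoc[symmetric] exp_add[symmetric])
    then have "exp (\<alpha> N * (\<Lambda> - \<epsilon>)) / exp (2 * e1) \<le> expectation (\<lambda>\<omega>. exp (Y N \<omega>))"
      by (simp add: pos_divide_le_eq mult.commute)
    moreover have "\<alpha> N * (\<Lambda> - \<epsilon>') = \<alpha> N * (\<Lambda> - \<epsilon>) - 2 * e1"
      by (simp add: \<epsilon>_def e1_def algebra_simps)
    ultimately show ?case using up by (simp only: exp_diff)
  qed
qed

section \<open>The particle system\<close>

locale mean_field =
  fixes E :: "nat \<Rightarrow> 'a measure" and K :: "nat \<Rightarrow> 'a measure \<Rightarrow> 'a \<Rightarrow> 'a measure" and \<eta>0 :: "'a measure"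
  assumes model: "mean_field_model E K \<eta>0"
begin

abbreviation Prob where "Prob n \<equiv> space (prob_algebra (E n))"
abbreviation conf where "conf N n \<equiv> PiM {1..N} (\<lambda>_. E n)"
text \<open>Only times strictly before m are recorded. For m = 0 the space is trivial, so the
  initial step has the same form as the later ones: sampling given the past.\<close>

abbreviation traj where "traj N m \<equiv> PiM {..<m} (\<lambda>k. conf N k)"

lemma eta0_Prob: "\<eta>0 \<in> Prob 0"
  using model by (simp add: mean_field_model_def)

lemma kernel_measurable: "\<eta> \<in> Prob n \<Longrightarrow> K (Suc n) \<eta> \<in> E n \<rightarrow>\<^sub>M prob_algebra (E (Suc n))"
  using model by (simp add: mean_field_model_def)

lemma kernel_Prob: "\<eta> \<in> Prob n \<Longrightarrow> x \<in> space (E n) \<Longrightarrow> K (Suc n) \<eta> x \<in> Prob (Suc n)"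
  using measurable_space[OF kernel_measurable] .

lemma Phi_Prob: "\<eta> \<in> Prob n \<Longrightarrow> Phi K (Suc n) \<eta> \<in> Prob (Suc n)"
  using prob_space_bind'[OF _ kernel_measurable] sets_bind'[OF _ kernel_measurable]
  by (simp add: Phi_def space_prob_algebra)

lemma flow_Prob: "flow K \<eta>0 n \<in> Prob n"
  by (induction n) (auto intro: eta0_Prob Phi_Prob)

lemma Prob_space: "\<eta> \<in> Prob n \<Longrightarrow> space \<eta> = space (E n)"
  by (rule sets_eq_imp_space_eq) (simp add: space_prob_algebra)

lemma Prob_prob_space: "\<eta> \<in> Prob n \<Longrightarrow> prob_space \<eta>"
  by (simp add: space_prob_algebra)

lemma Prob_measurable: "\<eta> \<in> Prob n \<Longrightarrow> f \<in> borel_measurable (E n) \<Longrightarrow> f \<in> borel_measurable \<eta>"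
  by (simp add: space_prob_algebra cong: measurable_cong_sets)

lemma bounded_measE:
  assumes "f \<in> bounded_meas (E n)"
  obtains b where "f \<in> borel_measurable (E n)" "0 \<le> b" "\<And>x. x \<in> space (E n) \<Longrightarrow> \<bar>f x\<bar> \<le> b"
proof -
  from assms obtain b where "f \<in> borel_measurable (E n)" "\<And>x. x \<in> space (E n) \<Longrightarrow> \<bar>f x\<bar> \<le> b"
    by (auto simp: bounded_meas_def bounded_iff)
  then show ?thesis by (intro that[of "\<bar>b\<bar>"]) (auto intro: order_trans[OF _ abs_ge_self])
qed

lemma bounded_measI:
  "f \<in> borel_measurable (E n) \<Longrightarrow> (\<And>x. x \<in> space (E n) \<Longrightarrow> \<bar>f x\<bar> \<le> b) \<Longrightarrow> f \<in> bounded_meas (E n)"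
  by (auto simp: bounded_meas_def bounded_iff)

lemma Prob_integrable:
  assumes "\<eta> \<in> Prob n" "f \<in> bounded_meas (E n)" shows "integrable \<eta> f"
proof -
  interpret prob_space \<eta> using assms Prob_prob_space by blast
  from assms(2) obtain b where b: "f \<in> borel_measurable (E n)" "0 \<le> b" "\<And>x. x \<in> space (E n) \<Longrightarrow> \<bar>f x\<bar> \<le> b"
    by (rule bounded_measE) blast
  then show ?thesis
    using Prob_measurable[OF assms(1)] Prob_space[OF assms(1)]
    by (intro integrable_bounded[where b=b]) auto
qed

lemma Prob_integral_bound:
  fixes f :: "'a \<Rightarrow> real"
  assumes "\<eta> \<in> Prob n" "f \<in> borel_measurable (E n)" "\<And>x. x \<in> space (E n) \<Longrightarrow> \<bar>f x\<bar> \<le> b"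
  shows "\<bar>\<integral>x. f x \<partial>\<eta>\<bar> \<le> b"
proof -
  interpret prob_space \<eta> using assms Prob_prob_space by blast
  show ?thesis
    using assms Prob_measurable[OF assms(1)] Prob_space[OF assms(1)]
    by (intro expectation_bounded) auto
qed

lemma space_conf: "x \<in> space (conf N n) \<Longrightarrow> i \<in> {1..N} \<Longrightarrow> x i \<in> space (E n)"
  by (auto simp: space_PiM)

lemma empirical_Prob:
  assumes "N \<ge> 1" "x \<in> space (conf N n)"
  shows "empirical (E n) N x \<in> Prob n"
proof -
  have x: "x \<in> uniform_count_measure {1..N} \<rightarrow>\<^sub>M E n"
    using space_conf[OF assms(2)]
    by (intro measurableI) (auto simp: space_uniform_count_measure sets_uniform_count_measure)
  interpret prob_space "uniform_count_measure {1..N}"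
    using assms by (intro prob_space_uniform_count_measure) auto
  show ?thesis
    using prob_space_distr[OF x] by (simp add: empirical_def space_prob_algebra)
qed

lemma integral_empirical:
  fixes f :: "'a \<Rightarrow> real"
  assumes "x \<in> space (conf N n)" "f \<in> borel_measurable (E n)"
  shows "(\<integral>y. f y \<partial>empirical (E n) N x) = (\<Sum>i\<in>{1..N}. f (x i)) / real N"
proof -
  have x: "x \<in> uniform_count_measure {1..N} \<rightarrow>\<^sub>M E n"
    using space_conf[OF assms(1)]
    by (intro measurableI) (auto simp: space_uniform_count_measure sets_uniform_count_measure)
  show ?thesis unfolding empirical_def
    using assms by (subst integral_distr[OF x]) (simp_all add: integral_uniform_count_measure)
qed

lemma kernel_integral_measurable:
  fixes f :: "'a \<Rightarrow> real"
  assumes "\<eta> \<in> Prob n" "f \<in> borel_measurable (E (Suc n))"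
  shows "(\<lambda>x. \<integral>y. f y \<partial>K (Suc n) \<eta> x) \<in> borel_measurable (E n)"
  using measurable_compose[OF measurable_prob_algebraD[OF kernel_measurable[OF assms(1)]]
      integral_measurable_subprob_algebra[OF assms(2)]] .

lemma kernel_integral_bounded:
  fixes f :: "'a \<Rightarrow> real"
  assumes \<eta>: "\<eta> \<in> Prob n" and f: "f \<in> bounded_meas (E (Suc n))"
  shows "(\<lambda>x. \<integral>y. f y \<partial>K (Suc n) \<eta> x) \<in> bounded_meas (E n)"
proof -
  from f obtain b where b: "f \<in> borel_measurable (E (Suc n))" "0 \<le> b" "\<And>x. x \<in> space (E (Suc n)) \<Longrightarrow> \<bar>f x\<bar> \<le> b"
    by (rule bounded_measE) blast
  show ?thesis
    using kernel_integral_measurable[OF \<eta> b(1)] Prob_integral_bound[OF kernel_Prob[OF \<eta>] b(1,3)]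
    by (intro bounded_measI)
qed

lemma integral_Phi:
  fixes f :: "'a \<Rightarrow> real"
  assumes \<eta>: "\<eta> \<in> Prob n" and f: "f \<in> bounded_meas (E (Suc n))"
  shows "(\<integral>y. f y \<partial>Phi K (Suc n) \<eta>) = (\<integral>x. (\<integral>y. f y \<partial>K (Suc n) \<eta> x) \<partial>\<eta>)"
proof -
  from f obtain b where b: "f \<in> borel_measurable (E (Suc n))" "0 \<le> b" "\<And>x. x \<in> space (E (Suc n)) \<Longrightarrow> \<bar>f x\<bar> \<le> b"
    by (rule bounded_measE) blast
  interpret prob_space \<eta> using \<eta> by (rule Prob_prob_space)
  have Km: "K (Suc n) \<eta> \<in> \<eta> \<rightarrow>\<^sub>M subprob_algebra (E (Suc n))"
    using measurable_prob_algebraD[OF kernel_measurable[OF \<eta>]] \<eta>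
    by (simp add: space_prob_algebra cong: measurable_cong_sets)
  show ?thesis unfolding Phi_def
  proof (rule integral_bind[OF b(1) b(3) Km, where B'=1])
    show "finite_measure \<eta>" by unfold_locales
    show "AE x in \<eta>. emeasure (K (Suc n) \<eta> x) (space (K (Suc n) \<eta> x)) \<le> ennreal 1"
      using kernel_Prob[OF \<eta>] Prob_space[OF \<eta>]
      by (intro AE_I2) (metis Prob_prob_space ennreal_1 prob_space.emeasure_space_1 order_refl)
  qed
qed

text \<open>The conditional law of particle i at time m given the past. At time 0 it ignores the
  past, which lets the factorisation and the Laplace transforms be stated once for all
  times.\<close>

fun law :: "nat \<Rightarrow> nat \<Rightarrow> (nat \<Rightarrow> nat \<Rightarrow> 'a) \<Rightarrow> nat \<Rightarrow> 'a measure" where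
  "law N 0 x i = \<eta>0"
| "law N (Suc m) x i = K (Suc m) (empirical (E m) N (x m)) (x m i)"

text \<open>The model gives measurability of the real probability of each single set; here it
  becomes measurability of a map into the space of probability measures, as the integration lemmas
  require.\<close>

lemma conf_law_measurable:
  assumes N: "N \<ge> 1" and i: "i \<in> {1..N}"
  shows "(\<lambda>x. K (Suc m) (empirical (E m) N x) (x i)) \<in> conf N m \<rightarrow>\<^sub>M prob_algebra (E (Suc m))"
proof -
  have P: "K (Suc m) (empirical (E m) N x) (x i) \<in> Prob (Suc m)" if "x \<in> space (conf N m)" for x
    using kernel_Prob[OF empirical_Prob[OF N that] space_conf[OF that i]] .
  show ?thesis
  proof (intro measurable_prob_algebraI measurable_subprob_algebra)
    fix x assume x: "x \<in> space (conf N m)"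
    show "prob_space (K (Suc m) (empirical (E m) N x) (x i))" using P[OF x] by (rule Prob_prob_space)
    then show "subprob_space (K (Suc m) (empirical (E m) N x) (x i))" by (rule prob_space_imp_subprob_space)
    show "sets (K (Suc m) (empirical (E m) N x) (x i)) = sets (E (Suc m))"
      using P[OF x] by (simp add: space_prob_algebra)
  next
    fix A assume A: "A \<in> sets (E (Suc m))"
    have "(\<lambda>x. measure (K (Suc m) (empirical (E m) N x) (x i)) A) \<in> borel_measurable (conf N m)"
      using model N i A unfolding mean_field_model_def by blast
    then have "(\<lambda>x. ennreal (measure (K (Suc m) (empirical (E m) N x) (x i)) A)) \<in> borel_measurable (conf N m)"
      by simp
    also have "?this \<longleftrightarrow> (\<lambda>x. emeasure (K (Suc m) (empirical (E m) N x) (x i)) A) \<in> borel_measurable (conf N m)"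
    proof (rule measurable_cong)
      fix x assume x: "x \<in> space (conf N m)"
      interpret prob_space "K (Suc m) (empirical (E m) N x) (x i)" using P[OF x] by (rule Prob_prob_space)
      show "ennreal (measure (K (Suc m) (empirical (E m) N x) (x i)) A) = emeasure (K (Suc m) (empirical (E m) N x) (x i)) A"
        by (simp add: emeasure_eq_measure)
    qed
    finally show "(\<lambda>x. emeasure (K (Suc m) (empirical (E m) N x) (x i)) A) \<in> borel_measurable (conf N m)" .
  qed
qed

lemma law_measurable:
  assumes N: "N \<ge> 1" and i: "i \<in> {1..N}"
  shows "(\<lambda>x. law N m x i) \<in> traj N m \<rightarrow>\<^sub>M prob_algebra (E m)"
proof (cases m)
  case 0
  then show ?thesis using eta0_Prob by simp
next
  case (Suc k)
  have "(\<lambda>x. x k) \<in> traj N m \<rightarrow>\<^sub>M conf N k"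
    using Suc by (intro measurable_component_singleton) simp
  from measurable_compose[OF this conf_law_measurable[OF N i]] show ?thesis
    using Suc by simp
qed

lemma law_Prob: "N \<ge> 1 \<Longrightarrow> i \<in> {1..N} \<Longrightarrow> x \<in> space (traj N m) \<Longrightarrow> law N m x i \<in> Prob m"
  using measurable_space[OF law_measurable] .

lemma law_integral_measurable:
  fixes f :: "'a \<Rightarrow> real"
  assumes "N \<ge> 1" "i \<in> {1..N}" "f \<in> borel_measurable (E m)"
  shows "(\<lambda>x. \<integral>y. f y \<partial>law N m x i) \<in> borel_measurable (traj N m)"
  using measurable_compose[OF measurable_prob_algebraD[OF law_measurable[OF assms(1,2)]]
      integral_measurable_subprob_algebra[OF assms(3)]] .

lemma law_nn_integral_measurable:
  fixes f :: "'a \<Rightarrow> ennreal"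
  assumes "N \<ge> 1" "i \<in> {1..N}" "f \<in> borel_measurable (E m)"
  shows "(\<lambda>x. \<integral>\<^sup>+y. f y \<partial>law N m x i) \<in> borel_measurable (traj N m)"
  using measurable_compose[OF measurable_prob_algebraD[OF law_measurable[OF assms(1,2)]]
      nn_integral_measurable_subprob_algebra[OF assms(3)]] .

end

section \<open>One particle system: conditional independence in integrated form\<close>

locale particles = mean_field E K \<eta>0
  for E :: "nat \<Rightarrow> 'a measure" and K \<eta>0 +
  fixes N :: nat and M :: "'w measure" and \<xi> :: "nat \<Rightarrow> 'w \<Rightarrow> nat \<Rightarrow> 'a"
  assumes N: "N \<ge> 1"
    and system: "particle_system E K \<eta>0 N M \<xi>"
begin

sublocale prob_space M using system by (simp add: particle_system_def)

definition path :: "nat \<Rightarrow> 'w \<Rightarrow> nat \<Rightarrow> nat \<Rightarrow> 'a" where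
  "path m \<omega> = (\<lambda>k\<in>{..<m}. \<xi> k \<omega>)"

lemma xi_measurable[measurable]: "\<xi> m \<in> M \<rightarrow>\<^sub>M conf N m"
  using system by (simp add: particle_system_def)

lemma particle_measurable: "i \<in> {1..N} \<Longrightarrow> (\<lambda>\<omega>. \<xi> m \<omega> i) \<in> M \<rightarrow>\<^sub>M E m"
  using measurable_compose[OF xi_measurable measurable_component_singleton] .

lemma path_measurable[measurable]: "path m \<in> M \<rightarrow>\<^sub>M traj N m"
  unfolding path_def[abs_def] by (intro measurable_restrict xi_measurable)

text \<open>The conditional probability of a product set, tested against a function g of the past.
  At time 0 independence takes the place of the conditional statement.\<close>

lemma factor_sets:
  fixes g :: "(nat \<Rightarrow> nat \<Rightarrow> 'a) \<Rightarrow> real"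
  assumes g: "g \<in> borel_measurable (traj N m)" and int: "integrable M (\<lambda>\<omega>. g (path m \<omega>))"
    and A: "\<And>i. i \<in> {1..N} \<Longrightarrow> A i \<in> sets (E m)"
  defines "B \<equiv> {\<omega>\<in>space M. \<forall>i\<in>{1..N}. \<xi> m \<omega> i \<in> A i}"
  shows "(\<integral>\<omega>. g (path m \<omega>) * indicat_real B \<omega> \<partial>M)
       = (\<integral>\<omega>. g (path m \<omega>) * (\<Prod>i\<in>{1..N}. measure (law N m (path m \<omega>) i) (A i)) \<partial>M)"
proof -
  have B: "B \<in> sets M" unfolding B_def
    using particle_measurable A by (auto intro!: sets.sets_Collect_finite_All' measurable_sets_Collect simp: N)
  show ?thesis
  proof (cases m)
    case 0
    have iv: "indep_vars (\<lambda>_. E 0) (\<lambda>i \<omega>. \<xi> 0 \<omega> i) {1..N}"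
      and di: "\<And>i. i \<in> {1..N} \<Longrightarrow> distr M (E 0) (\<lambda>\<omega>. \<xi> 0 \<omega> i) = \<eta>0"
      using system by (auto simp: particle_system_def)
    have "{1..N} \<noteq> {}" using N by auto
    then have "B = (\<Inter>i\<in>{1..N}. (\<lambda>\<omega>. \<xi> 0 \<omega> i) -` A i \<inter> space M)"
      by (auto simp: B_def 0)
    then have "prob B = (\<Prod>i\<in>{1..N}. prob ((\<lambda>\<omega>. \<xi> 0 \<omega> i) -` A i \<inter> space M))"
      using indep_varsD_finite[OF iv _ _ A[unfolded 0]] N by auto
    also have "\<dots> = (\<Prod>i\<in>{1..N}. measure \<eta>0 (A i))"
      using A particle_measurable[of _ 0]
      by (intro prod.cong refl) (auto simp: 0 measure_distr di[symmetric])
    finally have "prob B = (\<Prod>i\<in>{1..N}. measure \<eta>0 (A i))" .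
    \<comment> \<open>The past of time 0 is a constant, so \<open>g (path 0 \<omega>)\<close> can be
      taken out of the integral.\<close>
    moreover have "path 0 = (\<lambda>_ _. undefined)" by (simp add: path_def fun_eq_iff)
    ultimately show ?thesis using B by (simp add: 0 prob_space)
  next
    case (Suc n)
    define F where "F = history E N M \<xi> n"
    \<comment> \<open>The times 0 to n are exactly those before \<open>Suc n\<close>, so
      \<open>history\<close> at n is generated by \<open>path m\<close> and
      \<open>g (path m \<omega>)\<close> is measurable with respect to it.\<close>
    have eq: "(\<lambda>\<omega>. \<lambda>k\<in>{0..n}. \<xi> k \<omega>) = path m"
      by (auto simp: path_def Suc fun_eq_iff restrict_def)
    have eq2: "PiM {0..n} (\<lambda>k. conf N k) = traj N m"
      by (simp add: Suc atLeast0AtMost lessThan_Suc_atMost)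
    have F: "F = vimage_algebra (space M) (path m) (traj N m)"
      by (simp only: F_def history_def eq eq2)
    have pF: "path m \<in> F \<rightarrow>\<^sub>M traj N m"
      unfolding F using measurable_space[OF path_measurable] by (intro measurable_vimage_algebra1) auto
    have sub: "subalgebra M F"
    proof -
      have "path m \<in> space M \<rightarrow> space (traj N m)" using measurable_space[OF path_measurable] by auto
      from sets_vimage_algebra2[OF this] show ?thesis
        unfolding subalgebra_def F using measurable_sets[OF path_measurable] by (auto simp del: One_nat_def)
    qed
    interpret finite_measure_subalgebra M F by unfold_locales (rule sub)
    have gF: "(\<lambda>\<omega>. g (path m \<omega>)) \<in> borel_measurable F"
      using measurable_compose[OF pF g] .
    have "integrable M (\<lambda>\<omega>. g (path m \<omega>) * indicat_real B \<omega>)"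
      by (rule integrable_real_mult_indicator[OF B int])
    from real_cond_exp_intg(2)[OF this gF] B
    have "(\<integral>\<omega>. g (path m \<omega>) * indicat_real B \<omega> \<partial>M) = (\<integral>\<omega>. g (path m \<omega>) * real_cond_exp M F (indicat_real B) \<omega> \<partial>M)"
      by simp
    also have "\<dots> = (\<integral>\<omega>. g (path m \<omega>) * (\<Prod>i\<in>{1..N}. measure (law N m (path m \<omega>) i) (A i)) \<partial>M)"
    proof (rule integral_cong_AE)
      have "(\<lambda>x. measure (law N m x i) (A i)) \<in> borel_measurable (traj N m)" if "i \<in> {1..N}" for i
        using measurable_compose[OF law_measurable[OF N that] measurable_measure_prob_algebra[OF A[OF that]]] .
      then have *: "(\<lambda>x. g x * (\<Prod>i\<in>{1..N}. measure (law N m x i) (A i))) \<in> borel_measurable (traj N m)"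
        using g by (intro borel_measurable_times borel_measurable_prod)
      show "(\<lambda>\<omega>. g (path m \<omega>) * (\<Prod>i\<in>{1..N}. measure (law N m (path m \<omega>) i) (A i))) \<in> borel_measurable M"
        using measurable_compose[OF path_measurable *] .
      show "(\<lambda>\<omega>. g (path m \<omega>) * real_cond_exp M F (indicat_real B) \<omega>) \<in> borel_measurable M"
        using measurable_compose[OF path_measurable g] by simp
      have "AE \<omega> in M. real_cond_exp M F (indicat_real B) \<omega> =
          (\<Prod>i\<in>{1..N}. measure (K (Suc n) (empirical (E n) N (\<xi> n \<omega>)) (\<xi> n \<omega> i)) (A i))"
        using system A unfolding particle_system_def F_def B_def Suc by blast
      then show "AE \<omega> in M. g (path m \<omega>) * real_cond_exp M F (indicat_real B) \<omega> =
          g (path m \<omega>) * (\<Prod>i\<in>{1..N}. measure (law N m (path m \<omega>) i) (A i))"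
        by eventually_elim (simp add: Suc path_def)
    qed
    finally show ?thesis .
  qed
qed


text \<open>The functions of the individual particles are passed from indicators to general measurable
  functions one coordinate at a time.\<close>

lemma factor_nn_integral_aux:
  fixes g :: "(nat \<Rightarrow> nat \<Rightarrow> 'a) \<Rightarrow> real" and \<phi> :: "nat \<Rightarrow> 'a \<Rightarrow> ennreal"
  assumes g: "g \<in> borel_measurable (traj N m)" and int: "integrable M (\<lambda>\<omega>. g (path m \<omega>))"
    and g0: "\<And>x. 0 \<le> g x"
    and I: "finite I" "I \<subseteq> {1..N}"
    and \<phi>: "\<And>i. i \<in> {1..N} \<Longrightarrow> \<phi> i \<in> borel_measurable (E m)"
    and ind: "\<And>i. i \<in> {1..N} - I \<Longrightarrow> \<exists>A\<in>sets (E m). \<phi> i = indicator A"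
  shows "(\<integral>\<^sup>+\<omega>. ennreal (g (path m \<omega>)) * (\<Prod>i\<in>{1..N}. \<phi> i (\<xi> m \<omega> i)) \<partial>M)
       = (\<integral>\<^sup>+\<omega>. ennreal (g (path m \<omega>)) * (\<Prod>i\<in>{1..N}. \<integral>\<^sup>+y. \<phi> i y \<partial>law N m (path m \<omega>) i) \<partial>M)"
  using I \<phi> ind
proof (induction I arbitrary: \<phi> rule: finite_induct)
  case empty
  then obtain A where A: "\<And>i. i \<in> {1..N} \<Longrightarrow> A i \<in> sets (E m)" "\<And>i. i \<in> {1..N} \<Longrightarrow> \<phi> i = indicator (A i)"
    by (metis Diff_empty)
  define B where "B = {\<omega>\<in>space M. \<forall>i\<in>{1..N}. \<xi> m \<omega> i \<in> A i}"
  define L where "L x = (\<Prod>i\<in>{1..N}. measure (law N m x i) (A i))" for x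
  have Bm: "B \<in> sets M" unfolding B_def
    using particle_measurable A(1) by (auto intro!: sets.sets_Collect_finite_All' measurable_sets_Collect simp: N)
  have gm: "(\<lambda>\<omega>. g (path m \<omega>)) \<in> borel_measurable M" using int by auto
  have Lm: "(\<lambda>\<omega>. L (path m \<omega>)) \<in> borel_measurable M"
    unfolding L_def
    by (intro borel_measurable_prod measurable_compose[OF path_measurable]
        measurable_compose[OF law_measurable[OF N] measurable_measure_prob_algebra] A) auto
  have P: "prob_space (law N m (path m \<omega>) i) \<and> sets (law N m (path m \<omega>) i) = sets (E m)"
    if "\<omega> \<in> space M" "i \<in> {1..N}" for \<omega> i
    using law_Prob[OF N that(2) measurable_space[OF path_measurable that(1)]] by (simp add: space_prob_algebra)
  have L01: "0 \<le> L (path m \<omega>) \<and> L (path m \<omega>) \<le> 1" if "\<omega> \<in> space M" for \<omega>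
    unfolding L_def using P[OF that] by (auto intro!: prod_nonneg prod_le_1 simp: prob_space.prob_le_1)
  have "(\<integral>\<^sup>+\<omega>. ennreal (g (path m \<omega>)) * (\<Prod>i\<in>{1..N}. \<phi> i (\<xi> m \<omega> i)) \<partial>M)
      = (\<integral>\<^sup>+\<omega>. ennreal (g (path m \<omega>) * indicat_real B \<omega>) \<partial>M)"
  proof (rule nn_integral_cong)
    fix \<omega> assume w: "\<omega> \<in> space M"
    have "(\<Prod>i\<in>{1..N}. \<phi> i (\<xi> m \<omega> i)) = (\<Prod>i\<in>{1..N}. ennreal (indicator (A i) (\<xi> m \<omega> i)))"
      using A(2) by (intro prod.cong refl) (simp add: ennreal_indicator)
    also have "\<dots> = ennreal (indicat_real B \<omega>)"
    proof (cases "\<omega> \<in> B")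
      case True then show ?thesis by (simp add: B_def)
    next
      case False
      with w obtain i where i: "i \<in> {1..N}" "\<xi> m \<omega> i \<notin> A i" by (auto simp: B_def)
      have "(\<Prod>i\<in>{1..N}. ennreal (indicator (A i) (\<xi> m \<omega> i))) = 0"
        using i by (intro prod_zero finite_atLeastAtMost bexI[of _ i]) simp_all
      with False show ?thesis by simp
    qed
    finally show "ennreal (g (path m \<omega>)) * (\<Prod>i\<in>{1..N}. \<phi> i (\<xi> m \<omega> i)) = ennreal (g (path m \<omega>) * indicat_real B \<omega>)"
      using g0 by (simp add: ennreal_mult)
  qed
  also have "\<dots> = ennreal (\<integral>\<omega>. g (path m \<omega>) * indicat_real B \<omega> \<partial>M)"
    using g0 by (intro nn_integral_eq_integral integrable_real_mult_indicator Bm int) auto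
  also have "\<dots> = ennreal (\<integral>\<omega>. g (path m \<omega>) * L (path m \<omega>) \<partial>M)"
    unfolding B_def L_def by (subst factor_sets[OF g int A(1)]) auto
  also have "\<dots> = (\<integral>\<^sup>+\<omega>. ennreal (g (path m \<omega>) * L (path m \<omega>)) \<partial>M)"
  proof (rule nn_integral_eq_integral[symmetric])
    show "integrable M (\<lambda>\<omega>. g (path m \<omega>) * L (path m \<omega>))"
      using L01 g0 gm Lm by (intro Bochner_Integration.integrable_bound[OF int])
        (auto intro!: AE_I2 mult_left_le simp: abs_mult)
    show "AE \<omega> in M. 0 \<le> g (path m \<omega>) * L (path m \<omega>)" using L01 g0 by (intro AE_I2) auto
  qed
  also have "\<dots> = (\<integral>\<^sup>+\<omega>. ennreal (g (path m \<omega>)) * (\<Prod>i\<in>{1..N}. \<integral>\<^sup>+y. \<phi> i y \<partial>law N m (path m \<omega>) i) \<partial>M)"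
  proof (rule nn_integral_cong)
    fix \<omega> assume w: "\<omega> \<in> space M"
    have "(\<integral>\<^sup>+y. \<phi> i y \<partial>law N m (path m \<omega>) i) = ennreal (measure (law N m (path m \<omega>) i) (A i))"
      if i: "i \<in> {1..N}" for i
    proof -
      interpret l: prob_space "law N m (path m \<omega>) i" using P[OF w i] by simp
      show ?thesis using A(1)[OF i] P[OF w i] by (simp add: A(2)[OF i] l.emeasure_eq_measure)
    qed
    then have "(\<Prod>i\<in>{1..N}. \<integral>\<^sup>+y. \<phi> i y \<partial>law N m (path m \<omega>) i) = ennreal (L (path m \<omega>))"
      by (simp add: L_def prod_ennreal)
    then show "ennreal (g (path m \<omega>) * L (path m \<omega>)) =
        ennreal (g (path m \<omega>)) * (\<Prod>i\<in>{1..N}. \<integral>\<^sup>+y. \<phi> i y \<partial>law N m (path m \<omega>) i)"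
      using g0 L01[OF w] by (simp add: ennreal_mult)
  qed
  finally show ?case .
next
  case (insert j I)
  then have j: "j \<in> {1..N}" by auto
  \<comment> \<open>Everything except the factor of particle j is frozen in a and b. Both sides of
    \<open>?P\<close> are then linear in u and continuous along increasing sequences, so induction
    over measurable functions reduces the claim to indicators.\<close>
  define a where "a \<omega> = ennreal (g (path m \<omega>)) * (\<Prod>i\<in>{1..N}-{j}. \<phi> i (\<xi> m \<omega> i))" for \<omega>
  define b where "b \<omega> = ennreal (g (path m \<omega>)) * (\<Prod>i\<in>{1..N}-{j}. \<integral>\<^sup>+y. \<phi> i y \<partial>law N m (path m \<omega>) i)" for \<omega>
  let ?P = "\<lambda>u. (\<integral>\<^sup>+\<omega>. a \<omega> * u (\<xi> m \<omega> j) \<partial>M) = (\<integral>\<^sup>+\<omega>. b \<omega> * (\<integral>\<^sup>+y. u y \<partial>law N m (path m \<omega>) j) \<partial>M)"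
  have gm[measurable]: "(\<lambda>\<omega>. ennreal (g (path m \<omega>))) \<in> borel_measurable M" using int by auto
  have am[measurable]: "a \<in> borel_measurable M" unfolding a_def[abs_def]
    using insert.prems(2)
    by (intro borel_measurable_times_ennreal borel_measurable_prod_ennreal gm
        measurable_compose[OF particle_measurable]) auto
  have Lm: "(\<lambda>\<omega>. \<integral>\<^sup>+y. u y \<partial>law N m (path m \<omega>) i) \<in> borel_measurable M"
    if "i \<in> {1..N}" "u \<in> borel_measurable (E m)" for i u
    using measurable_compose[OF path_measurable law_nn_integral_measurable[OF N that]] .
  have bm[measurable]: "b \<in> borel_measurable M" unfolding b_def[abs_def]
    using insert.prems(2)
    by (intro borel_measurable_times_ennreal borel_measurable_prod_ennreal gm Lm) auto
  have um: "(\<lambda>\<omega>. u (\<xi> m \<omega> j)) \<in> borel_measurable M" if "u \<in> borel_measurable (E m)" for u :: "'a \<Rightarrow> ennreal"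
    using measurable_compose[OF particle_measurable[OF j] that] .
  have sl: "sets (law N m (path m \<omega>) j) = sets (E m)" "space (law N m (path m \<omega>) j) = space (E m)"
    if "\<omega> \<in> space M" for \<omega>
    using law_Prob[OF N j measurable_space[OF path_measurable that]] Prob_space
    by (auto simp: space_prob_algebra)
  have ml: "u \<in> borel_measurable (law N m (path m \<omega>) j)"
    if "\<omega> \<in> space M" "u \<in> borel_measurable (E m)" for \<omega> and u :: "'a \<Rightarrow> ennreal"
    using that sl[OF that(1)] by (simp cong: measurable_cong_sets)
  have xs: "\<xi> m \<omega> j \<in> space (E m)" if "\<omega> \<in> space M" for \<omega>
    using measurable_space[OF particle_measurable[OF j] that] .
  have "?P (\<phi> j)"
    using insert.prems(2)[OF j]
  proof (induction rule: borel_measurable_induct)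
    case (cong f h)
    have "(\<integral>\<^sup>+\<omega>. a \<omega> * f (\<xi> m \<omega> j) \<partial>M) = (\<integral>\<^sup>+\<omega>. a \<omega> * h (\<xi> m \<omega> j) \<partial>M)"
      using cong(3) xs by (intro nn_integral_cong) simp
    moreover have "(\<integral>\<^sup>+\<omega>. b \<omega> * (\<integral>\<^sup>+y. f y \<partial>law N m (path m \<omega>) j) \<partial>M)
        = (\<integral>\<^sup>+\<omega>. b \<omega> * (\<integral>\<^sup>+y. h y \<partial>law N m (path m \<omega>) j) \<partial>M)"
      using cong(3) sl by (intro nn_integral_cong arg_cong[where f="\<lambda>x. _ * x"]) auto
    ultimately show ?case using cong(4) by simp
  next
    \<comment> \<open>With an indicator at coordinate j only the coordinates in I carry general
      functions, so the outer induction hypothesis applies.\<close>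
    case (set A)
    let ?\<phi> = "\<phi>(j := indicator A)"
    have *: "?\<phi> i \<in> borel_measurable (E m)" "i \<in> {1..N} - I \<Longrightarrow> \<exists>A\<in>sets (E m). ?\<phi> i = indicator A"
      if "i \<in> {1..N}" for i
      using that insert.prems set by auto
    have "(\<integral>\<^sup>+\<omega>. ennreal (g (path m \<omega>)) * (\<Prod>i\<in>{1..N}. ?\<phi> i (\<xi> m \<omega> i)) \<partial>M)
       = (\<integral>\<^sup>+\<omega>. ennreal (g (path m \<omega>)) * (\<Prod>i\<in>{1..N}. \<integral>\<^sup>+y. ?\<phi> i y \<partial>law N m (path m \<omega>) i) \<partial>M)"
      using insert.prems(1) * by (intro insert.IH) auto
    moreover have "(\<Prod>i\<in>{1..N}-{j}. ?\<phi> i (\<xi> m \<omega> i)) = (\<Prod>i\<in>{1..N}-{j}. \<phi> i (\<xi> m \<omega> i))"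
      "(\<Prod>i\<in>{1..N}-{j}. \<integral>\<^sup>+y. ?\<phi> i y \<partial>law N m (path m \<omega>) i)
        = (\<Prod>i\<in>{1..N}-{j}. \<integral>\<^sup>+y. \<phi> i y \<partial>law N m (path m \<omega>) i)" for \<omega>
      by (auto intro!: prod.cong)
    ultimately show ?case
      unfolding prod.remove[OF finite_atLeastAtMost j] a_def b_def
      by (simp only: fun_upd_same mult_ac)
  next
    case (mult u c)
    have "(\<integral>\<^sup>+\<omega>. a \<omega> * (c * u (\<xi> m \<omega> j)) \<partial>M) = (\<integral>\<^sup>+\<omega>. c * (a \<omega> * u (\<xi> m \<omega> j)) \<partial>M)"
      by (simp add: mult_ac)
    also have "\<dots> = c * (\<integral>\<^sup>+\<omega>. a \<omega> * u (\<xi> m \<omega> j) \<partial>M)"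
      using um[OF mult.hyps(2)] by (intro nn_integral_cmult) auto
    also have "\<dots> = c * (\<integral>\<^sup>+\<omega>. b \<omega> * (\<integral>\<^sup>+y. u y \<partial>law N m (path m \<omega>) j) \<partial>M)"
      by (simp only: mult.IH)
    also have "\<dots> = (\<integral>\<^sup>+\<omega>. c * (b \<omega> * (\<integral>\<^sup>+y. u y \<partial>law N m (path m \<omega>) j)) \<partial>M)"
      using Lm[OF j mult.hyps(2)] by (intro nn_integral_cmult[symmetric]) auto
    also have "\<dots> = (\<integral>\<^sup>+\<omega>. b \<omega> * (\<integral>\<^sup>+y. c * u y \<partial>law N m (path m \<omega>) j) \<partial>M)"
      using ml[OF _ mult.hyps(2)]
      by (intro nn_integral_cong) (simp only: nn_integral_cmult mult.left_commute)
    finally show ?case .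
  next
    case (add u v)
    have "(\<integral>\<^sup>+\<omega>. a \<omega> * (v (\<xi> m \<omega> j) + u (\<xi> m \<omega> j)) \<partial>M)
        = (\<integral>\<^sup>+\<omega>. a \<omega> * v (\<xi> m \<omega> j) \<partial>M) + (\<integral>\<^sup>+\<omega>. a \<omega> * u (\<xi> m \<omega> j) \<partial>M)"
      using um[OF add.hyps(1)] um[OF add.hyps(3)] by (simp add: distrib_left nn_integral_add)
    also have "\<dots> = (\<integral>\<^sup>+\<omega>. b \<omega> * (\<integral>\<^sup>+y. v y \<partial>law N m (path m \<omega>) j) \<partial>M)
        + (\<integral>\<^sup>+\<omega>. b \<omega> * (\<integral>\<^sup>+y. u y \<partial>law N m (path m \<omega>) j) \<partial>M)"
      by (simp only: add.IH)
    also have "\<dots> = (\<integral>\<^sup>+\<omega>. b \<omega> * (\<integral>\<^sup>+y. v y \<partial>law N m (path m \<omega>) j)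
        + b \<omega> * (\<integral>\<^sup>+y. u y \<partial>law N m (path m \<omega>) j) \<partial>M)"
      using Lm[OF j add.hyps(1)] Lm[OF j add.hyps(3)] by (intro nn_integral_add[symmetric]) auto
    also have "\<dots> = (\<integral>\<^sup>+\<omega>. b \<omega> * (\<integral>\<^sup>+y. v y + u y \<partial>law N m (path m \<omega>) j) \<partial>M)"
      using ml[OF _ add.hyps(1)] ml[OF _ add.hyps(3)]
      by (intro nn_integral_cong) (simp only: nn_integral_add distrib_left)
    finally show ?case .
  next
    case (seq U)
    have SUPa: "(SUP i. U i) x = (SUP i. U i x)" for x by (simp add: image_image)
    have inc: "incseq (\<lambda>i. U i x)" for x using seq.hyps(3) by (auto simp: incseq_def le_fun_def)
    have "(\<integral>\<^sup>+\<omega>. a \<omega> * (SUP i. U i) (\<xi> m \<omega> j) \<partial>M) = (\<integral>\<^sup>+\<omega>. (SUP i. a \<omega> * U i (\<xi> m \<omega> j)) \<partial>M)"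
      by (intro nn_integral_cong) (simp only: SUPa SUP_mult_left_ennreal)
    also have "\<dots> = (SUP i. \<integral>\<^sup>+\<omega>. a \<omega> * U i (\<xi> m \<omega> j) \<partial>M)"
      using inc um[OF seq.hyps(1)]
      by (intro nn_integral_monotone_convergence_SUP) (auto simp: incseq_def le_fun_def intro!: mult_left_mono)
    also have "\<dots> = (SUP i. \<integral>\<^sup>+\<omega>. b \<omega> * (\<integral>\<^sup>+y. U i y \<partial>law N m (path m \<omega>) j) \<partial>M)"
      by (simp only: seq.IH)
    also have "\<dots> = (\<integral>\<^sup>+\<omega>. (SUP i. b \<omega> * (\<integral>\<^sup>+y. U i y \<partial>law N m (path m \<omega>) j)) \<partial>M)"
      using inc Lm[OF j seq.hyps(1)]
      by (intro nn_integral_monotone_convergence_SUP[symmetric])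
         (auto simp: incseq_def le_fun_def intro!: mult_left_mono nn_integral_mono)
    also have "\<dots> = (\<integral>\<^sup>+\<omega>. b \<omega> * (\<integral>\<^sup>+y. (SUP i. U i) y \<partial>law N m (path m \<omega>) j) \<partial>M)"
    proof (rule nn_integral_cong)
      fix \<omega> assume w: "\<omega> \<in> space M"
      have "(\<integral>\<^sup>+y. (SUP i. U i) y \<partial>law N m (path m \<omega>) j) = (\<integral>\<^sup>+y. (SUP i. U i y) \<partial>law N m (path m \<omega>) j)"
        by (simp only: SUPa)
      also have "\<dots> = (SUP i. \<integral>\<^sup>+y. U i y \<partial>law N m (path m \<omega>) j)"
        using seq.hyps(3) ml[OF w seq.hyps(1)] by (intro nn_integral_monotone_convergence_SUP) auto
      finally show "(SUP i. b \<omega> * (\<integral>\<^sup>+y. U i y \<partial>law N m (path m \<omega>) j))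
          = b \<omega> * (\<integral>\<^sup>+y. (SUP i. U i) y \<partial>law N m (path m \<omega>) j)"
        by (simp only: SUP_mult_left_ennreal)
    qed
    finally show ?case .
  qed
  then show ?case
    unfolding prod.remove[OF finite_atLeastAtMost j] a_def b_def by (simp add: mult_ac)
qed

lemma factor_nn_integral:
  fixes g :: "(nat \<Rightarrow> nat \<Rightarrow> 'a) \<Rightarrow> real" and \<phi> :: "'a \<Rightarrow> ennreal"
  assumes "g \<in> borel_measurable (traj N m)" "integrable M (\<lambda>\<omega>. g (path m \<omega>))" "\<And>x. 0 \<le> g x"
    and "\<phi> \<in> borel_measurable (E m)"
  shows "(\<integral>\<^sup>+\<omega>. ennreal (g (path m \<omega>)) * (\<Prod>i\<in>{1..N}. \<phi> (\<xi> m \<omega> i)) \<partial>M)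
       = (\<integral>\<^sup>+\<omega>. ennreal (g (path m \<omega>)) * (\<Prod>i\<in>{1..N}. \<integral>\<^sup>+y. \<phi> y \<partial>law N m (path m \<omega>) i) \<partial>M)"
  using factor_nn_integral_aux[OF assms(1-3), of "{1..N}" "\<lambda>_. \<phi>"] assms(4) by auto

end

section \<open>Exponential concentration\<close>

lemma osc_le_iff:
  "0 \<le> c \<Longrightarrow> osc E f \<le> ennreal c \<longleftrightarrow> (\<forall>x\<in>space E. \<forall>y\<in>space E. \<bar>f x - f y\<bar> \<le> c)"
  by (simp add: osc_def SUP_le_iff)

lemma diff_le_osc:
  assumes "osc E f < \<infinity>" "x \<in> space E" "y \<in> space E"
  shows "\<bar>f x - f y\<bar> \<le> enn2real (osc E f)"
  using osc_le_iff[of "enn2real (osc E f)" E f] assms by simp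

lemma Osc1_iff:
  "f \<in> Osc1 E \<longleftrightarrow> f \<in> borel_measurable E \<and> (\<forall>x\<in>space E. \<forall>y\<in>space E. \<bar>f x - f y\<bar> \<le> 1)"
  using osc_le_iff[of 1 E f] by (simp add: Osc1_def)

lemma osc_bounded_meas: "f \<in> bounded_meas E \<Longrightarrow> osc E f < \<infinity>"
proof -
  assume "f \<in> bounded_meas E"
  then obtain b where b: "\<And>x. x \<in> space E \<Longrightarrow> \<bar>f x\<bar> \<le> b"
    by (auto simp: bounded_meas_def bounded_iff)
  have "\<bar>f x - f y\<bar> \<le> \<bar>2 * b\<bar>" if "x \<in> space E" "y \<in> space E" for x y
    using b[OF that(1)] b[OF that(2)] by linarith
  then have "osc E f \<le> ennreal \<bar>2 * b\<bar>" by (subst osc_le_iff) auto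
  then show ?thesis using le_less_trans by fastforce
qed

lemma Osc1_bounded_meas: "f \<in> Osc1 E \<Longrightarrow> f \<in> bounded_meas E"
proof (cases "space E = {}")
  case False
  assume f: "f \<in> Osc1 E"
  from False obtain x0 where "x0 \<in> space E" by auto
  then have "\<bar>f x\<bar> \<le> \<bar>f x0\<bar> + 1" if "x \<in> space E" for x
    using f that unfolding Osc1_iff by (smt (verit))
  with f show ?thesis by (auto simp: bounded_meas_def Osc1_iff bounded_iff)
qed (auto simp: bounded_meas_def Osc1_iff)

lemma Osc1_divide:
  assumes "f \<in> borel_measurable E" "0 < c"
    "\<And>x y. x \<in> space E \<Longrightarrow> y \<in> space E \<Longrightarrow> \<bar>f x - f y\<bar> \<le> c"
  shows "(\<lambda>x. f x / c) \<in> Osc1 E"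
  using assms by (auto simp: Osc1_iff diff_divide_distrib[symmetric] pos_divide_le_eq)

context mean_field
begin

lemma Prob_diff_le_osc:
  fixes f :: "'a \<Rightarrow> real"
  assumes \<mu>: "\<mu> \<in> Prob n" and \<eta>: "\<eta> \<in> Prob n" and f: "f \<in> bounded_meas (E n)"
  shows "\<bar>(\<integral>x. f x \<partial>\<mu>) - (\<integral>x. f x \<partial>\<eta>)\<bar> \<le> enn2real (osc (E n) f)"
proof -
  define c where "c = enn2real (osc (E n) f)"
  have c: "\<bar>f x - f y\<bar> \<le> c" if "x \<in> space (E n)" "y \<in> space (E n)" for x y
    unfolding c_def by (rule diff_le_osc[OF osc_bounded_meas[OF f] that])
  have one: "(\<integral>x. f x \<partial>\<mu>) - (\<integral>x. f x \<partial>\<eta>) \<le> c" if \<mu>: "\<mu> \<in> Prob n" and \<eta>: "\<eta> \<in> Prob n" for \<mu> \<eta>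
  proof -
    interpret m: prob_space \<mu> using \<mu> by (rule Prob_prob_space)
    interpret e: prob_space \<eta> using \<eta> by (rule Prob_prob_space)
    have *: "(\<integral>x. f x \<partial>\<mu>) \<le> f y + c" if "y \<in> space (E n)" for y
      using c[OF _ that] Prob_space[OF \<mu>]
      by (intro m.integral_le_const Prob_integrable[OF \<mu> f] AE_I2) (smt (verit))
    have "(\<integral>x. f x \<partial>\<mu>) - c \<le> (\<integral>x. f x \<partial>\<eta>)"
      using * Prob_space[OF \<eta>]
      by (intro e.integral_ge_const Prob_integrable[OF \<eta> f] AE_I2) (simp add: algebra_simps)
    then show ?thesis by simp
  qed
  show ?thesis using one[OF \<mu> \<eta>] one[OF \<eta> \<mu>] by (simp add: c_def abs_le_iff)
qed

definition fluct_sum :: "nat \<Rightarrow> nat \<Rightarrow> (nat \<Rightarrow> nat \<Rightarrow> 'a) \<Rightarrow> ('a \<Rightarrow> real) \<Rightarrow> real" where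
  "fluct_sum N m x f = (\<Sum>i\<in>{1..N}. f (x m i) - (\<integral>y. f y \<partial>law N m x i))"

text \<open>The Laplace transform of \<open>fluct_sum\<close> at s given the past: a product over
  the particles by conditional independence, as \<open>tilted_mgf\<close> confirms in integrated
  form.\<close>

definition cond_mgf :: "nat \<Rightarrow> nat \<Rightarrow> real \<Rightarrow> ('a \<Rightarrow> real) \<Rightarrow> (nat \<Rightarrow> nat \<Rightarrow> 'a) \<Rightarrow> real" where
  "cond_mgf N m s f x =
     (\<Prod>i\<in>{1..N}. \<integral>y. exp (s * (f y - (\<integral>z. f z \<partial>law N m x i))) \<partial>law N m x i)"

text \<open>The variance of the fluctuation field applied to f, given the past. It is still random,
  and its concentration is what the moderate deviations rest on.\<close>

definition cond_var :: "nat \<Rightarrow> nat \<Rightarrow> ('a \<Rightarrow> real) \<Rightarrow> (nat \<Rightarrow> nat \<Rightarrow> 'a) \<Rightarrow> real" where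
  "cond_var N m f x =
     (\<Sum>i\<in>{1..N}. \<integral>y. (f y - (\<integral>z. f z \<partial>law N m x i))\<^sup>2 \<partial>law N m x i) / real N"

definition dev :: "nat \<Rightarrow> ('a \<Rightarrow> real) \<Rightarrow> nat \<Rightarrow> (nat \<Rightarrow> 'a) \<Rightarrow> real" where
  "dev p f N x = \<bar>(\<integral>y. f y \<partial>empirical (E p) N x) - (\<integral>y. f y \<partial>flow K \<eta>0 p)\<bar>"

text \<open>The part of the error at time \<open>Suc p\<close> that is inherited from time p; the
  other part is the fresh sampling error.\<close>

definition Phi_dev :: "nat \<Rightarrow> ('a \<Rightarrow> real) \<Rightarrow> nat \<Rightarrow> (nat \<Rightarrow> 'a) \<Rightarrow> real" where
  "Phi_dev p f N x = \<bar>(\<integral>y. f y \<partial>Phi K (Suc p) (empirical (E p) N x)) - (\<integral>y. f y \<partial>flow K \<eta>0 (Suc p))\<bar>"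

lemma law_integral_sum:
  fixes f :: "'a \<Rightarrow> real"
  assumes N: "N \<ge> 1" and x: "x p \<in> space (conf N p)" and f: "f \<in> bounded_meas (E (Suc p))"
  shows "(\<integral>y. f y \<partial>Phi K (Suc p) (empirical (E p) N (x p))) = (\<Sum>i\<in>{1..N}. \<integral>y. f y \<partial>law N (Suc p) x i) / real N"
proof -
  let ?\<mu> = "empirical (E p) N (x p)"
  have \<mu>: "?\<mu> \<in> Prob p" using empirical_Prob[OF N x] .
  have fm: "f \<in> borel_measurable (E (Suc p))" using f by (simp add: bounded_meas_def)
  show ?thesis
    unfolding integral_Phi[OF \<mu> f] integral_empirical[OF x kernel_integral_measurable[OF \<mu> fm]] by simp
qed

lemma fluctuation_eq:
  assumes N: "N \<ge> 1" and x: "\<And>k. k \<le> p \<Longrightarrow> x k \<in> space (conf N k)" and f: "f \<in> bounded_meas (E p)"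
  shows "fluctuation E K \<eta>0 N x p f = fluct_sum N p x f / sqrt (real N)"
proof -
  have N0: "0 < real N" using N by simp
  have fm: "f \<in> borel_measurable (E p)" using f by (simp add: bounded_meas_def)
  have sq: "sqrt (real N) * (a / real N) = a / sqrt (real N)" for a
    using N0 by (simp add: field_simps)
  have "fluctuation E K \<eta>0 N x p f = sqrt (real N) * (fluct_sum N p x f / real N)"
  proof (cases p)
    case 0
    then show ?thesis using N0 integral_empirical[OF x[of 0] fm[unfolded 0]]
      by (simp add: fluct_sum_def sum_subtractf diff_divide_distrib)
  next
    case (Suc q)
    have xq: "x q \<in> space (conf N q)" and xp: "x (Suc q) \<in> space (conf N (Suc q))" using x Suc by auto
    show ?thesis
      using integral_empirical[OF xp fm[unfolded Suc]] law_integral_sum[of N x q f] N xq f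
      by (simp add: Suc fluct_sum_def sum_subtractf diff_divide_distrib)
  qed
  then show ?thesis using sq by simp
qed

lemma conf_component_measurable: "i \<in> {1..N} \<Longrightarrow> f \<in> borel_measurable (E p) \<Longrightarrow> (\<lambda>x. f (x i)) \<in> borel_measurable (conf N p)"
  using measurable_compose[OF measurable_component_singleton] .

lemma empirical_integral_measurable:
  fixes f :: "'a \<Rightarrow> real"
  assumes "f \<in> borel_measurable (E p)"
  shows "(\<lambda>x. \<integral>y. f y \<partial>empirical (E p) N x) \<in> borel_measurable (conf N p)"
proof -
  have "(\<lambda>x. (\<Sum>i\<in>{1..N}. f (x i)) / real N) \<in> borel_measurable (conf N p)"
    by (intro borel_measurable_divide borel_measurable_sum conf_component_measurable assms borel_measurable_const)
  then show ?thesis by (subst measurable_cong) (rule integral_empirical[OF _ assms])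
qed

lemma dev_measurable: "f \<in> borel_measurable (E p) \<Longrightarrow> dev p f N \<in> borel_measurable (conf N p)"
  unfolding dev_def[abs_def]
  by (intro borel_measurable_abs borel_measurable_diff empirical_integral_measurable borel_measurable_const)

lemma conf_law_integral_measurable:
  fixes f :: "'a \<Rightarrow> real"
  assumes "N \<ge> 1" "i \<in> {1..N}" "f \<in> borel_measurable (E (Suc p))"
  shows "(\<lambda>x. \<integral>y. f y \<partial>K (Suc p) (empirical (E p) N x) (x i)) \<in> borel_measurable (conf N p)"
  using measurable_compose[OF measurable_prob_algebraD[OF conf_law_measurable[OF assms(1,2)]]
      integral_measurable_subprob_algebra[OF assms(3)]] .

lemma Phi_dev_measurable:
  assumes N: "N \<ge> 1" and f: "f \<in> bounded_meas (E (Suc p))"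
  shows "Phi_dev p f N \<in> borel_measurable (conf N p)"
proof -
  have fm: "f \<in> borel_measurable (E (Suc p))" using f by (simp add: bounded_meas_def)
  have "(\<lambda>x. (\<Sum>i\<in>{1..N}. \<integral>y. f y \<partial>K (Suc p) (empirical (E p) N x) (x i)) / real N) \<in> borel_measurable (conf N p)"
    by (intro borel_measurable_divide borel_measurable_sum conf_law_integral_measurable N fm borel_measurable_const)
  then have "(\<lambda>x. \<integral>y. f y \<partial>Phi K (Suc p) (empirical (E p) N x)) \<in> borel_measurable (conf N p)"
    using law_integral_sum[OF N _ f, of "\<lambda>_. _"] by (subst measurable_cong) auto
  then show ?thesis unfolding Phi_dev_def[abs_def]
    by (intro borel_measurable_abs borel_measurable_diff borel_measurable_const)
qed

lemma law_cong: "(\<And>k. k < m \<Longrightarrow> x k = y k) \<Longrightarrow> law N m x i = law N m y i"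
  by (cases m) auto

text \<open>Hoeffding's lemma on the interval of radius 1 around one value of f. Its length 2 gives
  \<open>s^2 * 4 / 8\<close>; negative s are reduced to positive ones by passing to
  \<open>- f\<close>.\<close>

lemma centered_exp_bound:
  fixes f :: "'a \<Rightarrow> real"
  assumes \<eta>: "\<eta> \<in> Prob n" and f: "f \<in> Osc1 (E n)"
  shows "(\<integral>y. exp (s * (f y - (\<integral>z. f z \<partial>\<eta>))) \<partial>\<eta>) \<le> exp (s\<^sup>2 / 2)"
proof -
  interpret prob_space \<eta> using \<eta> by (rule Prob_prob_space)
  have pos: "(\<integral>y. exp (s * (f y - (\<integral>z. f z \<partial>\<eta>))) \<partial>\<eta>) \<le> exp (s\<^sup>2 / 2)"
    if f: "f \<in> Osc1 (E n)" and s: "0 < s" for f :: "'a \<Rightarrow> real" and s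
  proof -
    have fm: "f \<in> borel_measurable \<eta>" using f Prob_measurable[OF \<eta>] by (auto simp: Osc1_def)
    obtain x0 where x0: "x0 \<in> space \<eta>" using not_empty by auto
    have fx: "\<bar>f x - f x0\<bar> \<le> 1" if "x \<in> space \<eta>" for x
      using f that x0 Prob_space[OF \<eta>] by (auto simp: Osc1_iff)
    interpret interval_bounded_random_variable \<eta> f "f x0 - 1" "f x0 + 1"
      using fm fx by unfold_locales (auto simp: abs_le_iff algebra_simps)
    have "ennreal (\<integral>y. exp (s * (f y - (\<integral>z. f z \<partial>\<eta>))) \<partial>\<eta>) = (\<integral>\<^sup>+y. exp (s * (f y - (\<integral>z. f z \<partial>\<eta>))) \<partial>\<eta>)"
    proof (rule nn_integral_eq_integral[symmetric])
      have "\<bar>exp (s * (f y - (\<integral>z. f z \<partial>\<eta>)))\<bar> \<le> exp (s * (f x0 + 1 - (\<integral>z. f z \<partial>\<eta>)))" if "y \<in> space \<eta>" for y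
        using fx[OF that] s by (simp add: abs_le_iff)
      then show "integrable \<eta> (\<lambda>y. exp (s * (f y - (\<integral>z. f z \<partial>\<eta>))))"
        using fm by (intro integrable_bounded) auto
    qed auto
    also have "\<dots> \<le> ennreal (exp (s\<^sup>2 * ((f x0 + 1) - (f x0 - 1))\<^sup>2 / 8))"
      by (rule Hoeffdings_lemma_nn_integral[OF s])
    also have "s\<^sup>2 * ((f x0 + 1) - (f x0 - 1))\<^sup>2 / 8 = s\<^sup>2 / 2" by simp
    finally show ?thesis by simp
  qed
  consider "s > 0" | "s = 0" | "s < 0" by linarith
  then show ?thesis
  proof cases
    case 1 then show ?thesis by (rule pos[OF f])
  next
    case 2 then show ?thesis by (simp add: prob_space)
  next
    case 3
    have "(\<lambda>x. - f x) \<in> Osc1 (E n)" using f by (auto simp: Osc1_iff abs_minus_commute)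
    from pos[OF this, of "-s"] 3 show ?thesis by (simp add: algebra_simps)
  qed
qed

lemma cond_mgf_bound:
  assumes "N \<ge> 1" "x \<in> space (traj N m)" "f \<in> Osc1 (E m)"
  shows "cond_mgf N m s f x \<le> exp (real N * s\<^sup>2 / 2)"
proof -
  have "cond_mgf N m s f x \<le> (\<Prod>i\<in>{1..N}. exp (s\<^sup>2 / 2))"
    unfolding cond_mgf_def
    using centered_exp_bound[OF law_Prob[OF assms(1) _ assms(2)] assms(3)]
    by (intro prod_mono) auto
  also have "\<dots> = exp (real N * s\<^sup>2 / 2)" by (simp add: exp_of_nat_mult[symmetric])
  finally show ?thesis .
qed

lemma fluct_sum_bound:
  assumes N: "N \<ge> 1" and x: "x \<in> space (traj N m)" "y \<in> space (conf N m)" and f: "f \<in> borel_measurable (E m)"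
    and b: "\<And>z. z \<in> space (E m) \<Longrightarrow> \<bar>f z\<bar> \<le> b"
  shows "\<bar>\<Sum>i\<in>{1..N}. f (y i) - (\<integral>z. f z \<partial>law N m x i)\<bar> \<le> 2 * b * real N"
proof -
  have "\<bar>\<Sum>i\<in>{1..N}. f (y i) - (\<integral>z. f z \<partial>law N m x i)\<bar> \<le> (\<Sum>i\<in>{1..N}. \<bar>f (y i) - (\<integral>z. f z \<partial>law N m x i)\<bar>)"
    by (rule sum_abs)
  also have "\<dots> \<le> (\<Sum>i\<in>{1..N}. 2 * b)"
  proof (rule sum_mono)
    fix i assume i: "i \<in> {1..N}"
    show "\<bar>f (y i) - (\<integral>z. f z \<partial>law N m x i)\<bar> \<le> 2 * b"
      using b[OF space_conf[OF x(2) i]] Prob_integral_bound[OF law_Prob[OF N i x(1)] f b] by linarith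
  qed
  finally show ?thesis by (simp add: mult_ac)
qed

end

context particles
begin

lemma path_in: "\<omega> \<in> space M \<Longrightarrow> path m \<omega> \<in> space (traj N m)"
  using measurable_space[OF path_measurable] .

lemma xi_in: "\<omega> \<in> space M \<Longrightarrow> \<xi> m \<omega> \<in> space (conf N m)"
  using measurable_space[OF xi_measurable] .

lemma law_path: "law N m (\<lambda>k. \<xi> k \<omega>) i = law N m (path m \<omega>) i"
  by (rule law_cong) (simp add: path_def)

lemma fluct_sum_path: "fluct_sum N m (\<lambda>k. \<xi> k \<omega>) f = (\<Sum>i\<in>{1..N}. f (\<xi> m \<omega> i) - (\<integral>y. f y \<partial>law N m (path m \<omega>) i))"
  by (simp add: fluct_sum_def law_path)

lemma fluct_sum_measurable:
  assumes "f \<in> borel_measurable (E m)"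
  shows "(\<lambda>\<omega>. fluct_sum N m (\<lambda>k. \<xi> k \<omega>) f) \<in> borel_measurable M"
  unfolding fluct_sum_path
  by (intro borel_measurable_sum borel_measurable_diff measurable_compose[OF particle_measurable assms]
      measurable_compose[OF path_measurable law_integral_measurable[OF N _ assms]]) auto

text \<open>The centring terms depend on the past alone, so their exponential is moved into the
  weight. What is left is a product of functions of single particles, to which the factorisation
  applies.\<close>

lemma tilted_mgf:
  fixes g :: "(nat \<Rightarrow> nat \<Rightarrow> 'a) \<Rightarrow> real"
  assumes g: "g \<in> borel_measurable (traj N m)" and int: "integrable M (\<lambda>\<omega>. g (path m \<omega>))"
    and g0: "\<And>x. 0 \<le> g x" and f: "f \<in> bounded_meas (E m)"
  shows "(\<integral>\<^sup>+\<omega>. ennreal (g (path m \<omega>) * exp (s * fluct_sum N m (\<lambda>k. \<xi> k \<omega>) f)) \<partial>M)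
     = (\<integral>\<^sup>+\<omega>. ennreal (g (path m \<omega>) * cond_mgf N m s f (path m \<omega>)) \<partial>M)"
proof -
  obtain b where fm: "f \<in> borel_measurable (E m)" and b0: "0 \<le> b" and b: "\<And>x. x \<in> space (E m) \<Longrightarrow> \<bar>f x\<bar> \<le> b"
    using f by (rule bounded_measE) blast
  define c where "c x = (\<Sum>i\<in>{1..N}. \<integral>y. f y \<partial>law N m x i)" for x
  have cm: "c \<in> borel_measurable (traj N m)" unfolding c_def[abs_def]
    by (intro borel_measurable_sum law_integral_measurable N fm)
  \<comment> \<open>The weight including the centring. It stays integrable because c is bounded on
    trajectories.\<close>
  define g' where "g' x = g x * exp (- s * c x)" for x
  have g'm: "g' \<in> borel_measurable (traj N m)" unfolding g'_def[abs_def] using cm g by measurable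
  have cb: "\<bar>c x\<bar> \<le> real N * b" if "x \<in> space (traj N m)" for x
  proof -
    have "\<bar>c x\<bar> \<le> (\<Sum>i\<in>{1..N}. \<bar>\<integral>y. f y \<partial>law N m x i\<bar>)" unfolding c_def by (rule sum_abs)
    also have "\<dots> \<le> (\<Sum>i\<in>{1..N}. b)"
      using Prob_integral_bound[OF law_Prob[OF N _ that] fm b] by (intro sum_mono) auto
    finally show ?thesis by simp
  qed
  have int': "integrable M (\<lambda>\<omega>. g' (path m \<omega>))"
  proof (rule Bochner_Integration.integrable_bound)
    show "integrable M (\<lambda>\<omega>. exp (\<bar>s\<bar> * (real N * b)) * g (path m \<omega>))"
      by (intro integrable_mult_right int)
    show "(\<lambda>\<omega>. g' (path m \<omega>)) \<in> borel_measurable M" using measurable_compose[OF path_measurable g'm] .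
    show "AE \<omega> in M. norm (g' (path m \<omega>)) \<le> norm (exp (\<bar>s\<bar> * (real N * b)) * g (path m \<omega>))"
    proof (rule AE_I2)
      fix \<omega> assume "\<omega> \<in> space M"
      from cb[OF path_in[OF this]] have "\<bar>s\<bar> * \<bar>c (path m \<omega>)\<bar> \<le> \<bar>s\<bar> * (real N * b)"
        by (intro mult_left_mono) auto
      moreover have "- s * c (path m \<omega>) \<le> \<bar>s\<bar> * \<bar>c (path m \<omega>)\<bar>"
        by (metis abs_ge_self abs_minus_cancel abs_mult)
      ultimately have e: "exp (- s * c (path m \<omega>)) \<le> exp (\<bar>s\<bar> * (real N * b))" by simp
      then show "norm (g' (path m \<omega>)) \<le> norm (exp (\<bar>s\<bar> * (real N * b)) * g (path m \<omega>))"
        using mult_right_mono[OF e g0[of "path m \<omega>"]] g0[of "path m \<omega>"]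
        by (simp only: g'_def abs_mult mult.commute real_norm_def abs_of_nonneg exp_ge_zero abs_exp_cancel)
    qed
  qed
  have "(\<integral>\<^sup>+\<omega>. ennreal (g (path m \<omega>) * exp (s * fluct_sum N m (\<lambda>k. \<xi> k \<omega>) f)) \<partial>M)
      = (\<integral>\<^sup>+\<omega>. ennreal (g' (path m \<omega>)) * (\<Prod>i\<in>{1..N}. ennreal (exp (s * f (\<xi> m \<omega> i)))) \<partial>M)"
  proof (rule nn_integral_cong)
    fix \<omega> assume "\<omega> \<in> space M"
    have "s * fluct_sum N m (\<lambda>k. \<xi> k \<omega>) f = - s * c (path m \<omega>) + (\<Sum>i\<in>{1..N}. s * f (\<xi> m \<omega> i))"
      unfolding fluct_sum_path c_def by (simp add: sum_subtractf sum_distrib_left right_diff_distrib sum_negf)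
    then have "exp (s * fluct_sum N m (\<lambda>k. \<xi> k \<omega>) f)
        = exp (- s * c (path m \<omega>)) * (\<Prod>i\<in>{1..N}. exp (s * f (\<xi> m \<omega> i)))"
      by (simp only: exp_add exp_sum[OF finite_atLeastAtMost])
    then show "ennreal (g (path m \<omega>) * exp (s * fluct_sum N m (\<lambda>k. \<xi> k \<omega>) f))
        = ennreal (g' (path m \<omega>)) * (\<Prod>i\<in>{1..N}. ennreal (exp (s * f (\<xi> m \<omega> i))))"
      using g0 by (simp add: g'_def prod_ennreal ennreal_mult[symmetric] prod_nonneg mult.assoc)
  qed
  also have "\<dots> = (\<integral>\<^sup>+\<omega>. ennreal (g' (path m \<omega>)) *
      (\<Prod>i\<in>{1..N}. \<integral>\<^sup>+y. ennreal (exp (s * f y)) \<partial>law N m (path m \<omega>) i) \<partial>M)"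
    using g0 fm by (intro factor_nn_integral g'm int') (auto simp: g'_def)
  also have "\<dots> = (\<integral>\<^sup>+\<omega>. ennreal (g (path m \<omega>) * cond_mgf N m s f (path m \<omega>)) \<partial>M)"
  proof (rule nn_integral_cong)
    fix \<omega> assume w: "\<omega> \<in> space M"
    let ?l = "law N m (path m \<omega>)"
    have eb: "(\<lambda>y. exp (s * f y)) \<in> bounded_meas (E m)"
    proof (rule bounded_measI)
      show "\<bar>exp (s * f x)\<bar> \<le> exp (\<bar>s\<bar> * b)" if "x \<in> space (E m)" for x
      proof -
        have "s * f x \<le> \<bar>s\<bar> * \<bar>f x\<bar>" by (metis abs_ge_self abs_mult)
        also have "\<dots> \<le> \<bar>s\<bar> * b" using b[OF that] by (intro mult_left_mono) auto
        finally show ?thesis by simp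
      qed
    qed (use fm in measurable)
    have "(\<integral>\<^sup>+y. ennreal (exp (s * f y)) \<partial>?l i) = ennreal (\<integral>y. exp (s * f y) \<partial>?l i)" if "i \<in> {1..N}" for i
      using Prob_integrable[OF law_Prob[OF N that path_in[OF w]] eb] by (intro nn_integral_eq_integral) auto
    then have "(\<Prod>i\<in>{1..N}. \<integral>\<^sup>+y. ennreal (exp (s * f y)) \<partial>?l i) = (\<Prod>i\<in>{1..N}. ennreal (\<integral>y. exp (s * f y) \<partial>?l i))"
      by (rule prod.cong[OF refl])
    also have "\<dots> = ennreal (\<Prod>i\<in>{1..N}. \<integral>y. exp (s * f y) \<partial>?l i)"
      by (rule prod_ennreal) simp
    finally have 1: "(\<Prod>i\<in>{1..N}. \<integral>\<^sup>+y. ennreal (exp (s * f y)) \<partial>?l i) = ennreal (\<Prod>i\<in>{1..N}. \<integral>y. exp (s * f y) \<partial>?l i)" .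
    have "exp (- s * c (path m \<omega>)) = (\<Prod>i\<in>{1..N}. exp (- s * (\<integral>y. f y \<partial>?l i)))"
      unfolding c_def sum_distrib_left by (rule exp_sum) simp
    then have "exp (- s * c (path m \<omega>)) * (\<Prod>i\<in>{1..N}. \<integral>y. exp (s * f y) \<partial>?l i)
        = (\<Prod>i\<in>{1..N}. exp (- s * (\<integral>y. f y \<partial>?l i)) * (\<integral>y. exp (s * f y) \<partial>?l i))"
      by (simp only: prod.distrib)
    also have "\<dots> = cond_mgf N m s f (path m \<omega>)"
      unfolding cond_mgf_def
    proof (rule prod.cong[OF refl])
      fix i
      have "exp (s * (f y - (\<integral>z. f z \<partial>?l i))) = exp (- s * (\<integral>z. f z \<partial>?l i)) * exp (s * f y)" for y
        by (simp add: exp_add[symmetric] algebra_simps)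
      then show "exp (- s * (\<integral>y. f y \<partial>?l i)) * (\<integral>y. exp (s * f y) \<partial>?l i) = (\<integral>y. exp (s * (f y - (\<integral>z. f z \<partial>?l i))) \<partial>?l i)"
        by (simp only: integral_mult_right_zero)
    qed
    finally show "ennreal (g' (path m \<omega>)) * (\<Prod>i\<in>{1..N}. \<integral>\<^sup>+y. ennreal (exp (s * f y)) \<partial>?l i)
        = ennreal (g (path m \<omega>) * cond_mgf N m s f (path m \<omega>))"
      unfolding 1 g'_def using g0
      by (subst ennreal_mult[symmetric]) (auto intro!: prod_nonneg simp: mult.assoc)
  qed
  finally show ?thesis .
qed

text \<open>The factor 2 comes from bounding the exponential of the absolute value by the sum over
  both signs; the exponent is \<open>real N * s^2 / 2\<close> at
  \<open>s = t / real N\<close>.\<close>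

lemma fluct_sum_exp_moment:
  assumes f: "f \<in> Osc1 (E m)" and t: "0 \<le> t"
  shows "(\<integral>\<^sup>+\<omega>. ennreal (exp (t * \<bar>fluct_sum N m (\<lambda>k. \<xi> k \<omega>) f / real N\<bar>)) \<partial>M)
      \<le> ennreal (2 * exp (t\<^sup>2 / (2 * real N)))"
proof -
  let ?W = "\<lambda>\<omega>. fluct_sum N m (\<lambda>k. \<xi> k \<omega>) f"
  have fb: "f \<in> bounded_meas (E m)" using f by (rule Osc1_bounded_meas)
  have fm: "f \<in> borel_measurable (E m)" using f by (simp add: Osc1_def)
  have N0: "0 < real N" using N by simp
  have one: "(\<integral>\<^sup>+\<omega>. ennreal (exp (s * ?W \<omega>)) \<partial>M) \<le> ennreal (exp (real N * s\<^sup>2 / 2))" for s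
  proof -
    have "(\<integral>\<^sup>+\<omega>. ennreal (exp (s * ?W \<omega>)) \<partial>M) = (\<integral>\<^sup>+\<omega>. ennreal (cond_mgf N m s f (path m \<omega>)) \<partial>M)"
    proof -
      have "(\<integral>\<^sup>+\<omega>. ennreal (1 * exp (s * ?W \<omega>)) \<partial>M) = (\<integral>\<^sup>+\<omega>. ennreal (1 * cond_mgf N m s f (path m \<omega>)) \<partial>M)"
        by (rule tilted_mgf) (auto intro: fb)
      then show ?thesis by (simp only: mult_1)
    qed
    also have "\<dots> \<le> (\<integral>\<^sup>+\<omega>. ennreal (exp (real N * s\<^sup>2 / 2)) \<partial>M)"
      using cond_mgf_bound[OF N path_in f] by (intro nn_integral_mono ennreal_leI) auto
    finally show ?thesis by (simp add: emeasure_space_1)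
  qed
  have "(\<integral>\<^sup>+\<omega>. ennreal (exp (t * \<bar>?W \<omega> / real N\<bar>)) \<partial>M)
      \<le> (\<integral>\<^sup>+\<omega>. ennreal (exp (t / real N * ?W \<omega>)) + ennreal (exp (- (t / real N) * ?W \<omega>)) \<partial>M)"
  proof (rule nn_integral_mono)
    fix \<omega>
    have "t * \<bar>?W \<omega> / real N\<bar> = t / real N * ?W \<omega> \<or> t * \<bar>?W \<omega> / real N\<bar> = - (t / real N) * ?W \<omega>"
      using N0 by (auto simp: abs_if)
    then show "ennreal (exp (t * \<bar>?W \<omega> / real N\<bar>)) \<le> ennreal (exp (t / real N * ?W \<omega>)) + ennreal (exp (- (t / real N) * ?W \<omega>))"
      by (auto simp: ennreal_plus[symmetric] simp del: ennreal_plus intro!: ennreal_leI)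
  qed
  also have "\<dots> = (\<integral>\<^sup>+\<omega>. ennreal (exp (t / real N * ?W \<omega>)) \<partial>M) + (\<integral>\<^sup>+\<omega>. ennreal (exp (- (t / real N) * ?W \<omega>)) \<partial>M)"
    using fluct_sum_measurable[OF fm] by (intro nn_integral_add) auto
  also have "\<dots> \<le> ennreal (exp (real N * (t / real N)\<^sup>2 / 2)) + ennreal (exp (real N * (- (t / real N))\<^sup>2 / 2))"
    by (intro add_mono one)
  also have "\<dots> = ennreal (2 * exp (t\<^sup>2 / (2 * real N)))"
    using N0 by (simp add: ennreal_plus[symmetric] power2_eq_square del: ennreal_plus)
  finally show ?thesis .
qed

end

section \<open>Sub-Gaussian bounds uniform over families of test functions\<close>

locale particle_sequence = mean_field E K \<eta>0
  for E :: "nat \<Rightarrow> 'a measure" and K \<eta>0 +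
  fixes M :: "nat \<Rightarrow> 'w measure" and \<xi> :: "nat \<Rightarrow> nat \<Rightarrow> 'w \<Rightarrow> nat \<Rightarrow> 'a"
  assumes systems: "\<And>N. N \<ge> 1 \<Longrightarrow> particle_system E K \<eta>0 N (M N) (\<xi> N)"
    and cond_K: "\<And>k. cond_K (E k) (E (Suc k)) (K (Suc k))"
    and Upsilon: "\<And>k. Upsilon (E k) (E (Suc k)) (Phi K (Suc k))"
begin

lemma particles: "N \<ge> 1 \<Longrightarrow> particles E K \<eta>0 N (M N) (\<xi> N)"
  by unfold_locales (auto intro: systems)

text \<open>The bound is uniform over the family \<open>XX\<close>, so that it survives integration with respect
  to the measures \<open>R\<close> and \<open>T\<close> on functions.\<close>

definition conc :: "nat \<Rightarrow> (nat \<Rightarrow> (nat \<Rightarrow> 'a) \<Rightarrow> real) set \<Rightarrow> bool" where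
  "conc p XX \<longleftrightarrow> (\<exists>C\<ge>1. \<exists>c\<ge>0. \<forall>X\<in>XX. \<forall>N\<ge>1. X N \<in> borel_measurable (conf N p) \<and>
     (\<forall>t\<ge>0. (\<integral>\<^sup>+\<omega>. ennreal (exp (t * X N (\<xi> N p \<omega>))) \<partial>M N) \<le> ennreal (C * exp (c * t\<^sup>2 / real N))))"

lemma concE:
  assumes "conc p XX"
  obtains C c where "1 \<le> C" "0 \<le> c"
    "\<And>X N. X \<in> XX \<Longrightarrow> N \<ge> 1 \<Longrightarrow> X N \<in> borel_measurable (conf N p)"
    "\<And>X N t. X \<in> XX \<Longrightarrow> N \<ge> 1 \<Longrightarrow> 0 \<le> t \<Longrightarrow>
      (\<integral>\<^sup>+\<omega>. ennreal (exp (t * X N (\<xi> N p \<omega>))) \<partial>M N) \<le> ennreal (C * exp (c * t\<^sup>2 / real N))"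
  using assms unfolding conc_def by blast


text \<open>No independence is required: doubling the exponents splits the sum, and since
  sub-Gaussian bounds hold for all t, replacing t by 2t only enlarges the constant in the
  exponent.\<close>

lemma nn_integral_exp_sum_le:
  fixes X Y :: "'w \<Rightarrow> real"
  assumes [measurable]: "X \<in> borel_measurable P" "Y \<in> borel_measurable P"
    and X: "(\<integral>\<^sup>+\<omega>. ennreal (exp (2 * X \<omega>)) \<partial>P) \<le> ennreal a"
    and Y: "(\<integral>\<^sup>+\<omega>. ennreal (exp (2 * Y \<omega>)) \<partial>P) \<le> ennreal a"
    and Z: "\<And>\<omega>. \<omega> \<in> space P \<Longrightarrow> Z \<omega> \<le> X \<omega> + Y \<omega>"
  shows "(\<integral>\<^sup>+\<omega>. ennreal (exp (Z \<omega>)) \<partial>P) \<le> ennreal a"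
proof -
  have "(\<integral>\<^sup>+\<omega>. ennreal (exp (Z \<omega>)) \<partial>P)
      \<le> (\<integral>\<^sup>+\<omega>. ennreal (1 / 2) * (ennreal (exp (2 * X \<omega>)) + ennreal (exp (2 * Y \<omega>))) \<partial>P)"
  proof (rule nn_integral_mono)
    fix \<omega> assume "\<omega> \<in> space P"
    then have "exp (Z \<omega>) \<le> exp (X \<omega> + Y \<omega>)" using Z by simp
    also have "\<dots> \<le> (exp (2 * X \<omega>) + exp (2 * Y \<omega>)) / 2" by (rule exp_sum_le_squares)
    finally have "ennreal (exp (Z \<omega>)) \<le> ennreal (1 / 2 * (exp (2 * X \<omega>) + exp (2 * Y \<omega>)))"
      by (intro ennreal_leI) simp
    also have "\<dots> = ennreal (1 / 2) * (ennreal (exp (2 * X \<omega>)) + ennreal (exp (2 * Y \<omega>)))"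
      by (subst ennreal_mult) (auto simp: ennreal_plus)
    finally show "ennreal (exp (Z \<omega>)) \<le> ennreal (1 / 2) * (ennreal (exp (2 * X \<omega>)) + ennreal (exp (2 * Y \<omega>)))" .
  qed
  also have "\<dots> = ennreal (1 / 2) * ((\<integral>\<^sup>+\<omega>. ennreal (exp (2 * X \<omega>)) \<partial>P) + (\<integral>\<^sup>+\<omega>. ennreal (exp (2 * Y \<omega>)) \<partial>P))"
    by (subst nn_integral_cmult) (auto simp: nn_integral_add)
  also have "\<dots> \<le> ennreal (1 / 2) * (ennreal a + ennreal a)"
    by (intro mult_left_mono add_mono X Y) simp
  also have "\<dots> = ennreal a"
  proof (cases "0 \<le> a")
    case True
    then have "ennreal (1 / 2) * (ennreal a + ennreal a) = ennreal (1 / 2 * (a + a))"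
      by (simp only: ennreal_plus[symmetric] ennreal_mult[symmetric] zero_le_divide_1_iff
          zero_le_numeral add_nonneg_nonneg)
    then show ?thesis by simp
  qed (simp add: ennreal_neg)
  finally show ?thesis .
qed

lemma xi_conf: "N \<ge> 1 \<Longrightarrow> \<omega> \<in> space (M N) \<Longrightarrow> \<xi> N p \<omega> \<in> space (conf N p)"
  using particles.xi_in[OF particles] .

lemma xi_meas: "N \<ge> 1 \<Longrightarrow> \<xi> N p \<in> M N \<rightarrow>\<^sub>M conf N p"
  using particles.xi_measurable[OF particles] .

text \<open>Domination by a combination with fixed coefficients a and b keeps the bound uniform,
  although the dominating X and Y may vary with Z.\<close>

lemma conc_combine:
  assumes X: "conc p XX" and Y: "conc p YY" and ab: "0 \<le> a" "0 \<le> b"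
    and m: "\<And>Z N. Z \<in> ZZ \<Longrightarrow> N \<ge> 1 \<Longrightarrow> Z N \<in> borel_measurable (conf N p)"
    and le: "\<And>Z. Z \<in> ZZ \<Longrightarrow> \<exists>X\<in>XX. \<exists>Y\<in>YY. \<forall>N\<ge>1. \<forall>x\<in>space (conf N p). Z N x \<le> a * X N x + b * Y N x"
  shows "conc p ZZ"
proof -
  from X obtain C c where C: "1 \<le> C" "0 \<le> c"
    "\<And>X N. X \<in> XX \<Longrightarrow> N \<ge> 1 \<Longrightarrow> X N \<in> borel_measurable (conf N p)"
    "\<And>X N t. X \<in> XX \<Longrightarrow> N \<ge> 1 \<Longrightarrow> 0 \<le> t \<Longrightarrow>
      (\<integral>\<^sup>+\<omega>. ennreal (exp (t * X N (\<xi> N p \<omega>))) \<partial>M N) \<le> ennreal (C * exp (c * t\<^sup>2 / real N))"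
    by (rule concE) blast
  from Y obtain D e where D: "1 \<le> D" "0 \<le> e"
    "\<And>X N. X \<in> YY \<Longrightarrow> N \<ge> 1 \<Longrightarrow> X N \<in> borel_measurable (conf N p)"
    "\<And>X N t. X \<in> YY \<Longrightarrow> N \<ge> 1 \<Longrightarrow> 0 \<le> t \<Longrightarrow>
      (\<integral>\<^sup>+\<omega>. ennreal (exp (t * X N (\<xi> N p \<omega>))) \<partial>M N) \<le> ennreal (D * exp (e * t\<^sup>2 / real N))"
    by (rule concE) blast
  \<comment> \<open>The factors 2 are the doubling of the exponents in
    \<open>nn_integral_exp_sum_le\<close>.\<close>
  define k where "k = max (c * (2 * a)\<^sup>2) (e * (2 * b)\<^sup>2)"
  have k0: "0 \<le> k" using C(2) D(2) by (simp add: k_def le_max_iff_disj)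
  have main: "(\<integral>\<^sup>+\<omega>. ennreal (exp (t * Z N (\<xi> N p \<omega>))) \<partial>M N) \<le> ennreal (max C D * exp (k * t\<^sup>2 / real N))"
    if Z: "Z \<in> ZZ" and N: "N \<ge> 1" and t: "0 \<le> t" for Z N t
  proof -
    from le[OF Z] obtain X Y where XY: "X \<in> XX" "Y \<in> YY"
      "\<And>x. x \<in> space (conf N p) \<Longrightarrow> Z N x \<le> a * X N x + b * Y N x" using N by blast
    have N0: "0 < real N" using N by simp
    have est: "A * exp (d * (t * (2 * r))\<^sup>2 / real N) \<le> max C D * exp (k * t\<^sup>2 / real N)"
      if "d * (2 * r)\<^sup>2 \<le> k" "A \<le> max C D" for A d r
    proof -
      have "d * (t * (2 * r))\<^sup>2 = (d * (2 * r)\<^sup>2) * t\<^sup>2" by (simp add: power_mult_distrib)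
      also have "\<dots> \<le> k * t\<^sup>2" using that by (intro mult_right_mono) auto
      finally have "d * (t * (2 * r))\<^sup>2 / real N \<le> k * t\<^sup>2 / real N" using N0 by (simp add: divide_right_mono)
      then show ?thesis using that C(1) by (intro mult_mono) auto
    qed
    show ?thesis
    proof (rule nn_integral_exp_sum_le)
      show "(\<lambda>\<omega>. t * a * X N (\<xi> N p \<omega>)) \<in> borel_measurable (M N)"
        "(\<lambda>\<omega>. t * b * Y N (\<xi> N p \<omega>)) \<in> borel_measurable (M N)"
        using measurable_compose[OF xi_meas[OF N] C(3)[OF XY(1) N]]
          measurable_compose[OF xi_meas[OF N] D(3)[OF XY(2) N]] by auto
      have "(\<integral>\<^sup>+\<omega>. ennreal (exp (2 * (t * a * X N (\<xi> N p \<omega>)))) \<partial>M N)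
          = (\<integral>\<^sup>+\<omega>. ennreal (exp ((t * (2 * a)) * X N (\<xi> N p \<omega>))) \<partial>M N)"
        by (simp add: mult_ac)
      also have "\<dots> \<le> ennreal (C * exp (c * (t * (2 * a))\<^sup>2 / real N))"
        using t ab by (intro C(4) XY N) auto
      also have "\<dots> \<le> ennreal (max C D * exp (k * t\<^sup>2 / real N))"
        by (intro ennreal_leI est) (auto simp: k_def)
      finally show "(\<integral>\<^sup>+\<omega>. ennreal (exp (2 * (t * a * X N (\<xi> N p \<omega>)))) \<partial>M N) \<le> ennreal (max C D * exp (k * t\<^sup>2 / real N))" .
      have "(\<integral>\<^sup>+\<omega>. ennreal (exp (2 * (t * b * Y N (\<xi> N p \<omega>)))) \<partial>M N)
          = (\<integral>\<^sup>+\<omega>. ennreal (exp ((t * (2 * b)) * Y N (\<xi> N p \<omega>))) \<partial>M N)"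
        by (simp add: mult_ac)
      also have "\<dots> \<le> ennreal (D * exp (e * (t * (2 * b))\<^sup>2 / real N))"
        using t ab by (intro D(4) XY N) auto
      also have "\<dots> \<le> ennreal (max C D * exp (k * t\<^sup>2 / real N))"
        by (intro ennreal_leI est) (auto simp: k_def)
      finally show "(\<integral>\<^sup>+\<omega>. ennreal (exp (2 * (t * b * Y N (\<xi> N p \<omega>)))) \<partial>M N) \<le> ennreal (max C D * exp (k * t\<^sup>2 / real N))" .
      fix \<omega> assume "\<omega> \<in> space (M N)"
      from XY(3)[OF xi_conf[OF N this]] have "t * Z N (\<xi> N p \<omega>) \<le> t * (a * X N (\<xi> N p \<omega>) + b * Y N (\<xi> N p \<omega>))"
        using t by (rule mult_left_mono)
      then show "t * Z N (\<xi> N p \<omega>) \<le> t * a * X N (\<xi> N p \<omega>) + t * b * Y N (\<xi> N p \<omega>)"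
        by (simp add: algebra_simps)
    qed
  qed
  have "1 \<le> max C D" using C by simp
  then show ?thesis unfolding conc_def using k0 m main by blast
qed

definition mixture :: "'g measure \<Rightarrow> (nat \<Rightarrow> 'g \<Rightarrow> (nat \<Rightarrow> 'a) \<Rightarrow> real) \<Rightarrow> nat \<Rightarrow> (nat \<Rightarrow> 'a) \<Rightarrow> real" where
  "mixture R \<psi> N x = enn2real (\<integral>\<^sup>+g. ennreal (\<psi> N g x) \<partial>R)"

text \<open>The situation in which \<open>exp_mixture_le\<close> applies uniformly: w dominates
  \<psi> and has mass at most B, and for each g the normalised integrand is dominated by some member
  of XX. That member may depend on g, but not on N or x.\<close>

definition mixture_of :: "nat \<Rightarrow> (nat \<Rightarrow> (nat \<Rightarrow> 'a) \<Rightarrow> real) set \<Rightarrow> real \<Rightarrow> 'g measure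
    \<Rightarrow> (nat \<Rightarrow> 'g \<Rightarrow> (nat \<Rightarrow> 'a) \<Rightarrow> real) \<Rightarrow> ('g \<Rightarrow> real) \<Rightarrow> bool" where
  "mixture_of p XX B R \<psi> w \<longleftrightarrow> w \<in> borel_measurable R \<and> (\<integral>\<^sup>+g. ennreal (w g) \<partial>R) \<le> ennreal B \<and>
     (\<forall>N\<ge>1. (\<lambda>(g, x). \<psi> N g x) \<in> borel_measurable (R \<Otimes>\<^sub>M conf N p)) \<and>
     (\<forall>N\<ge>1. \<forall>g\<in>space R. \<forall>x\<in>space (conf N p). 0 \<le> \<psi> N g x \<and> \<psi> N g x \<le> w g) \<and>
     (\<forall>g\<in>space R. 0 < w g \<longrightarrow> (\<exists>X\<in>XX. \<forall>N\<ge>1. \<forall>x\<in>space (conf N p). \<psi> N g x / w g \<le> X N x))"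

text \<open>By Jensen's inequality a mixture inherits the bound of its members with t replaced by
  \<open>t * B\<close>. Only the mass bound B enters, so R, \<psi> and w may vary freely with the
  index.\<close>

lemma conc_mixture:
  fixes R :: "'i \<Rightarrow> 'g measure"
  assumes X: "conc p XX" and B: "0 \<le> B" and mix: "\<And>i. i \<in> I \<Longrightarrow> mixture_of p XX B (R i) (\<psi> i) (w i)"
  shows "conc p ((\<lambda>i. mixture (R i) (\<psi> i)) ` I)"
proof -
  from X obtain C c where C: "1 \<le> C" "0 \<le> c"
    "\<And>X N. X \<in> XX \<Longrightarrow> N \<ge> 1 \<Longrightarrow> X N \<in> borel_measurable (conf N p)"
    "\<And>X N t. X \<in> XX \<Longrightarrow> N \<ge> 1 \<Longrightarrow> 0 \<le> t \<Longrightarrow>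
      (\<integral>\<^sup>+\<omega>. ennreal (exp (t * X N (\<xi> N p \<omega>))) \<partial>M N) \<le> ennreal (C * exp (c * t\<^sup>2 / real N))"
    by (rule concE) blast
  have meas: "mixture (R i) (\<psi> i) N \<in> borel_measurable (conf N p)" if i: "i \<in> I" and N: "N \<ge> 1" for i N
  proof -
    have "(\<integral>\<^sup>+g. ennreal (w i g) \<partial>R i) < \<infinity>"
      using mix[OF i] unfolding mixture_of_def by (auto intro: le_less_trans)
    then have "(\<lambda>x. \<integral>\<^sup>+g. ennreal (\<psi> i N g x) \<partial>R i) \<in> borel_measurable (conf N p)"
      using mix[OF i] N unfolding mixture_of_def by (intro borel_measurable_mixture[where w="w i"]) auto
    then show ?thesis unfolding mixture_def[abs_def] by measurable
  qed
  have main: "(\<integral>\<^sup>+\<omega>. ennreal (exp (t * mixture (R i) (\<psi> i) N (\<xi> N p \<omega>))) \<partial>M N) \<le> ennreal (C * exp (c * B\<^sup>2 * t\<^sup>2 / real N))"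
    if i: "i \<in> I" and N: "N \<ge> 1" and t: "0 \<le> t" for i N t
    unfolding mixture_def
  proof (rule exp_mixture_le[where w="w i" and B=B])
    note m = mix[OF i, unfolded mixture_of_def]
    interpret P: particles E K \<eta>0 N "M N" "\<xi> N" using N by (rule particles)
    show "prob_space (M N)" by unfold_locales
    show "w i \<in> borel_measurable (R i)" "(\<integral>\<^sup>+g. ennreal (w i g) \<partial>R i) \<le> ennreal B" using m by auto
    show "0 \<le> t" "0 \<le> B" by fact+
    have pm: "(\<lambda>(g, x). \<psi> i N g x) \<in> borel_measurable (R i \<Otimes>\<^sub>M conf N p)" using m N by blast
    have "(\<lambda>(g, \<omega>). (g, \<xi> N p \<omega>)) \<in> R i \<Otimes>\<^sub>M M N \<rightarrow>\<^sub>M R i \<Otimes>\<^sub>M conf N p"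
      using xi_meas[OF N, of p] by measurable
    from measurable_compose[OF this pm]
    show "(\<lambda>(g, \<omega>). \<psi> i N g (\<xi> N p \<omega>)) \<in> borel_measurable (R i \<Otimes>\<^sub>M M N)"
      by (simp add: case_prod_unfold)
    show "0 \<le> \<psi> i N g (\<xi> N p \<omega>) \<and> \<psi> i N g (\<xi> N p \<omega>) \<le> w i g" if "g \<in> space (R i)" "\<omega> \<in> space (M N)" for g \<omega>
      using m that N xi_conf[OF N that(2)] by blast
    have "1 * 1 \<le> C * exp (c * B\<^sup>2 * t\<^sup>2 / real N)" using C by (intro mult_mono) auto
    then show "1 \<le> ennreal (C * exp (c * B\<^sup>2 * t\<^sup>2 / real N))" by (simp add: ennreal_ge_1)
    fix g assume g: "g \<in> space (R i)" "0 < w i g"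
    then obtain X where X: "X \<in> XX" "\<And>x. x \<in> space (conf N p) \<Longrightarrow> \<psi> i N g x / w i g \<le> X N x"
      using m N by blast
    have "(\<integral>\<^sup>+\<omega>. ennreal (exp (t * (B * (\<psi> i N g (\<xi> N p \<omega>) / w i g)))) \<partial>M N)
        \<le> (\<integral>\<^sup>+\<omega>. ennreal (exp ((t * B) * X N (\<xi> N p \<omega>))) \<partial>M N)"
    proof (rule nn_integral_mono)
      fix \<omega> assume "\<omega> \<in> space (M N)"
      from X(2)[OF xi_conf[OF N this]]
      have "(t * B) * (\<psi> i N g (\<xi> N p \<omega>) / w i g) \<le> (t * B) * X N (\<xi> N p \<omega>)"
        using t B by (intro mult_left_mono) auto
      then show "ennreal (exp (t * (B * (\<psi> i N g (\<xi> N p \<omega>) / w i g)))) \<le> ennreal (exp ((t * B) * X N (\<xi> N p \<omega>)))"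
        by (intro ennreal_leI) (simp add: mult.assoc)
    qed
    also have "\<dots> \<le> ennreal (C * exp (c * (t * B)\<^sup>2 / real N))"
      using t B by (intro C(4) X N) auto
    also have "c * (t * B)\<^sup>2 = c * B\<^sup>2 * t\<^sup>2" by (simp add: power_mult_distrib)
    finally show "(\<integral>\<^sup>+\<omega>. ennreal (exp (t * (B * (\<psi> i N g (\<xi> N p \<omega>) / w i g)))) \<partial>M N)
        \<le> ennreal (C * exp (c * B\<^sup>2 * t\<^sup>2 / real N))" .
  qed
  have "0 \<le> c * B\<^sup>2" using C by simp
  then show ?thesis unfolding conc_def using C(1) meas main by blast
qed

lemma dev_scale:
  fixes f :: "'a \<Rightarrow> real"
  shows "dev p (\<lambda>x. f x / c) N x = dev p f N x / \<bar>c\<bar>"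
  by (simp add: dev_def diff_divide_distrib[symmetric] abs_divide)

lemma dev_le_osc:
  assumes "N \<ge> 1" "x \<in> space (conf N p)" "f \<in> bounded_meas (E p)"
  shows "dev p f N x \<le> enn2real (osc (E p) f)"
  unfolding dev_def by (intro Prob_diff_le_osc empirical_Prob flow_Prob assms)

lemma dev_normalised:
  assumes f: "f \<in> bounded_meas (E p)" and o: "0 < enn2real (osc (E p) f)"
  shows "\<exists>X\<in>dev p ` Osc1 (E p). \<forall>N x. dev p f N x / enn2real (osc (E p) f) \<le> X N x"
proof (intro bexI[of _ "dev p (\<lambda>x. f x / enn2real (osc (E p) f))"] allI imageI)
  show "(\<lambda>x. f x / enn2real (osc (E p) f)) \<in> Osc1 (E p)"
    using f by (intro Osc1_divide o diff_le_osc osc_bounded_meas) (auto simp: bounded_meas_def)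
qed (simp add: dev_scale)

lemma eval_integral_measurable:
  assumes T[measurable]: "(\<lambda>(h, x). h x) \<in> borel_measurable (T \<Otimes>\<^sub>M E p)" and \<eta>: "\<eta> \<in> Prob p"
  shows "(\<lambda>h. \<integral>x. h x \<partial>\<eta> :: real) \<in> borel_measurable T"
proof -
  interpret prob_space \<eta> using \<eta> by (rule Prob_prob_space)
  have [measurable_cong]: "sets \<eta> = sets (E p)" using \<eta> by (simp add: space_prob_algebra)
  show ?thesis by (rule borel_measurable_lebesgue_integral) measurable
qed

lemma eval_empirical_measurable:
  assumes T: "(\<lambda>(h, x). h x :: real) \<in> borel_measurable (T \<Otimes>\<^sub>M E p)"
    and sp: "space T \<subseteq> bounded_meas (E p)"
  shows "(\<lambda>(h, x). \<integral>y. h y \<partial>empirical (E p) N x) \<in> borel_measurable (T \<Otimes>\<^sub>M conf N p)"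
proof -
  have "(\<lambda>(h, x). (\<Sum>i\<in>{1..N}. h (x i)) / real N) \<in> borel_measurable (T \<Otimes>\<^sub>M conf N p)"
    unfolding case_prod_unfold
  proof (intro borel_measurable_divide borel_measurable_sum borel_measurable_const)
    fix i assume i: "i \<in> {1..N}"
    have "(\<lambda>z. (fst z, snd z i)) \<in> T \<Otimes>\<^sub>M conf N p \<rightarrow>\<^sub>M T \<Otimes>\<^sub>M E p"
      using measurable_compose[OF measurable_snd measurable_component_singleton[OF i]]
      by (intro measurable_Pair measurable_fst) auto
    from measurable_compose[OF this T] show "(\<lambda>z. fst z (snd z i)) \<in> borel_measurable (T \<Otimes>\<^sub>M conf N p)"
      by (simp add: case_prod_unfold)
  qed
  also have "?this \<longleftrightarrow> ?thesis"
    using sp integral_empirical by (intro measurable_cong) (auto simp: space_pair_measure bounded_meas_def)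
  finally show ?thesis .
qed

text \<open>A tensor measure provides joint measurability only for the product
  \<open>g1 x * g2 y\<close>, not for the two evaluations separately. The product of deviations is
  therefore multiplied out into four integrals of \<open>g1 x * g2 y\<close>, each with respect to a
  pair formed from the empirical measure and the limit.\<close>

lemma tensor_dev_measurable:
  assumes R: "tensor_measure (E p) R" and N: "N \<ge> 1"
  shows "(\<lambda>(g, x). dev p (fst g) N x * dev p (snd g) N x) \<in> borel_measurable (R \<Otimes>\<^sub>M conf N p)"
proof -
  have sp: "fst g \<in> bounded_meas (E p)" "snd g \<in> bounded_meas (E p)" if "g \<in> space R" for g
    using R that Osc1_bounded_meas unfolding tensor_measure_def by force+
  have ev: "(\<lambda>((g1, g2), (x, y)). g1 x * g2 y :: real) \<in> borel_measurable (R \<Otimes>\<^sub>M (E p \<Otimes>\<^sub>M E p))"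
    using R by (simp add: tensor_measure_def)
  have ev': "(\<lambda>z. fst (fst z) (fst (snd z)) * snd (fst z) (snd (snd z))) \<in> borel_measurable (R \<Otimes>\<^sub>M (E p \<Otimes>\<^sub>M E p))"
    using ev by (simp add: case_prod_unfold)
  let ?\<eta> = "flow K \<eta>0 p"
  have \<eta>: "?\<eta> \<in> Prob p" by (rule flow_Prob)
  interpret e: prob_space ?\<eta> using \<eta> by (rule Prob_prob_space)
  interpret ee: pair_prob_space ?\<eta> ?\<eta> ..
  have [measurable_cong]: "sets ?\<eta> = sets (E p)" using \<eta> by (simp add: space_prob_algebra)
  let ?P = "R \<Otimes>\<^sub>M conf N p"
  have ci: "(\<lambda>z. snd z i) \<in> ?P \<rightarrow>\<^sub>M E p" if "i \<in> {1..N}" for i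
    using measurable_compose[OF measurable_snd measurable_component_singleton[OF that]] by auto
  let ?m = "\<lambda>h x. (\<Sum>i\<in>{1..N}. h (x i)) / real N"
  \<comment> \<open>In A both arguments are sampled, in B and C exactly one is averaged over the
    limit, and in D both are.\<close>
  define A where "A z = (\<Sum>i\<in>{1..N}. \<Sum>j\<in>{1..N}. fst (fst z) (snd z i) * snd (fst z) (snd z j)) / (real N)\<^sup>2"
    for z :: "(('a \<Rightarrow> real) \<times> ('a \<Rightarrow> real)) \<times> (nat \<Rightarrow> 'a)"
  define B where "B z = (\<Sum>i\<in>{1..N}. \<integral>y. fst (fst z) (snd z i) * snd (fst z) y \<partial>?\<eta>) / real N"
    for z :: "(('a \<Rightarrow> real) \<times> ('a \<Rightarrow> real)) \<times> (nat \<Rightarrow> 'a)"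
  define C where "C z = (\<Sum>i\<in>{1..N}. \<integral>y. fst (fst z) y * snd (fst z) (snd z i) \<partial>?\<eta>) / real N"
    for z :: "(('a \<Rightarrow> real) \<times> ('a \<Rightarrow> real)) \<times> (nat \<Rightarrow> 'a)"
  define D where "D z = (\<integral>a. (\<integral>b. fst (fst z) a * snd (fst z) b \<partial>?\<eta>) \<partial>?\<eta>)"
    for z :: "(('a \<Rightarrow> real) \<times> ('a \<Rightarrow> real)) \<times> (nat \<Rightarrow> 'a)"
  have Am: "A \<in> borel_measurable ?P" unfolding A_def[abs_def]
  proof (intro borel_measurable_divide borel_measurable_sum borel_measurable_const)
    fix i j assume ij: "i \<in> {1..N}" "j \<in> {1..N}"
    have "(\<lambda>z. (fst z, (snd z i, snd z j))) \<in> ?P \<rightarrow>\<^sub>M R \<Otimes>\<^sub>M (E p \<Otimes>\<^sub>M E p)"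
      using ci[OF ij(1)] ci[OF ij(2)] by measurable
    from measurable_compose[OF this ev']
    show "(\<lambda>z. fst (fst z) (snd z i) * snd (fst z) (snd z j)) \<in> borel_measurable ?P" by simp
  qed
  have Bm: "B \<in> borel_measurable ?P" unfolding B_def[abs_def]
  proof (intro borel_measurable_divide borel_measurable_sum borel_measurable_const e.borel_measurable_lebesgue_integral)
    fix i assume i: "i \<in> {1..N}"
    have "(\<lambda>z. (fst (fst z), (snd (fst z) i, snd z))) \<in> ?P \<Otimes>\<^sub>M ?\<eta> \<rightarrow>\<^sub>M R \<Otimes>\<^sub>M (E p \<Otimes>\<^sub>M E p)"
      using measurable_compose[OF measurable_fst ci[OF i]] by measurable
    from measurable_compose[OF this ev']
    show "(\<lambda>(z, y). fst (fst z) (snd z i) * snd (fst z) y) \<in> borel_measurable (?P \<Otimes>\<^sub>M ?\<eta>)"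
      by (simp add: case_prod_unfold)
  qed
  have Cm: "C \<in> borel_measurable ?P" unfolding C_def[abs_def]
  proof (intro borel_measurable_divide borel_measurable_sum borel_measurable_const e.borel_measurable_lebesgue_integral)
    fix i assume i: "i \<in> {1..N}"
    have "(\<lambda>z. (fst (fst z), (snd z, snd (fst z) i))) \<in> ?P \<Otimes>\<^sub>M ?\<eta> \<rightarrow>\<^sub>M R \<Otimes>\<^sub>M (E p \<Otimes>\<^sub>M E p)"
      using measurable_compose[OF measurable_fst ci[OF i]] by measurable
    from measurable_compose[OF this ev']
    show "(\<lambda>(z, y). fst (fst z) y * snd (fst z) (snd z i)) \<in> borel_measurable (?P \<Otimes>\<^sub>M ?\<eta>)"
      by (simp add: case_prod_unfold)
  qed
  have Dm: "D \<in> borel_measurable ?P" unfolding D_def[abs_def]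
  proof (rule e.borel_measurable_lebesgue_integral, unfold case_prod_unfold, rule e.borel_measurable_lebesgue_integral)
    have "(\<lambda>z. (fst (fst (fst z)), (snd (fst z), snd z))) \<in> (?P \<Otimes>\<^sub>M ?\<eta>) \<Otimes>\<^sub>M ?\<eta> \<rightarrow>\<^sub>M R \<Otimes>\<^sub>M (E p \<Otimes>\<^sub>M E p)"
      by measurable
    from measurable_compose[OF this ev']
    show "(\<lambda>(z, y). fst (fst (fst z)) (snd z) * snd (fst (fst z)) y) \<in> borel_measurable ((?P \<Otimes>\<^sub>M ?\<eta>) \<Otimes>\<^sub>M ?\<eta>)"
      by (simp add: case_prod_unfold)
  qed
  have alg: "a * b - a * v - b * u + u * v = (a - u) * (b - v)" for a b u v :: real
    by (simp add: algebra_simps)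
  have "(\<lambda>z. \<bar>A z - B z - C z + D z\<bar>) \<in> borel_measurable ?P"
    using Am Bm Cm Dm by measurable
  also have "?this \<longleftrightarrow> ?thesis"
  proof (rule measurable_cong)
    fix z assume "z \<in> space ?P"
    then obtain g x where z: "z = (g, x)" "g \<in> space R" "x \<in> space (conf N p)"
      by (auto simp: space_pair_measure)
    define g1 g2 where "g1 = fst g" and "g2 = snd g"
    have b: "g1 \<in> borel_measurable (E p)" "g2 \<in> borel_measurable (E p)"
      using sp[OF z(2)] by (auto simp: g1_def g2_def bounded_meas_def)
    have "A z = ?m g1 x * ?m g2 x"
      by (simp add: A_def z g1_def g2_def sum_product power2_eq_square)
    moreover have "B z = ?m g1 x * (\<integral>y. g2 y \<partial>?\<eta>)"
      by (simp add: B_def z g1_def g2_def sum_distrib_right)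
    moreover have "C z = ?m g2 x * (\<integral>y. g1 y \<partial>?\<eta>)"
      by (simp add: C_def z g1_def g2_def sum_distrib_left mult.commute)
    moreover have "D z = (\<integral>y. g1 y \<partial>?\<eta>) * (\<integral>y. g2 y \<partial>?\<eta>)"
      by (simp add: D_def z g1_def g2_def)
    ultimately have "A z - B z - C z + D z = (?m g1 x - (\<integral>y. g1 y \<partial>?\<eta>)) * (?m g2 x - (\<integral>y. g2 y \<partial>?\<eta>))"
      by (simp only: alg)
    then show "\<bar>A z - B z - C z + D z\<bar> = (\<lambda>(g, x). dev p (fst g) N x * dev p (snd g) N x) z"
      using integral_empirical[OF z(3) b(1)] integral_empirical[OF z(3) b(2)]
      by (simp add: z dev_def g1_def g2_def abs_mult)
  qed
  finally show ?thesis .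
qed

text \<open>The linear term is a deviation of \<open>D f\<close>, brought into \<open>Osc1\<close>
  by dividing by \<beta>; the remainder is a mixture of products of two deviations. The objects R,
  g, \<psi>, w may depend on f, whereas \<beta> and B may not: this carries the uniformity to the
  next time.\<close>

lemma Phi_dev_dominated:
  obtains \<beta> B where "0 \<le> \<beta>" "0 \<le> B"
    "\<And>f. f \<in> Osc1 (E (Suc p)) \<Longrightarrow> \<exists>(R :: (('a \<Rightarrow> real) \<times> ('a \<Rightarrow> real)) measure) g \<psi> w.
        g \<in> Osc1 (E p) \<and> mixture_of p (dev p ` Osc1 (E p)) B R \<psi> w \<and>
        (\<forall>N\<ge>1. \<forall>x\<in>space (conf N p). Phi_dev p f N x \<le> \<beta> * dev p g N x + mixture R \<psi> N x)"
proof -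
  let ?\<eta> = "flow K \<eta>0 p"
  have \<eta>: "?\<eta> \<in> Prob p" by (rule flow_Prob)
  from Upsilon[of p] obtain D Rem R and \<delta> :: ennreal where
    exp1: "\<forall>\<mu>\<in>Prob p. \<forall>\<eta>\<in>Prob p. \<forall>f\<in>bounded_meas (E (Suc p)).
       (\<integral>y. f y \<partial>Phi K (Suc p) \<mu>) - (\<integral>y. f y \<partial>Phi K (Suc p) \<eta>) =
             ((\<integral>x. D \<eta> f x \<partial>\<mu>) - (\<integral>x. D \<eta> f x \<partial>\<eta>)) + Rem \<mu> \<eta> f"
    and bio: "\<forall>\<eta>\<in>Prob p. bounded_integral_operator (E p) (E (Suc p)) (D \<eta>) \<and> (\<forall>x\<in>space (E p). D \<eta> (\<lambda>_. 1) x = 0)"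
    and bet: "(SUP \<eta>\<in>Prob p. beta (E p) (E (Suc p)) (D \<eta>)) < \<infinity>"
    and ten: "\<forall>\<eta>\<in>Prob p. \<forall>f\<in>bounded_meas (E (Suc p)). tensor_measure (E p) (R \<eta> f)"
    and rem: "\<forall>\<mu>\<in>Prob p. \<forall>\<eta>\<in>Prob p. \<forall>f\<in>bounded_meas (E (Suc p)).
       ennreal \<bar>Rem \<mu> \<eta> f\<bar> \<le> (\<integral>\<^sup>+ (g1, g2). ennreal \<bar>((\<integral>x. g1 x \<partial>\<mu>) - (\<integral>x. g1 x \<partial>\<eta>)) *
                                ((\<integral>x. g2 x \<partial>\<mu>) - (\<integral>x. g2 x \<partial>\<eta>))\<bar> \<partial>R \<eta> f)"
    and Rb: "\<forall>f\<in>bounded_meas (E (Suc p)).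
       (SUP \<eta>\<in>Prob p. \<integral>\<^sup>+ (g1, g2). osc (E p) g1 * osc (E p) g2 \<partial>R \<eta> f) \<le> osc (E (Suc p)) f * \<delta>"
    and del: "\<delta> < \<infinity>"
    unfolding Upsilon_def by (elim conjE exE) (rule that; assumption)
  note exp1 = exp1[rule_format] and bio = bio[rule_format, THEN conjunct1] and ten = ten[rule_format]
    and rem = rem[rule_format] and Rb = Rb[rule_format]
  \<comment> \<open>The added 1 makes \<beta> positive, so that division by it is meaningful even
    when all oscillations of \<open>D f\<close> vanish.\<close>
  define \<beta> where "\<beta> = enn2real (SUP \<eta>\<in>Prob p. beta (E p) (E (Suc p)) (D \<eta>)) + 1"
  define B where "B = enn2real \<delta>"
  show ?thesis
  proof (rule that[of \<beta> B])
    show b0: "0 \<le> \<beta>" by (simp add: \<beta>_def add_nonneg_nonneg)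
    show "0 \<le> B" by (simp add: B_def)
    fix f assume f: "f \<in> Osc1 (E (Suc p))"
    then have fb: "f \<in> bounded_meas (E (Suc p))" by (rule Osc1_bounded_meas)
    have Df: "D ?\<eta> f \<in> bounded_meas (E p)" using bio[OF \<eta>] fb by (auto simp: bounded_integral_operator_def)
    define g where "g x = D ?\<eta> f x / \<beta>" for x
    have b1: "0 < \<beta>" by (simp add: \<beta>_def add_nonneg_pos)
    have "osc (E p) (D ?\<eta> f) \<le> (SUP \<eta>\<in>Prob p. beta (E p) (E (Suc p)) (D \<eta>))"
      using f unfolding beta_def by (intro SUP_upper2[OF \<eta>] SUP_upper)
    also have "\<dots> \<le> ennreal \<beta>"
      using bet by (simp add: \<beta>_def ennreal_plus add_increasing2 del: ennreal_plus)
        (metis ennreal_enn2real_if ennreal_leI infinity_ennreal_def le_add_same_cancel1 less_irrefl zero_le_one)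
    finally have "osc (E p) (D ?\<eta> f) \<le> ennreal \<beta>" .
    then have g1: "g \<in> Osc1 (E p)"
      unfolding g_def[abs_def] using Df b1 osc_le_iff[OF b0, of "E p" "D ?\<eta> f"]
      by (intro Osc1_divide) (auto simp: bounded_meas_def)
    define \<psi> where "\<psi> N h x = dev p (fst h) N x * dev p (snd h) N x"
      for N and h :: "('a \<Rightarrow> real) \<times> ('a \<Rightarrow> real)" and x :: "nat \<Rightarrow> 'a"
    define w where "w h = enn2real (osc (E p) (fst h) * osc (E p) (snd h))" for h :: "('a \<Rightarrow> real) \<times> ('a \<Rightarrow> real)"
    have sp: "fst h \<in> bounded_meas (E p)" "snd h \<in> bounded_meas (E p)"
      "osc (E p) (fst h) < \<infinity>" "osc (E p) (snd h) < \<infinity>" "osc (E p) (snd h) \<le> 1"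
      if "h \<in> space (R ?\<eta> f)" for h
    proof -
      have "fst h \<in> Osc1 (E p)" "snd h \<in> Osc1 (E p)"
        using ten[OF \<eta> fb] that unfolding tensor_measure_def by auto
      then show "fst h \<in> bounded_meas (E p)" "snd h \<in> bounded_meas (E p)"
        "osc (E p) (fst h) < \<infinity>" "osc (E p) (snd h) < \<infinity>" "osc (E p) (snd h) \<le> 1"
        using Osc1_bounded_meas osc_bounded_meas by (auto simp: Osc1_def)
    qed
    have wp: "w h = enn2real (osc (E p) (fst h)) * enn2real (osc (E p) (snd h))" for h
      by (simp add: w_def enn2real_mult)
    have we: "ennreal (w h) = osc (E p) (fst h) * osc (E p) (snd h)" if "h \<in> space (R ?\<eta> f)" for h
      using sp(3,4)[OF that] by (simp add: w_def ennreal_mult_less_top)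
    have bnd: "0 \<le> \<psi> N h x \<and> \<psi> N h x \<le> w h" if "N \<ge> 1" "h \<in> space (R ?\<eta> f)" "x \<in> space (conf N p)" for N h x
      unfolding \<psi>_def wp
      using dev_le_osc[OF that(1,3) sp(1)[OF that(2)]] dev_le_osc[OF that(1,3) sp(2)[OF that(2)]]
      by (auto intro!: mult_mono mult_nonneg_nonneg simp: dev_def)
    have mix: "mixture_of p (dev p ` Osc1 (E p)) B (R ?\<eta> f) \<psi> w"
      unfolding mixture_of_def
    proof (intro conjI allI impI ballI)
      have "(\<lambda>h. osc (E p) (fst h) * osc (E p) (snd h)) \<in> borel_measurable (R ?\<eta> f)"
        using ten[OF \<eta> fb] by (simp add: tensor_measure_def case_prod_unfold)
      then show "w \<in> borel_measurable (R ?\<eta> f)"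
        unfolding w_def[abs_def] by measurable
      have "(\<integral>\<^sup>+h. ennreal (w h) \<partial>R ?\<eta> f) = (\<integral>\<^sup>+(g1, g2). osc (E p) g1 * osc (E p) g2 \<partial>R ?\<eta> f)"
        using we by (intro nn_integral_cong) (simp add: case_prod_unfold)
      also have "\<dots> \<le> (SUP \<eta>\<in>Prob p. \<integral>\<^sup>+ (g1, g2). osc (E p) g1 * osc (E p) g2 \<partial>R \<eta> f)"
        by (rule SUP_upper[OF \<eta>])
      also have "\<dots> \<le> osc (E (Suc p)) f * \<delta>" by (rule Rb[OF fb])
      also have "\<dots> \<le> 1 * \<delta>" using f by (intro mult_right_mono) (auto simp: Osc1_def)
      also have "\<dots> = ennreal B" using del by (simp add: B_def)
      finally show "(\<integral>\<^sup>+h. ennreal (w h) \<partial>R ?\<eta> f) \<le> ennreal B" .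
      fix N :: nat assume N: "1 \<le> N"
      show "(\<lambda>(g, x). \<psi> N g x) \<in> borel_measurable (R ?\<eta> f \<Otimes>\<^sub>M conf N p)"
        unfolding \<psi>_def by (rule tensor_dev_measurable[OF ten[OF \<eta> fb] N])
      fix h x assume "h \<in> space (R ?\<eta> f)" "x \<in> space (conf N p)"
      then show "0 \<le> \<psi> N h x" "\<psi> N h x \<le> w h" using bnd[OF N] by auto
    next
      fix h assume h: "h \<in> space (R ?\<eta> f)" and w0: "0 < w h"
      have o: "0 < enn2real (osc (E p) (fst h))" "0 < enn2real (osc (E p) (snd h))"
        using w0 enn2real_nonneg[of "osc (E p) (fst h)"] enn2real_nonneg[of "osc (E p) (snd h)"]
        unfolding wp zero_less_mult_iff by linarith+
      from dev_normalised[OF sp(1)[OF h] o(1)] obtain X where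
        X: "X \<in> dev p ` Osc1 (E p)" "\<And>N x. dev p (fst h) N x / enn2real (osc (E p) (fst h)) \<le> X N x" by blast
      show "\<exists>X\<in>dev p ` Osc1 (E p). \<forall>N\<ge>1. \<forall>x\<in>space (conf N p). \<psi> N h x / w h \<le> X N x"
      proof (intro bexI[OF _ X(1)] allI impI ballI)
        fix N :: nat and x assume N: "1 \<le> N" and x: "x \<in> space (conf N p)"
        have "\<psi> N h x / w h = dev p (fst h) N x / enn2real (osc (E p) (fst h))
            * (dev p (snd h) N x / enn2real (osc (E p) (snd h)))"
          by (simp add: \<psi>_def wp)
        \<comment> \<open>The second normalised factor is at most 1 and is given up. The quadratic
          remainder is thereby treated as a linear one, and the bound survives for all t.\<close>
        also have "\<dots> \<le> dev p (fst h) N x / enn2real (osc (E p) (fst h)) * 1"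
          using dev_le_osc[OF N x sp(2)[OF h]] o by (intro mult_left_mono) (auto simp: dev_def)
        also have "\<dots> \<le> X N x" using X(2) by simp
        finally show "\<psi> N h x / w h \<le> X N x" .
      qed
    qed
    have dom: "Phi_dev p f N x \<le> \<beta> * dev p g N x + mixture (R ?\<eta> f) \<psi> N x"
      if N: "N \<ge> 1" and x: "x \<in> space (conf N p)" for N x
    proof -
      let ?\<mu> = "empirical (E p) N x"
      have \<mu>: "?\<mu> \<in> Prob p" by (rule empirical_Prob[OF N x])
      \<comment> \<open>Finiteness has to be known first, because \<open>enn2real\<close> sends an
        infinite integral to 0.\<close>
      have "(\<integral>\<^sup>+h. ennreal (\<psi> N h x) \<partial>R ?\<eta> f) \<le> (\<integral>\<^sup>+h. ennreal (w h) \<partial>R ?\<eta> f)"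
        using bnd[OF N _ x] by (intro nn_integral_mono ennreal_leI) auto
      also have "\<dots> < top" using mix by (auto simp: mixture_of_def intro: le_less_trans)
      finally have fin: "(\<integral>\<^sup>+h. ennreal (\<psi> N h x) \<partial>R ?\<eta> f) < top" .
      have "ennreal \<bar>Rem ?\<mu> ?\<eta> f\<bar> \<le> (\<integral>\<^sup>+h. ennreal (\<psi> N h x) \<partial>R ?\<eta> f)"
        using rem[OF \<mu> \<eta> fb] by (simp add: \<psi>_def dev_def abs_mult case_prod_unfold)
      then have "\<bar>Rem ?\<mu> ?\<eta> f\<bar> \<le> mixture (R ?\<eta> f) \<psi> N x"
        using fin unfolding mixture_def by (metis abs_ge_zero enn2real_ennreal enn2real_mono)
      moreover have "\<beta> * dev p g N x = \<bar>(\<integral>x. D ?\<eta> f x \<partial>?\<mu>) - (\<integral>x. D ?\<eta> f x \<partial>?\<eta>)\<bar>"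
        unfolding g_def[abs_def] dev_scale using b1 by (simp add: dev_def)
      ultimately show ?thesis
        using exp1[OF \<mu> \<eta> fb] by (simp add: Phi_dev_def)
    qed
    show "\<exists>(R :: (('a \<Rightarrow> real) \<times> ('a \<Rightarrow> real)) measure) g \<psi> w.
        g \<in> Osc1 (E p) \<and> mixture_of p (dev p ` Osc1 (E p)) B R \<psi> w \<and>
        (\<forall>N\<ge>1. \<forall>x\<in>space (conf N p). Phi_dev p f N x \<le> \<beta> * dev p g N x + mixture R \<psi> N x)"
      by (rule exI[of _ "R ?\<eta> f"], rule exI[of _ g], rule exI[of _ \<psi>], rule exI[of _ w])
        (use g1 mix dom in blast)
  qed
qed

lemma conc_Phi_dev:
  assumes "conc p (dev p ` Osc1 (E p))"
  shows "conc p (Phi_dev p ` Osc1 (E (Suc p)))"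
proof -
  obtain \<beta> B where bB: "0 \<le> \<beta>" "0 \<le> B" and
    "\<And>f. f \<in> Osc1 (E (Suc p)) \<Longrightarrow> \<exists>(R :: (('a \<Rightarrow> real) \<times> ('a \<Rightarrow> real)) measure) g \<psi> w.
        g \<in> Osc1 (E p) \<and> mixture_of p (dev p ` Osc1 (E p)) B R \<psi> w \<and>
        (\<forall>N\<ge>1. \<forall>x\<in>space (conf N p). Phi_dev p f N x \<le> \<beta> * dev p g N x + mixture R \<psi> N x)"
    by (rule Phi_dev_dominated[of p]) blast
  then obtain R :: "('a \<Rightarrow> real) \<Rightarrow> (('a \<Rightarrow> real) \<times> ('a \<Rightarrow> real)) measure" and g \<psi> w where
    *: "\<And>f. f \<in> Osc1 (E (Suc p)) \<Longrightarrow> g f \<in> Osc1 (E p) \<and> mixture_of p (dev p ` Osc1 (E p)) B (R f) (\<psi> f) (w f) \<and>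
        (\<forall>N\<ge>1. \<forall>x\<in>space (conf N p). Phi_dev p f N x \<le> \<beta> * dev p (g f) N x + mixture (R f) (\<psi> f) N x)"
    by metis
  have "conc p ((\<lambda>f. mixture (R f) (\<psi> f)) ` Osc1 (E (Suc p)))"
    using * by (intro conc_mixture[OF assms bB(2), where w=w]) auto
  then show ?thesis
  proof (rule conc_combine[OF assms _ bB(1), of _ 1])
    show "Z N \<in> borel_measurable (conf N p)" if Z: "Z \<in> Phi_dev p ` Osc1 (E (Suc p))" and N: "N \<ge> 1" for Z N
      using Z Phi_dev_measurable[OF N Osc1_bounded_meas] by blast
    fix Z assume "Z \<in> Phi_dev p ` Osc1 (E (Suc p))"
    then obtain f where f: "Z = Phi_dev p f" "f \<in> Osc1 (E (Suc p))" by blast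
    show "\<exists>X\<in>dev p ` Osc1 (E p). \<exists>Y\<in>(\<lambda>f. mixture (R f) (\<psi> f)) ` Osc1 (E (Suc p)).
        \<forall>N\<ge>1. \<forall>x\<in>space (conf N p). Z N x \<le> \<beta> * X N x + 1 * Y N x"
      using *[OF f(2)] f(2) unfolding f(1) mult_1
      by (intro bexI[of _ "dev p (g f)"] bexI[of _ "mixture (R f) (\<psi> f)"] imageI) auto
  qed simp
qed

text \<open>The deviation at time \<open>Suc p\<close> is at most the sampling error given time p
  plus \<open>Phi_dev\<close>. The first is sub-Gaussian by Hoeffding's lemma, the second by the
  induction hypothesis and the expansion of \<open>Phi\<close>; the two need not be
  independent.\<close>

lemma conc_dev: "conc p (dev p ` Osc1 (E p))"
proof (induction p)
  case 0
  have m: "dev 0 f N \<in> borel_measurable (conf N 0)" if "f \<in> Osc1 (E 0)" for f N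
    using that by (intro dev_measurable) (auto simp: Osc1_def)
  have "(\<integral>\<^sup>+\<omega>. ennreal (exp (t * dev 0 f N (\<xi> N 0 \<omega>))) \<partial>M N) \<le> ennreal (2 * exp (1 / 2 * t\<^sup>2 / real N))"
    if f: "f \<in> Osc1 (E 0)" and N: "N \<ge> 1" and t: "0 \<le> t" for f N t
  proof -
    interpret P: particles E K \<eta>0 N "M N" "\<xi> N" using N by (rule particles)
    have "dev 0 f N (\<xi> N 0 \<omega>) = \<bar>fluct_sum N 0 (\<lambda>k. \<xi> N k \<omega>) f / real N\<bar>" if "\<omega> \<in> space (M N)" for \<omega>
      using integral_empirical[OF xi_conf[OF N that], of f] f N
      by (simp add: dev_def fluct_sum_def Osc1_def sum_subtractf diff_divide_distrib)
    then have "(\<integral>\<^sup>+\<omega>. ennreal (exp (t * dev 0 f N (\<xi> N 0 \<omega>))) \<partial>M N)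
        = (\<integral>\<^sup>+\<omega>. ennreal (exp (t * \<bar>fluct_sum N 0 (\<lambda>k. \<xi> N k \<omega>) f / real N\<bar>)) \<partial>M N)"
      by (intro nn_integral_cong) simp
    also have "\<dots> \<le> ennreal (2 * exp (t\<^sup>2 / (2 * real N)))" by (rule P.fluct_sum_exp_moment[OF f t])
    finally show ?thesis by simp
  qed
  with m show ?case unfolding conc_def
    by (intro exI[of _ 2] conjI exI[of _ "1/2"]) auto
next
  case (Suc p)
  from conc_Phi_dev[OF this] obtain C c where C: "1 \<le> C" "0 \<le> c"
    "\<And>X N. X \<in> Phi_dev p ` Osc1 (E (Suc p)) \<Longrightarrow> N \<ge> 1 \<Longrightarrow> X N \<in> borel_measurable (conf N p)"
    "\<And>X N t. X \<in> Phi_dev p ` Osc1 (E (Suc p)) \<Longrightarrow> N \<ge> 1 \<Longrightarrow> 0 \<le> t \<Longrightarrow>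
      (\<integral>\<^sup>+\<omega>. ennreal (exp (t * X N (\<xi> N p \<omega>))) \<partial>M N) \<le> ennreal (C * exp (c * t\<^sup>2 / real N))"
    by (rule concE) blast
  define D where "D = max C 2"
  \<comment> \<open>At order 2t the sampling error contributes \<open>2 * t^2\<close> and the
    inherited error \<open>4 * c * t^2\<close>; k bounds both.\<close>
  define k where "k = 4 * c + 2"
  have m: "dev (Suc p) f N \<in> borel_measurable (conf N (Suc p))" if "f \<in> Osc1 (E (Suc p))" for f N
    using that by (intro dev_measurable) (auto simp: Osc1_def)
  have "(\<integral>\<^sup>+\<omega>. ennreal (exp (t * dev (Suc p) f N (\<xi> N (Suc p) \<omega>))) \<partial>M N) \<le> ennreal (D * exp (k * t\<^sup>2 / real N))"
    if f: "f \<in> Osc1 (E (Suc p))" and N: "N \<ge> 1" and t: "0 \<le> t" for f N t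
  proof -
    interpret P: particles E K \<eta>0 N "M N" "\<xi> N" using N by (rule particles)
    have fb: "f \<in> bounded_meas (E (Suc p))" using f by (rule Osc1_bounded_meas)
    have fm: "f \<in> borel_measurable (E (Suc p))" using f by (simp add: Osc1_def)
    let ?W = "\<lambda>\<omega>. \<bar>fluct_sum N (Suc p) (\<lambda>k. \<xi> N k \<omega>) f / real N\<bar>"
    have N0: "0 < real N" using N by simp
    show ?thesis
    proof (rule nn_integral_exp_sum_le)
      show "(\<lambda>\<omega>. t * ?W \<omega>) \<in> borel_measurable (M N)"
        using P.fluct_sum_measurable[OF fm] by measurable
      show "(\<lambda>\<omega>. t * Phi_dev p f N (\<xi> N p \<omega>)) \<in> borel_measurable (M N)"
        using measurable_compose[OF xi_meas[OF N] C(3)[OF imageI[OF f] N]] by measurable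
      have "(\<integral>\<^sup>+\<omega>. ennreal (exp (2 * (t * ?W \<omega>))) \<partial>M N) = (\<integral>\<^sup>+\<omega>. ennreal (exp ((2 * t) * ?W \<omega>)) \<partial>M N)"
        by (simp only: mult.assoc)
      also have "\<dots> \<le> ennreal (2 * exp ((2 * t)\<^sup>2 / (2 * real N)))"
        using t by (intro P.fluct_sum_exp_moment f) auto
      also have "\<dots> \<le> ennreal (D * exp (k * t\<^sup>2 / real N))"
      proof (intro ennreal_leI mult_mono)
        have "(2 * t)\<^sup>2 / (2 * real N) = 2 * t\<^sup>2 / real N" by (simp add: power_mult_distrib)
        also have "\<dots> \<le> k * t\<^sup>2 / real N"
          using C(2) N0 by (intro divide_right_mono mult_right_mono) (auto simp: k_def)
        finally show "exp ((2 * t)\<^sup>2 / (2 * real N)) \<le> exp (k * t\<^sup>2 / real N)" by simp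
      qed (auto simp: D_def)
      finally show "(\<integral>\<^sup>+\<omega>. ennreal (exp (2 * (t * ?W \<omega>))) \<partial>M N) \<le> ennreal (D * exp (k * t\<^sup>2 / real N))" .
      have "(\<integral>\<^sup>+\<omega>. ennreal (exp (2 * (t * Phi_dev p f N (\<xi> N p \<omega>)))) \<partial>M N)
          = (\<integral>\<^sup>+\<omega>. ennreal (exp ((2 * t) * Phi_dev p f N (\<xi> N p \<omega>))) \<partial>M N)"
        by (simp only: mult.assoc)
      also have "\<dots> \<le> ennreal (C * exp (c * (2 * t)\<^sup>2 / real N))"
        using t f by (intro C(4) N) auto
      also have "\<dots> \<le> ennreal (D * exp (k * t\<^sup>2 / real N))"
      proof (intro ennreal_leI mult_mono)
        have "c * (2 * t)\<^sup>2 / real N = (4 * c) * t\<^sup>2 / real N" by (simp add: power_mult_distrib)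
        also have "\<dots> \<le> k * t\<^sup>2 / real N"
          using N0 by (intro divide_right_mono mult_right_mono) (auto simp: k_def)
        finally show "exp (c * (2 * t)\<^sup>2 / real N) \<le> exp (k * t\<^sup>2 / real N)" by simp
      qed (use C in \<open>auto simp: D_def\<close>)
      finally show "(\<integral>\<^sup>+\<omega>. ennreal (exp (2 * (t * Phi_dev p f N (\<xi> N p \<omega>)))) \<partial>M N) \<le> ennreal (D * exp (k * t\<^sup>2 / real N))" .
      fix \<omega> assume w: "\<omega> \<in> space (M N)"
      have "(\<integral>y. f y \<partial>empirical (E (Suc p)) N (\<xi> N (Suc p) \<omega>)) - (\<integral>y. f y \<partial>Phi K (Suc p) (empirical (E p) N (\<xi> N p \<omega>)))
          = fluct_sum N (Suc p) (\<lambda>k. \<xi> N k \<omega>) f / real N"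
        using integral_empirical[OF xi_conf[OF N w] fm] law_integral_sum[OF N _ fb, of "\<lambda>k. \<xi> N k \<omega>"] xi_conf[OF N w]
        by (simp add: fluct_sum_def sum_subtractf diff_divide_distrib)
      then have "dev (Suc p) f N (\<xi> N (Suc p) \<omega>) \<le> ?W \<omega> + Phi_dev p f N (\<xi> N p \<omega>)"
        unfolding dev_def Phi_dev_def by linarith
      then have "t * dev (Suc p) f N (\<xi> N (Suc p) \<omega>) \<le> t * (?W \<omega> + Phi_dev p f N (\<xi> N p \<omega>))"
        using t by (rule mult_left_mono)
      then show "t * dev (Suc p) f N (\<xi> N (Suc p) \<omega>) \<le> t * ?W \<omega> + t * Phi_dev p f N (\<xi> N p \<omega>)"
        by (simp only: distrib_left)
    qed
  qed
  moreover have "1 \<le> D" "0 \<le> k" using C by (auto simp: D_def k_def)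
  ultimately show ?case using m unfolding conc_def by blast
qed

end

section \<open>Covariances and concentration of the conditional variance\<close>

definition covar :: "'a measure \<Rightarrow> ('a \<Rightarrow> real) \<Rightarrow> ('a \<Rightarrow> real) \<Rightarrow> real" where
  "covar \<eta> f g = (\<integral>y. (f y - (\<integral>z. f z \<partial>\<eta>)) * (g y - (\<integral>z. g z \<partial>\<eta>)) \<partial>\<eta>)"

lemma limit_cov_covar:
  "limit_cov K \<eta>0 0 f g = covar \<eta>0 f g"
  "limit_cov K \<eta>0 (Suc n) f g = (\<integral>x. covar (K (Suc n) (flow K \<eta>0 n) x) f g \<partial>flow K \<eta>0 n)"
  by (simp_all add: covar_def Let_def)

context mean_field
begin

lemma bounded_meas_mult: "f \<in> bounded_meas (E n) \<Longrightarrow> g \<in> bounded_meas (E n) \<Longrightarrow> (\<lambda>x. f x * g x) \<in> bounded_meas (E n)"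
proof -
  assume f: "f \<in> bounded_meas (E n)" and g: "g \<in> bounded_meas (E n)"
  from f obtain b where b: "f \<in> borel_measurable (E n)" "0 \<le> b" "\<And>x. x \<in> space (E n) \<Longrightarrow> \<bar>f x\<bar> \<le> b"
    by (rule bounded_measE) blast
  from g obtain c where c: "g \<in> borel_measurable (E n)" "0 \<le> c" "\<And>x. x \<in> space (E n) \<Longrightarrow> \<bar>g x\<bar> \<le> c"
    by (rule bounded_measE) blast
  show ?thesis
    using b c by (intro bounded_measI[where b="b * c"]) (auto simp: abs_mult intro!: mult_mono)
qed

lemma bounded_meas_sum:
  assumes "finite I" "\<And>i. i \<in> I \<Longrightarrow> f i \<in> bounded_meas (E n)"
  shows "(\<lambda>x. \<Sum>i\<in>I. c i * f i x) \<in> bounded_meas (E n)"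
proof -
  have "\<forall>i\<in>I. \<exists>b. \<forall>x\<in>space (E n). \<bar>f i x\<bar> \<le> b"
    using assms(2) by (auto simp: bounded_meas_def bounded_iff) 
  then obtain b where b: "\<And>i x. i \<in> I \<Longrightarrow> x \<in> space (E n) \<Longrightarrow> \<bar>f i x\<bar> \<le> b i" by metis
  show ?thesis
  proof (rule bounded_measI[where b="\<Sum>i\<in>I. \<bar>c i\<bar> * b i"])
    show "(\<lambda>x. \<Sum>i\<in>I. c i * f i x) \<in> borel_measurable (E n)"
      using assms(2) by (intro borel_measurable_sum borel_measurable_times) (auto simp: bounded_meas_def)
    fix x assume x: "x \<in> space (E n)"
    have "\<bar>\<Sum>i\<in>I. c i * f i x\<bar> \<le> (\<Sum>i\<in>I. \<bar>c i * f i x\<bar>)" by (rule sum_abs)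
    also have "\<dots> \<le> (\<Sum>i\<in>I. \<bar>c i\<bar> * b i)"
      using b[OF _ x] by (intro sum_mono) (auto simp: abs_mult intro!: mult_left_mono)
    finally show "\<bar>\<Sum>i\<in>I. c i * f i x\<bar> \<le> (\<Sum>i\<in>I. \<bar>c i\<bar> * b i)" .
  qed
qed

lemma covar_eq:
  assumes \<eta>: "\<eta> \<in> Prob n" and f: "f \<in> bounded_meas (E n)" and g: "g \<in> bounded_meas (E n)"
  shows "covar \<eta> f g = (\<integral>y. f y * g y \<partial>\<eta>) - (\<integral>y. f y \<partial>\<eta>) * (\<integral>y. g y \<partial>\<eta>)"
proof -
  interpret prob_space \<eta> using \<eta> by (rule Prob_prob_space)
  note i = Prob_integrable[OF \<eta> f] Prob_integrable[OF \<eta> g] Prob_integrable[OF \<eta> bounded_meas_mult[OF f g]]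
  have "covar \<eta> f g = (\<integral>y. f y * g y - f y * (\<integral>z. g z \<partial>\<eta>) - (\<integral>z. f z \<partial>\<eta>) * g y + (\<integral>z. f z \<partial>\<eta>) * (\<integral>z. g z \<partial>\<eta>) \<partial>\<eta>)"
    by (simp add: covar_def algebra_simps)
  also have "\<dots> = (\<integral>y. f y * g y \<partial>\<eta>) - (\<integral>y. f y \<partial>\<eta>) * (\<integral>y. g y \<partial>\<eta>)"
    using i by (simp add: prob_space)
  finally show ?thesis .
qed

lemma covar_nonneg: "0 \<le> covar \<eta> f f"
  by (simp add: covar_def)

lemma covar_commute: "covar \<eta> f g = covar \<eta> g f"
  by (simp add: covar_def mult.commute)

lemma limit_cov_commute: "limit_cov K \<eta>0 n f g = limit_cov K \<eta>0 n g f"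
  by (cases n) (simp_all only: limit_cov_covar covar_commute[of _ f g])

lemma limit_cov_nonneg: "0 \<le> limit_cov K \<eta>0 n f f"
  by (cases n) (auto simp only: limit_cov_covar intro!: integral_nonneg_AE covar_nonneg)

lemma covar_sum:
  assumes \<eta>: "\<eta> \<in> Prob n" and I: "finite I" and f: "\<And>i. i \<in> I \<Longrightarrow> f i \<in> bounded_meas (E n)"
  shows "covar \<eta> (\<lambda>x. \<Sum>i\<in>I. c i * f i x) (\<lambda>x. \<Sum>i\<in>I. c i * f i x)
      = (\<Sum>i\<in>I. \<Sum>j\<in>I. c i * c j * covar \<eta> (f i) (f j))"
proof -
  interpret prob_space \<eta> using \<eta> by (rule Prob_prob_space)
  have "(\<integral>z. (\<Sum>i\<in>I. c i * f i z) \<partial>\<eta>) = (\<Sum>i\<in>I. c i * (\<integral>z. f i z \<partial>\<eta>))"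
    using Prob_integrable[OF \<eta> f] by (subst Bochner_Integration.integral_sum) auto
  then have "covar \<eta> (\<lambda>x. \<Sum>i\<in>I. c i * f i x) (\<lambda>x. \<Sum>i\<in>I. c i * f i x)
      = (\<integral>y. (\<Sum>i\<in>I. c i * (f i y - (\<integral>z. f i z \<partial>\<eta>))) * (\<Sum>i\<in>I. c i * (f i y - (\<integral>z. f i z \<partial>\<eta>))) \<partial>\<eta>)"
    by (simp add: covar_def right_diff_distrib sum_subtractf)
  also have "\<dots> = (\<integral>y. (\<Sum>i\<in>I. \<Sum>j\<in>I. c i * c j * ((f i y - (\<integral>z. f i z \<partial>\<eta>)) * (f j y - (\<integral>z. f j z \<partial>\<eta>)))) \<partial>\<eta>)"
    by (simp add: sum_product mult_ac)
  also have "\<dots> = (\<Sum>i\<in>I. \<Sum>j\<in>I. c i * c j * covar \<eta> (f i) (f j))"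
  proof -
    have "integrable \<eta> (\<lambda>y. (f i y - (\<integral>z. f i z \<partial>\<eta>)) * (f j y - (\<integral>z. f j z \<partial>\<eta>)))" if "i \<in> I" "j \<in> I" for i j
    proof -
      have "(\<lambda>y. f i y - k) \<in> bounded_meas (E n)" if i: "i \<in> I" for i k
      proof -
        obtain b where "f i \<in> borel_measurable (E n)" "0 \<le> b" "\<And>x. x \<in> space (E n) \<Longrightarrow> \<bar>f i x\<bar> \<le> b"
          using f[OF i] by (rule bounded_measE) blast
        then show ?thesis by (intro bounded_measI[where b="b + \<bar>k\<bar>"]) (auto intro: order_trans[OF abs_triangle_ineq4] add_right_mono)
      qed
      then show ?thesis using that by (intro Prob_integrable[OF \<eta>] bounded_meas_mult)
    qed
    then show ?thesis unfolding covar_def by simp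
  qed
  finally show ?thesis .
qed

lemma covar_kernel_bounded:
  assumes \<eta>: "\<eta> \<in> Prob n" and f: "f \<in> bounded_meas (E (Suc n))" and g: "g \<in> bounded_meas (E (Suc n))"
  shows "integrable \<eta> (\<lambda>x. covar (K (Suc n) \<eta> x) f g)"
proof -
  have "integrable \<eta> (\<lambda>x. (\<integral>y. f y * g y \<partial>K (Suc n) \<eta> x) - (\<integral>y. f y \<partial>K (Suc n) \<eta> x) * (\<integral>y. g y \<partial>K (Suc n) \<eta> x))"
    by (intro Bochner_Integration.integrable_diff Prob_integrable[OF \<eta>] kernel_integral_bounded[OF \<eta>] bounded_meas_mult f g)
  also have "?this \<longleftrightarrow> ?thesis"
    using covar_eq[OF kernel_Prob[OF \<eta>] f g] Prob_space[OF \<eta>]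
    by (intro Bochner_Integration.integrable_cong) auto
  finally show ?thesis .
qed

lemma limit_cov_sum:
  assumes I: "finite I" and f: "\<And>i. i \<in> I \<Longrightarrow> f i \<in> bounded_meas (E n)"
  shows "limit_cov K \<eta>0 n (\<lambda>x. \<Sum>i\<in>I. c i * f i x) (\<lambda>x. \<Sum>i\<in>I. c i * f i x)
      = (\<Sum>i\<in>I. \<Sum>j\<in>I. c i * c j * limit_cov K \<eta>0 n (f i) (f j))"
proof (cases n)
  case 0
  then show ?thesis using covar_sum[OF eta0_Prob I] f by (simp only: limit_cov_covar)
next
  case (Suc k)
  let ?\<eta> = "flow K \<eta>0 k"
  have \<eta>: "?\<eta> \<in> Prob k" by (rule flow_Prob)
  have "(\<integral>x. covar (K (Suc k) ?\<eta> x) (\<lambda>x. \<Sum>i\<in>I. c i * f i x) (\<lambda>x. \<Sum>i\<in>I. c i * f i x) \<partial>?\<eta>)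
      = (\<integral>x. (\<Sum>i\<in>I. \<Sum>j\<in>I. c i * c j * covar (K (Suc k) ?\<eta> x) (f i) (f j)) \<partial>?\<eta>)"
    using covar_sum[OF kernel_Prob[OF \<eta>] I] f Suc Prob_space[OF \<eta>]
    by (intro Bochner_Integration.integral_cong) auto
  also have "\<dots> = (\<Sum>i\<in>I. \<Sum>j\<in>I. c i * c j * (\<integral>x. covar (K (Suc k) ?\<eta> x) (f i) (f j) \<partial>?\<eta>))"
    using covar_kernel_bounded[OF \<eta>] f Suc by simp
  finally show ?thesis unfolding Suc limit_cov_covar .
qed

lemma cond_var_eq: "cond_var N m f x = (\<Sum>i\<in>{1..N}. covar (law N m x i) f f) / real N"
  by (simp add: cond_var_def covar_def power2_eq_square)

lemma cond_var_measurable: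
  assumes N: "N \<ge> 1" and f: "f \<in> bounded_meas (E m)"
  shows "cond_var N m f \<in> borel_measurable (traj N m)"
proof -
  have fm: "f \<in> borel_measurable (E m)" "(\<lambda>y. f y * f y) \<in> borel_measurable (E m)"
    using f by (auto simp: bounded_meas_def)
  have "(\<lambda>x. (\<Sum>i\<in>{1..N}. (\<integral>y. f y * f y \<partial>law N m x i) - (\<integral>y. f y \<partial>law N m x i) * (\<integral>y. f y \<partial>law N m x i)) / real N)
      \<in> borel_measurable (traj N m)"
    by (intro borel_measurable_divide borel_measurable_sum borel_measurable_diff borel_measurable_times
        law_integral_measurable N fm borel_measurable_const)
  also have "?this \<longleftrightarrow> ?thesis"
    using covar_eq[OF law_Prob[OF N] f f] unfolding cond_var_eq
    by (intro measurable_cong arg_cong[where f="\<lambda>x. x / _"] sum.cong) auto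
  finally show ?thesis .
qed

text \<open>Both terms become integrals with respect to \<open>Phi K (Suc p) \<mu>\<close> and
  \<mu>. Set against \<open>limit_cov_Suc\<close>, the distance to the limit splits into a deviation
  of \<open>Phi\<close>, a change of kernel and a deviation of the empirical measure.\<close>

lemma cond_var_Suc:
  assumes N: "N \<ge> 1" and x: "x p \<in> space (conf N p)" and f: "f \<in> bounded_meas (E (Suc p))"
  defines "\<mu> \<equiv> empirical (E p) N (x p)"
  shows "cond_var N (Suc p) f x = (\<integral>y. f y * f y \<partial>Phi K (Suc p) \<mu>)
     - (\<integral>z. (\<integral>y. f y \<partial>K (Suc p) \<mu> z) * (\<integral>y. f y \<partial>K (Suc p) \<mu> z) \<partial>\<mu>)"
proof -
  have \<mu>: "\<mu> \<in> Prob p" unfolding \<mu>_def by (rule empirical_Prob[OF N x])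
  have "cond_var N (Suc p) f x = (\<Sum>i\<in>{1..N}. (\<integral>y. f y * f y \<partial>K (Suc p) \<mu> (x p i))
      - (\<integral>y. f y \<partial>K (Suc p) \<mu> (x p i)) * (\<integral>y. f y \<partial>K (Suc p) \<mu> (x p i))) / real N"
    unfolding cond_var_eq law.simps \<mu>_def[symmetric]
    using covar_eq[OF kernel_Prob[OF \<mu> space_conf[OF x]] f f]
    by (intro arg_cong[where f="\<lambda>x. x / _"] sum.cong) auto
  also have "\<dots> = (\<integral>y. f y * f y \<partial>Phi K (Suc p) \<mu>)
     - (\<integral>z. (\<integral>y. f y \<partial>K (Suc p) \<mu> z) * (\<integral>y. f y \<partial>K (Suc p) \<mu> z) \<partial>\<mu>)"
  proof -
    have "(\<lambda>z. (\<integral>y. f y \<partial>K (Suc p) \<mu> z) * (\<integral>y. f y \<partial>K (Suc p) \<mu> z)) \<in> borel_measurable (E p)"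
      using bounded_meas_mult[OF kernel_integral_bounded[OF \<mu> f] kernel_integral_bounded[OF \<mu> f]]
      by (simp add: bounded_meas_def)
    from integral_empirical[OF x this] law_integral_sum[of N x p, OF N x bounded_meas_mult[OF f f]]
    show ?thesis unfolding \<mu>_def law.simps by (simp add: sum_subtractf diff_divide_distrib)
  qed
  finally show ?thesis .
qed

lemma limit_cov_Suc:
  assumes f: "f \<in> bounded_meas (E (Suc p))"
  defines "\<eta> \<equiv> flow K \<eta>0 p"
  shows "limit_cov K \<eta>0 (Suc p) f f = (\<integral>y. f y * f y \<partial>Phi K (Suc p) \<eta>)
     - (\<integral>z. (\<integral>y. f y \<partial>K (Suc p) \<eta> z) * (\<integral>y. f y \<partial>K (Suc p) \<eta> z) \<partial>\<eta>)"
proof -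
  have \<eta>: "\<eta> \<in> Prob p" unfolding \<eta>_def by (rule flow_Prob)
  have "limit_cov K \<eta>0 (Suc p) f f = (\<integral>z. (\<integral>y. f y * f y \<partial>K (Suc p) \<eta> z)
     - (\<integral>y. f y \<partial>K (Suc p) \<eta> z) * (\<integral>y. f y \<partial>K (Suc p) \<eta> z) \<partial>\<eta>)"
    unfolding limit_cov_covar \<eta>_def[symmetric]
    using covar_eq[OF kernel_Prob[OF \<eta>] f f] Prob_space[OF \<eta>]
    by (intro Bochner_Integration.integral_cong) auto
  also have "\<dots> = (\<integral>z. (\<integral>y. f y * f y \<partial>K (Suc p) \<eta> z) \<partial>\<eta>)
     - (\<integral>z. (\<integral>y. f y \<partial>K (Suc p) \<eta> z) * (\<integral>y. f y \<partial>K (Suc p) \<eta> z) \<partial>\<eta>)"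
    by (intro Bochner_Integration.integral_diff Prob_integrable[OF \<eta>] kernel_integral_bounded[OF \<eta>] bounded_meas_mult f)
  finally show ?thesis by (simp only: integral_Phi[OF \<eta> bounded_meas_mult[OF f f]])
qed

end

context particle_sequence
begin

text \<open>The right-hand side in condition (K) does not depend on the point z, so a single mixture
  of deviations controls the kernels at all z simultaneously.\<close>

lemma kernel_dev_conc:
  assumes f: "f \<in> Osc1 (E (Suc p))"
  obtains Y where "conc p {Y}" "\<And>N x z. N \<ge> 1 \<Longrightarrow> x \<in> space (conf N p) \<Longrightarrow> z \<in> space (E p) \<Longrightarrow>
     \<bar>(\<integral>y. f y \<partial>K (Suc p) (empirical (E p) N x) z) - (\<integral>y. f y \<partial>K (Suc p) (flow K \<eta>0 p) z)\<bar> \<le> Y N x"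
proof -
  let ?\<eta> = "flow K \<eta>0 p"
  have \<eta>: "?\<eta> \<in> Prob p" by (rule flow_Prob)
  from cond_K[of p] obtain T and \<delta> :: ennreal where
    meas: "\<forall>\<eta>\<in>Prob p. \<forall>f\<in>Osc1 (E (Suc p)). function_measure (E p) (T \<eta> f)"
    and sup: "\<forall>\<mu>\<in>Prob p. \<forall>\<eta>\<in>Prob p. \<forall>f\<in>Osc1 (E (Suc p)).
           sup_norm (E p) (\<lambda>x. (\<integral>y. f y \<partial>K (Suc p) \<mu> x) - (\<integral>y. f y \<partial>K (Suc p) \<eta> x)) \<le>
             (\<integral>\<^sup>+ h. ennreal \<bar>(\<integral>x. h x \<partial>\<mu>) - (\<integral>x. h x \<partial>\<eta>)\<bar> \<partial>T \<eta> f)"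
    and Tb: "\<forall>f\<in>Osc1 (E (Suc p)).
           (SUP \<eta>\<in>Prob p. \<integral>\<^sup>+ h. osc (E p) h \<partial>T \<eta> f) \<le> osc (E (Suc p)) f * \<delta>"
    and del: "\<delta> < \<infinity>"
    unfolding cond_K_def by (elim conjE exE) (rule that; assumption)
  note meas = meas[rule_format, OF \<eta> f] and sup = sup[rule_format, OF _ \<eta> f] and Tb = Tb[rule_format, OF f]
  define B where "B = enn2real \<delta>"
  define \<psi> where "\<psi> N h x = dev p h N x" for N h x
  define w where "w h = enn2real (osc (E p) h)" for h
  have sp: "h \<in> bounded_meas (E p)" if "h \<in> space (T ?\<eta> f)" for h
    using meas that by (auto simp: function_measure_def)
  have we: "ennreal (w h) = osc (E p) h" if "h \<in> space (T ?\<eta> f)" for h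
    using osc_bounded_meas[OF sp[OF that]] by (simp add: w_def)
  have bnd: "0 \<le> \<psi> N h x \<and> \<psi> N h x \<le> w h" if "N \<ge> 1" "h \<in> space (T ?\<eta> f)" "x \<in> space (conf N p)" for N h x
    using dev_le_osc[OF that(1,3) sp[OF that(2)]] by (auto simp: \<psi>_def w_def dev_def)
  have mix: "mixture_of p (dev p ` Osc1 (E p)) B (T ?\<eta> f) \<psi> w"
    unfolding mixture_of_def
  proof (intro conjI allI impI ballI)
    have "osc (E p) \<in> borel_measurable (T ?\<eta> f)" using meas by (simp add: function_measure_def)
    then show "w \<in> borel_measurable (T ?\<eta> f)" unfolding w_def[abs_def] by measurable
    have "(\<integral>\<^sup>+h. ennreal (w h) \<partial>T ?\<eta> f) = (\<integral>\<^sup>+h. osc (E p) h \<partial>T ?\<eta> f)"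
      using we by (intro nn_integral_cong)
    also have "\<dots> \<le> (SUP \<eta>\<in>Prob p. \<integral>\<^sup>+ h. osc (E p) h \<partial>T \<eta> f)" by (rule SUP_upper[OF \<eta>])
    also have "\<dots> \<le> osc (E (Suc p)) f * \<delta>" by (rule Tb)
    also have "\<dots> \<le> 1 * \<delta>" using f by (intro mult_right_mono) (auto simp: Osc1_def)
    also have "\<dots> = ennreal B" using del by (simp add: B_def)
    finally show "(\<integral>\<^sup>+h. ennreal (w h) \<partial>T ?\<eta> f) \<le> ennreal B" .
    fix N :: nat assume N: "1 \<le> N"
    have ev: "(\<lambda>(h, x). h x) \<in> borel_measurable (T ?\<eta> f \<Otimes>\<^sub>M E p)" and ss: "space (T ?\<eta> f) \<subseteq> bounded_meas (E p)"
      using meas by (auto simp: function_measure_def)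
    have 1: "(\<lambda>z. \<integral>y. fst z y \<partial>empirical (E p) N (snd z)) \<in> borel_measurable (T ?\<eta> f \<Otimes>\<^sub>M conf N p)"
      using eval_empirical_measurable[OF ev ss] by (simp add: case_prod_unfold)
    have 2: "(\<lambda>z. \<integral>y. fst z y \<partial>?\<eta>) \<in> borel_measurable (T ?\<eta> f \<Otimes>\<^sub>M conf N p)"
      using measurable_compose[OF measurable_fst eval_integral_measurable[OF ev \<eta>]] .
    from 1 2 show "(\<lambda>(g, x). \<psi> N g x) \<in> borel_measurable (T ?\<eta> f \<Otimes>\<^sub>M conf N p)"
      unfolding \<psi>_def dev_def case_prod_unfold by measurable
    fix h x assume "h \<in> space (T ?\<eta> f)" "x \<in> space (conf N p)"
    then show "0 \<le> \<psi> N h x" "\<psi> N h x \<le> w h" using bnd[OF N] by auto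
  next
    fix h assume "h \<in> space (T ?\<eta> f)" "0 < w h"
    then show "\<exists>X\<in>dev p ` Osc1 (E p). \<forall>N\<ge>1. \<forall>x\<in>space (conf N p). \<psi> N h x / w h \<le> X N x"
      using dev_normalised[of h p] sp unfolding \<psi>_def w_def by blast
  qed
  show ?thesis
  proof (rule that[of "mixture (T ?\<eta> f) \<psi>"])
    have "0 \<le> B" by (simp add: B_def)
    from conc_mixture[OF conc_dev this, of "{()}" p "\<lambda>_. T ?\<eta> f" "\<lambda>_. \<psi>" "\<lambda>_. w"] mix
    show "conc p {mixture (T ?\<eta> f) \<psi>}" by simp
    fix N :: nat and x z assume N: "N \<ge> 1" and x: "x \<in> space (conf N p)" and z: "z \<in> space (E p)"
    let ?\<mu> = "empirical (E p) N x"
    have \<mu>: "?\<mu> \<in> Prob p" by (rule empirical_Prob[OF N x])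
    have "(\<integral>\<^sup>+h. ennreal (\<psi> N h x) \<partial>T ?\<eta> f) \<le> (\<integral>\<^sup>+h. ennreal (w h) \<partial>T ?\<eta> f)"
      using bnd[OF N _ x] by (intro nn_integral_mono ennreal_leI) auto
    also have "\<dots> < top" using mix by (auto simp: mixture_of_def intro: le_less_trans)
    finally have fin: "(\<integral>\<^sup>+h. ennreal (\<psi> N h x) \<partial>T ?\<eta> f) < top" .
    have "ennreal \<bar>(\<integral>y. f y \<partial>K (Suc p) ?\<mu> z) - (\<integral>y. f y \<partial>K (Suc p) ?\<eta> z)\<bar>
        \<le> sup_norm (E p) (\<lambda>z. (\<integral>y. f y \<partial>K (Suc p) ?\<mu> z) - (\<integral>y. f y \<partial>K (Suc p) ?\<eta> z))"
      unfolding sup_norm_def by (rule SUP_upper[OF z])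
    also have "\<dots> \<le> (\<integral>\<^sup>+h. ennreal (\<psi> N h x) \<partial>T ?\<eta> f)"
      using sup[OF \<mu>] by (simp add: \<psi>_def dev_def)
    finally show "\<bar>(\<integral>y. f y \<partial>K (Suc p) ?\<mu> z) - (\<integral>y. f y \<partial>K (Suc p) ?\<eta> z)\<bar> \<le> mixture (T ?\<eta> f) \<psi> N x"
      using fin unfolding mixture_def by (metis abs_ge_zero enn2real_ennreal enn2real_mono)
  qed
qed

text \<open>Three errors add up: the deviation of \<open>Phi\<close> on the square of f; the change
  of the squared kernel mean when the kernel at the empirical measure is replaced by the one at the
  limit; and the deviation of the empirical measure on the limiting squared kernel mean. At time 0
  the conditional variance equals its limit.\<close>

lemma cond_var_conc:
  assumes f: "f \<in> bounded_meas (E m)"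
  obtains C c where "0 \<le> C" "0 \<le> c" "\<And>N t. N \<ge> 1 \<Longrightarrow> 0 \<le> t \<Longrightarrow>
    (\<integral>\<^sup>+\<omega>. ennreal (exp (t * \<bar>cond_var N m f (\<lambda>k. \<xi> N k \<omega>) - limit_cov K \<eta>0 m f f\<bar>)) \<partial>M N)
      \<le> ennreal (C * exp (c * t\<^sup>2 / real N))"
proof (cases m)
  case 0
  show ?thesis
  proof (rule that[of 1 0])
    fix N :: nat and t :: real assume N: "N \<ge> 1"
    then interpret P: particles E K \<eta>0 N "M N" "\<xi> N" by (rule particles)
    show "(\<integral>\<^sup>+\<omega>. ennreal (exp (t * \<bar>cond_var N m f (\<lambda>k. \<xi> N k \<omega>) - limit_cov K \<eta>0 m f f\<bar>)) \<partial>M N)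
        \<le> ennreal (1 * exp (0 * t\<^sup>2 / real N))"
      using N by (simp add: 0 cond_var_eq limit_cov_covar del: limit_cov.simps) (simp add: P.emeasure_space_1)
  qed auto
next
  case (Suc p)
  from f Suc have f: "f \<in> bounded_meas (E (Suc p))" by simp
  obtain b0 where "f \<in> borel_measurable (E (Suc p))" "0 \<le> b0" "\<And>x. x \<in> space (E (Suc p)) \<Longrightarrow> \<bar>f x\<bar> \<le> b0"
    using f by (rule bounded_measE) blast
  \<comment> \<open>A bound of at least 1 keeps the divisors below positive.\<close>
  then obtain b where fm: "f \<in> borel_measurable (E (Suc p))" and b1: "1 \<le> b"
    and b: "\<And>x. x \<in> space (E (Suc p)) \<Longrightarrow> \<bar>f x\<bar> \<le> b"
    using that[of "b0 + 1"] by (metis add_increasing2 le_add_same_cancel2 order_trans zero_le_one)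
  let ?\<eta> = "flow K \<eta>0 p"
  have \<eta>: "?\<eta> \<in> Prob p" by (rule flow_Prob)
  define h where "h \<mu> z = (\<integral>y. f y \<partial>K (Suc p) \<mu> z)" for \<mu> z
  have hb: "\<bar>h \<mu> z\<bar> \<le> b" if "\<mu> \<in> Prob p" "z \<in> space (E p)" for \<mu> z
    unfolding h_def by (rule Prob_integral_bound[OF kernel_Prob[OF that] fm b])
  have hm: "h \<mu> \<in> bounded_meas (E p)" if "\<mu> \<in> Prob p" for \<mu>
    unfolding h_def[abs_def] by (rule kernel_integral_bounded[OF that f])
  \<comment> \<open>F, G and H are the square of f, f itself and the squared limiting kernel mean,
    each divided by a bound of its oscillation so as to lie in \<open>Osc1\<close>.\<close>
  define F where "F y = f y * f y / (2 * b\<^sup>2)" for y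
  define G where "G y = f y / (2 * b)" for y
  define H where "H z = h ?\<eta> z * h ?\<eta> z / (2 * b\<^sup>2)" for z
  have sq: "\<bar>a * a - c * c\<bar> \<le> 2 * b\<^sup>2" if "\<bar>a\<bar> \<le> b" "\<bar>c\<bar> \<le> b" for a c :: real
  proof -
    have "a\<^sup>2 \<le> b\<^sup>2" "c\<^sup>2 \<le> b\<^sup>2" using that b1 by (auto simp: abs_le_square_iff[symmetric])
    moreover have "0 \<le> a\<^sup>2" "0 \<le> c\<^sup>2" by auto
    ultimately show ?thesis unfolding power2_eq_square[symmetric] by linarith
  qed
  have F: "F \<in> Osc1 (E (Suc p))" unfolding F_def[abs_def]
    using fm b1 b by (intro Osc1_divide sq) auto
  have H: "H \<in> Osc1 (E p)" unfolding H_def[abs_def]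
    using hm[OF \<eta>] b1 hb[OF \<eta>] by (intro Osc1_divide sq) (auto simp: bounded_meas_def)
  have "\<bar>f x - f y\<bar> \<le> 2 * b" if "x \<in> space (E (Suc p))" "y \<in> space (E (Suc p))" for x y
    using b[OF that(1)] b[OF that(2)] by linarith
  then have G: "G \<in> Osc1 (E (Suc p))" unfolding G_def[abs_def]
    using fm b1 by (intro Osc1_divide) auto
  obtain Y where Y: "conc p {Y}" "\<And>N x z. N \<ge> 1 \<Longrightarrow> x \<in> space (conf N p) \<Longrightarrow> z \<in> space (E p) \<Longrightarrow>
     \<bar>(\<integral>y. G y \<partial>K (Suc p) (empirical (E p) N x) z) - (\<integral>y. G y \<partial>K (Suc p) ?\<eta> z)\<bar> \<le> Y N x"
    using kernel_dev_conc[OF G] by blast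
  let ?lim = "limit_cov K \<eta>0 (Suc p) f f"
  \<comment> \<open>The three errors are added in two rounds, since \<open>conc_combine\<close>
    joins two families at a time. The factor \<open>4 * b^2\<close> comes from
    \<open>a^2 - c^2 = (a + c) * (a - c)\<close>: the sum is at most \<open>2 * b\<close>, the
    difference at most \<open>2 * b * Y N x\<close>.\<close>
  define Z1 where "Z1 N x = 2 * b\<^sup>2 * Phi_dev p F N x + 4 * b\<^sup>2 * Y N x" for N x
  \<comment> \<open>The conditional variance at time \<open>Suc p\<close> reads the trajectory only
    at time p, so a constant trajectory can stand in for it.\<close>
  define Z where "Z N x = \<bar>cond_var N (Suc p) f (\<lambda>_. x) - ?lim\<bar>" for N x
  have "conc p {Z1}"
  proof (rule conc_combine[OF conc_Phi_dev[OF conc_dev] Y(1), of "2 * b\<^sup>2" "4 * b\<^sup>2"])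
    show "\<exists>X\<in>Phi_dev p ` Osc1 (E (Suc p)). \<exists>Ya\<in>{Y}. \<forall>N\<ge>1. \<forall>x\<in>space (conf N p).
        W N x \<le> 2 * b\<^sup>2 * X N x + 4 * b\<^sup>2 * Ya N x" if "W \<in> {Z1}" for W
      using that F by (intro bexI[of _ "Phi_dev p F"] bexI[of _ Y]) (auto simp: Z1_def)
    show "W N \<in> borel_measurable (conf N p)" if W: "W \<in> {Z1}" and N: "N \<ge> 1" for W N
    proof -
      have "Y N \<in> borel_measurable (conf N p)" using Y(1) N unfolding conc_def by blast
      with Phi_dev_measurable[OF N Osc1_bounded_meas[OF F]] W show ?thesis
        unfolding Z1_def[abs_def] by simp
    qed
  qed (use b1 in auto)
  then have "conc p {Z}"
  proof (rule conc_combine[OF _ conc_dev[of p], of _ 1 "2 * b\<^sup>2"])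
    show "W N \<in> borel_measurable (conf N p)" if W: "W \<in> {Z}" and N: "N \<ge> 1" for W N
    proof -

      have ff: "(\<lambda>y. f y * f y) \<in> borel_measurable (E (Suc p))" using fm by simp
      have "(\<lambda>x. \<bar>(\<Sum>i\<in>{1..N}. (\<integral>y. f y * f y \<partial>K (Suc p) (empirical (E p) N x) (x i))
          - (\<integral>y. f y \<partial>K (Suc p) (empirical (E p) N x) (x i)) * (\<integral>y. f y \<partial>K (Suc p) (empirical (E p) N x) (x i))) / real N - ?lim\<bar>)
        \<in> borel_measurable (conf N p)"
        by (intro borel_measurable_abs borel_measurable_divide borel_measurable_sum borel_measurable_diff
            borel_measurable_times conf_law_integral_measurable N fm ff borel_measurable_const)
      also have "?this \<longleftrightarrow> Z N \<in> borel_measurable (conf N p)"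
        unfolding Z_def cond_var_eq law.simps
        using covar_eq[OF kernel_Prob[OF empirical_Prob[OF N] space_conf[of _ N]] f f]
        by (intro measurable_cong arg_cong[where f="\<lambda>x. \<bar>x / _ - _\<bar>"] sum.cong) auto
      finally show ?thesis using W by simp
    qed
    show "\<exists>X\<in>{Z1}. \<exists>Ya\<in>dev p ` Osc1 (E p). \<forall>N\<ge>1. \<forall>x\<in>space (conf N p).
        W N x \<le> 1 * X N x + 2 * b\<^sup>2 * Ya N x" if "W \<in> {Z}" for W
    proof (rule bexI[of _ Z1], rule bexI[of _ "dev p H"], intro allI impI ballI)
      fix N :: nat and x assume N: "N \<ge> 1" and x: "x \<in> space (conf N p)"
      let ?\<mu> = "empirical (E p) N x"
      have \<mu>: "?\<mu> \<in> Prob p" by (rule empirical_Prob[OF N x])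
      interpret m: prob_space ?\<mu> using \<mu> by (rule Prob_prob_space)
      have cv: "cond_var N (Suc p) f (\<lambda>_. x) = (\<integral>y. f y * f y \<partial>Phi K (Suc p) ?\<mu>) - (\<integral>z. h ?\<mu> z * h ?\<mu> z \<partial>?\<mu>)"
        using cond_var_Suc[OF N _ f, of "\<lambda>_. x"] x by (simp add: h_def)
      have lc: "?lim = (\<integral>y. f y * f y \<partial>flow K \<eta>0 (Suc p)) - (\<integral>z. h ?\<eta> z * h ?\<eta> z \<partial>?\<eta>)"
        using limit_cov_Suc[OF f] by (simp add: h_def)
      have 1: "2 * b\<^sup>2 * Phi_dev p F N x = \<bar>(\<integral>y. f y * f y \<partial>Phi K (Suc p) ?\<mu>) - (\<integral>y. f y * f y \<partial>flow K \<eta>0 (Suc p))\<bar>"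
        using b1 by (simp add: Phi_dev_def F_def diff_divide_distrib[symmetric] abs_divide)
      have 2: "2 * b\<^sup>2 * dev p H N x = \<bar>(\<integral>z. h ?\<eta> z * h ?\<eta> z \<partial>?\<mu>) - (\<integral>z. h ?\<eta> z * h ?\<eta> z \<partial>?\<eta>)\<bar>"
        using b1 by (simp add: dev_def H_def diff_divide_distrib[symmetric] abs_divide)
      have hh: "\<bar>h ?\<mu> z * h ?\<mu> z - h ?\<eta> z * h ?\<eta> z\<bar> \<le> 4 * b\<^sup>2 * Y N x" if z: "z \<in> space (E p)" for z
      proof -
        have "\<bar>h ?\<mu> z - h ?\<eta> z\<bar> = 2 * b * \<bar>(\<integral>y. G y \<partial>K (Suc p) ?\<mu> z) - (\<integral>y. G y \<partial>K (Suc p) ?\<eta> z)\<bar>"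
          using b1 by (simp add: h_def G_def diff_divide_distrib[symmetric] abs_divide)
        also have "\<dots> \<le> 2 * b * Y N x" using Y(2)[OF N x z] b1 by (intro mult_left_mono) auto
        finally have d: "\<bar>h ?\<mu> z - h ?\<eta> z\<bar> \<le> 2 * b * Y N x" .
        have s: "\<bar>h ?\<mu> z + h ?\<eta> z\<bar> \<le> 2 * b" using hb[OF \<mu> z] hb[OF \<eta> z] by linarith
        have "h ?\<mu> z * h ?\<mu> z - h ?\<eta> z * h ?\<eta> z = (h ?\<mu> z + h ?\<eta> z) * (h ?\<mu> z - h ?\<eta> z)"
          by (simp add: algebra_simps)
        then have "\<bar>h ?\<mu> z * h ?\<mu> z - h ?\<eta> z * h ?\<eta> z\<bar> = \<bar>h ?\<mu> z + h ?\<eta> z\<bar> * \<bar>h ?\<mu> z - h ?\<eta> z\<bar>"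
          by (simp add: abs_mult)
        also have "\<dots> \<le> 2 * b * (2 * b * Y N x)" using s d b1 by (intro mult_mono) auto
        finally show ?thesis by (simp add: power2_eq_square)
      qed
      have i: "integrable ?\<mu> (\<lambda>z. h \<nu> z * h \<nu> z)" if "\<nu> \<in> Prob p" for \<nu>
        by (intro Prob_integrable[OF \<mu>] bounded_meas_mult hm that)
      have "(\<integral>z. h ?\<mu> z * h ?\<mu> z \<partial>?\<mu>) - (\<integral>z. h ?\<eta> z * h ?\<eta> z \<partial>?\<mu>) = (\<integral>z. h ?\<mu> z * h ?\<mu> z - h ?\<eta> z * h ?\<eta> z \<partial>?\<mu>)"
        using i[OF \<mu>] i[OF \<eta>] by simp
      also have "\<bar>\<dots>\<bar> \<le> 4 * b\<^sup>2 * Y N x"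
        using hh bounded_meas_mult[OF hm[OF \<mu>] hm[OF \<mu>]] bounded_meas_mult[OF hm[OF \<eta>] hm[OF \<eta>]]
        by (intro Prob_integral_bound[OF \<mu>]) (auto simp: bounded_meas_def)
      finally have 3: "\<bar>(\<integral>z. h ?\<mu> z * h ?\<mu> z \<partial>?\<mu>) - (\<integral>z. h ?\<eta> z * h ?\<eta> z \<partial>?\<mu>)\<bar> \<le> 4 * b\<^sup>2 * Y N x" .
      have "Z N x \<le> Z1 N x + 2 * b\<^sup>2 * dev p H N x"
        unfolding Z_def Z1_def cv lc 1 2 using 3 by linarith
      then show "W N x \<le> 1 * Z1 N x + 2 * b\<^sup>2 * dev p H N x" using that by simp
    qed (use H in auto)
  qed (use b1 in auto)
  then obtain C c where C: "1 \<le> C" "0 \<le> c"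
    "\<And>X N t. X \<in> {Z} \<Longrightarrow> N \<ge> 1 \<Longrightarrow> 0 \<le> t \<Longrightarrow>
      (\<integral>\<^sup>+\<omega>. ennreal (exp (t * X N (\<xi> N p \<omega>))) \<partial>M N) \<le> ennreal (C * exp (c * t\<^sup>2 / real N))"
    by (rule concE) blast
  have "Z N (\<xi> N p \<omega>) = \<bar>cond_var N m f (\<lambda>k. \<xi> N k \<omega>) - limit_cov K \<eta>0 m f f\<bar>" for N \<omega>
    by (simp add: Z_def Suc cond_var_eq del: limit_cov.simps)
  with C show ?thesis using that[of C c] by simp
qed

end

section \<open>The limit of the Laplace transforms\<close>

text \<open>A factor \<open>exp (\<alpha> N * (v + o(1)))\<close> adds v to the rate. It is used for
  the Gaussian factor that the last time step contributes.\<close>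

lemma exp_rate_shift:
  assumes r: "exp_rate \<alpha> L \<Lambda>" and \<alpha>: "\<forall>\<^sub>F N in sequentially. 0 \<le> \<alpha> N" and d: "\<delta> \<longlonglongrightarrow> 0"
    and b: "\<forall>\<^sub>F N in sequentially. exp (\<alpha> N * (v - \<delta> N)) * L N \<le> L' N \<and> L' N \<le> exp (\<alpha> N * (v + \<delta> N)) * L N"
  shows "exp_rate \<alpha> L' (\<Lambda> + v)"
  unfolding exp_rate_def
proof (intro allI impI)
  fix \<epsilon> :: real assume e: "0 < \<epsilon>"
  have "\<forall>\<^sub>F N in sequentially. \<delta> N < \<epsilon> / 2" using e by (intro order_tendstoD(2)[OF d]) simp
  moreover have "\<forall>\<^sub>F N in sequentially. exp (\<alpha> N * (\<Lambda> - \<epsilon> / 2)) \<le> L N \<and> L N \<le> exp (\<alpha> N * (\<Lambda> + \<epsilon> / 2))"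
    using r e unfolding exp_rate_def by simp
  ultimately show "\<forall>\<^sub>F N in sequentially. exp (\<alpha> N * (\<Lambda> + v - \<epsilon>)) \<le> L' N \<and> L' N \<le> exp (\<alpha> N * (\<Lambda> + v + \<epsilon>))"
    using \<alpha> b
  proof eventually_elim
    case (elim N)
    have "\<alpha> N * (\<Lambda> + v - \<epsilon>) \<le> \<alpha> N * ((v - \<delta> N) + (\<Lambda> - \<epsilon> / 2))"
      using elim by (intro mult_left_mono) auto
    then have "exp (\<alpha> N * (\<Lambda> + v - \<epsilon>)) \<le> exp (\<alpha> N * (v - \<delta> N)) * exp (\<alpha> N * (\<Lambda> - \<epsilon> / 2))"
      by (simp only: exp_add[symmetric] distrib_left[symmetric] exp_le_cancel_iff)
    also have "\<dots> \<le> exp (\<alpha> N * (v - \<delta> N)) * L N" using elim by (intro mult_left_mono) auto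
    also have "\<dots> \<le> L' N" using elim by simp
    finally have lo: "exp (\<alpha> N * (\<Lambda> + v - \<epsilon>)) \<le> L' N" .
    have "L' N \<le> exp (\<alpha> N * (v + \<delta> N)) * L N" using elim by simp
    also have "\<dots> \<le> exp (\<alpha> N * (v + \<delta> N)) * exp (\<alpha> N * (\<Lambda> + \<epsilon> / 2))" using elim by (intro mult_left_mono) auto
    also have "\<dots> \<le> exp (\<alpha> N * (\<Lambda> + v + \<epsilon>))"
    proof -
      have "\<alpha> N * ((v + \<delta> N) + (\<Lambda> + \<epsilon> / 2)) \<le> \<alpha> N * (\<Lambda> + v + \<epsilon>)"
        using elim by (intro mult_left_mono) auto
      then show ?thesis by (simp only: exp_add[symmetric] distrib_left[symmetric] exp_le_cancel_iff)
    qed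
    finally show ?case using lo by simp
  qed
qed

context mean_field
begin

text \<open>Makes the earlier fluctuations admissible as weights depending on the past. Since
  \<open>law N p\<close> is measurable on \<open>traj N p\<close>, the longer trajectory is first
  restricted.\<close>

lemma fluct_sum_traj_measurable:
  assumes N: "N \<ge> 1" and p: "p < m" and f: "f \<in> borel_measurable (E p)"
  shows "(\<lambda>x. fluct_sum N p x f) \<in> borel_measurable (traj N m)"
proof -
  have r: "(\<lambda>x. restrict x {..<p}) \<in> traj N m \<rightarrow>\<^sub>M traj N p"
    using p by (intro measurable_restrict_subset) auto
  have l: "law N p (restrict x {..<p}) = law N p x" for x by (intro ext law_cong) simp
  have "fluct_sum N p x f = (\<Sum>i\<in>{1..N}. f (x p i) - (\<integral>y. f y \<partial>law N p (restrict x {..<p}) i))" for x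
    by (simp only: fluct_sum_def l)
  note eq = this
  have c: "(\<lambda>x. x p) \<in> traj N m \<rightarrow>\<^sub>M conf N p" using p by (intro measurable_component_singleton) simp
  show ?thesis unfolding eq
    by (intro borel_measurable_sum borel_measurable_diff
        measurable_compose[OF c conf_component_measurable[OF _ f]]
        measurable_compose[OF r law_integral_measurable[OF N _ f]])
qed

text \<open>With \<open>s = sqrt (\<alpha> N / real N)\<close> the main term is
  \<open>\<alpha> N / 2\<close> times the conditional variance, and the error
  \<open>real N * s^3 = \<alpha> N * s\<close> is of smaller order than
  \<open>\<alpha> N\<close>.\<close>

lemma cond_mgf_expansion:
  assumes N: "N \<ge> 1" and x: "x \<in> space (traj N m)" and f: "f \<in> borel_measurable (E m)"
    and b: "\<And>z. z \<in> space (E m) \<Longrightarrow> \<bar>f z\<bar> \<le> b" and s: "0 \<le> s" "4 * b * s \<le> 1"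
  shows "exp (real N * (s\<^sup>2 / 2 * cond_var N m f x - 24 * b ^ 3 * s ^ 3)) \<le> cond_mgf N m s f x"
    and "cond_mgf N m s f x \<le> exp (real N * (s\<^sup>2 / 2 * cond_var N m f x + 24 * b ^ 3 * s ^ 3))"
proof -
  have N0: "real N \<noteq> 0" using N by simp
  define v where "v i = (\<integral>y. (f y - (\<integral>z. f z \<partial>law N m x i))\<^sup>2 \<partial>law N m x i)" for i
  have e: "exp (s\<^sup>2 / 2 * v i - 24 * b ^ 3 * s ^ 3) \<le> (\<integral>y. exp (s * (f y - (\<integral>z. f z \<partial>law N m x i))) \<partial>law N m x i)
      \<and> (\<integral>y. exp (s * (f y - (\<integral>z. f z \<partial>law N m x i))) \<partial>law N m x i) \<le> exp (s\<^sup>2 / 2 * v i + 24 * b ^ 3 * s ^ 3)"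
    if i: "i \<in> {1..N}" for i
  proof -
    have l: "law N m x i \<in> Prob m" by (rule law_Prob[OF N i x])
    interpret prob_space "law N m x i" using l by (rule Prob_prob_space)
    show ?thesis unfolding v_def
      using centered_mgf_bounds[OF Prob_measurable[OF l f] b s] Prob_space[OF l] by simp
  qed
  have sum: "(\<Sum>i\<in>{1..N}. s\<^sup>2 / 2 * v i + c) = real N * (s\<^sup>2 / 2 * cond_var N m f x + c)" for c
    using N0 by (simp add: cond_var_def v_def[symmetric] sum.distrib sum_distrib_left[symmetric] sum_divide_distrib[symmetric] distrib_left)
  have "(\<Prod>i\<in>{1..N}. exp (s\<^sup>2 / 2 * v i + - (24 * b ^ 3 * s ^ 3))) \<le> cond_mgf N m s f x"
    unfolding cond_mgf_def using e by (intro prod_mono) auto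
  then show "exp (real N * (s\<^sup>2 / 2 * cond_var N m f x - 24 * b ^ 3 * s ^ 3)) \<le> cond_mgf N m s f x"
    unfolding exp_sum[OF finite_atLeastAtMost, symmetric] sum by simp
  have "cond_mgf N m s f x \<le> (\<Prod>i\<in>{1..N}. exp (s\<^sup>2 / 2 * v i + 24 * b ^ 3 * s ^ 3))"
    unfolding cond_mgf_def using e by (intro prod_mono) auto
  then show "cond_mgf N m s f x \<le> exp (real N * (s\<^sup>2 / 2 * cond_var N m f x + 24 * b ^ 3 * s ^ 3))"
    unfolding exp_sum[OF finite_atLeastAtMost, symmetric] sum .
qed

end

context particle_sequence
begin

lemma fluct_sum_xi_bound:
  assumes f: "f \<in> bounded_meas (E p)"
  obtains b where "0 \<le> b" "\<And>N \<omega>. N \<ge> 1 \<Longrightarrow> \<omega> \<in> space (M N) \<Longrightarrow> \<bar>fluct_sum N p (\<lambda>k. \<xi> N k \<omega>) f\<bar> \<le> b * real N"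
proof -
  obtain b where b: "f \<in> borel_measurable (E p)" "0 \<le> b" "\<And>x. x \<in> space (E p) \<Longrightarrow> \<bar>f x\<bar> \<le> b"
    using f by (rule bounded_measE) blast
  show ?thesis
  proof (rule that[of "2 * b"])
    fix N :: nat and \<omega> assume N: "N \<ge> 1" and w: "\<omega> \<in> space (M N)"
    interpret P: particles E K \<eta>0 N "M N" "\<xi> N" using N by (rule particles)
    show "\<bar>fluct_sum N p (\<lambda>k. \<xi> N k \<omega>) f\<bar> \<le> 2 * b * real N"
      unfolding P.fluct_sum_path by (rule fluct_sum_bound[OF N P.path_in[OF w] P.xi_in[OF w] b(1,3)])
  qed (use b in auto)
qed

text \<open>The exponent \<open>\<alpha> N * ip u (Z N \<omega>)\<close> of the Laplace transform:
  the fluctuation carries \<open>1 / sqrt (real N)\<close>, the moderate scaling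
  \<open>1 / sqrt (\<alpha> N)\<close>, which leaves \<open>sqrt (\<alpha> N / real N)\<close>. The
  sum covers the times before m.\<close>

definition log_weight :: "(nat \<Rightarrow> real) \<Rightarrow> nat \<Rightarrow> (nat \<Rightarrow> 'a \<Rightarrow> real) \<Rightarrow> nat \<Rightarrow> 'w \<Rightarrow> real" where
  "log_weight \<alpha> m f N \<omega> = (\<Sum>p<m. sqrt (\<alpha> N / real N) * fluct_sum N p (\<lambda>k. \<xi> N k \<omega>) (f p))"

lemma log_weight_measurable:
  assumes "\<And>p. p < m \<Longrightarrow> f p \<in> bounded_meas (E p)" and N: "N \<ge> 1"
  shows "log_weight \<alpha> m f N \<in> borel_measurable (M N)"
proof -
  interpret P: particles E K \<eta>0 N "M N" "\<xi> N" using N by (rule particles)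
  show ?thesis unfolding log_weight_def[abs_def] using assms(1)
    by (intro borel_measurable_sum borel_measurable_times P.fluct_sum_measurable borel_measurable_const)
      (auto simp: bounded_meas_def)
qed

lemma log_weight_bounded:
  assumes "\<And>p. p < m \<Longrightarrow> f p \<in> bounded_meas (E p)" and N: "N \<ge> 1"
  shows "\<exists>B. \<forall>\<omega>\<in>space (M N). \<bar>log_weight \<alpha> m f N \<omega>\<bar> \<le> B"
proof -
  have "\<exists>b. \<forall>\<omega>\<in>space (M N). \<bar>fluct_sum N p (\<lambda>k. \<xi> N k \<omega>) (f p)\<bar> \<le> b" if p: "p < m" for p
    using fluct_sum_xi_bound[OF assms(1)[OF p]] N by metis
  then obtain b where b: "\<And>p \<omega>. p < m \<Longrightarrow> \<omega> \<in> space (M N) \<Longrightarrow> \<bar>fluct_sum N p (\<lambda>k. \<xi> N k \<omega>) (f p)\<bar> \<le> b p"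
    by metis
  have "\<bar>log_weight \<alpha> m f N \<omega>\<bar> \<le> (\<Sum>p<m. \<bar>sqrt (\<alpha> N / real N)\<bar> * b p)" if "\<omega> \<in> space (M N)" for \<omega>
    unfolding log_weight_def using b that
    by (intro order_trans[OF sum_abs] sum_mono) (auto simp only: abs_mult lessThan_iff intro!: mult_left_mono)
  then show ?thesis by blast
qed

text \<open>The bounded term D makes room for the centred conditional variance that is added to the
  exponent in \<open>log_mgf_limit\<close>.\<close>

lemma integrable_exp_log_weight:
  assumes f: "\<And>p. p < m \<Longrightarrow> f p \<in> bounded_meas (E p)" and N: "N \<ge> 1"
    and D: "D \<in> borel_measurable (M N)" "\<And>\<omega>. \<omega> \<in> space (M N) \<Longrightarrow> \<bar>D \<omega>\<bar> \<le> d"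
  shows "integrable (M N) (\<lambda>\<omega>. exp (c * log_weight \<alpha> m f N \<omega> + D \<omega>))"
proof -
  interpret P: particles E K \<eta>0 N "M N" "\<xi> N" using N by (rule particles)
  note [measurable] = log_weight_measurable[OF f N] D(1)
  obtain B where B: "\<And>\<omega>. \<omega> \<in> space (M N) \<Longrightarrow> \<bar>log_weight \<alpha> m f N \<omega>\<bar> \<le> B"
    using log_weight_bounded[OF f N] by metis
  show ?thesis
  proof (rule P.integrable_bounded[where b="exp (\<bar>c\<bar> * B + d)"])
    fix \<omega> assume w: "\<omega> \<in> space (M N)"
    have "c * log_weight \<alpha> m f N \<omega> \<le> \<bar>c\<bar> * \<bar>log_weight \<alpha> m f N \<omega>\<bar>" by (metis abs_ge_self abs_mult)
    also have "\<dots> \<le> \<bar>c\<bar> * B" using B[OF w] by (intro mult_left_mono) auto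
    finally show "\<bar>exp (c * log_weight \<alpha> m f N \<omega> + D \<omega>)\<bar> \<le> exp (\<bar>c\<bar> * B + d)"
      using D(2)[OF w] by (simp add: abs_le_iff)
  qed measurable
qed

text \<open>With c = 2 this identifies the second moment of the weight as the first moment for
  doubled test functions.\<close>

lemma log_weight_scale: "log_weight \<alpha> m (\<lambda>p x. c * f p x) N \<omega> = c * log_weight \<alpha> m f N \<omega>"
  by (simp add: log_weight_def fluct_sum_def sum_distrib_left right_diff_distrib mult_ac)

text \<open>Integrating out the last time, given the past, turns its factor into the exponential of
  \<open>\<alpha> N / 2\<close> times the conditional variance, up to o(\<alpha> N). The limiting
  variance is split off as a deterministic factor, and the centred rest is a perturbation of the
  exponent of the earlier times.\<close>

lemma log_mgf_limit:
  assumes \<alpha>: "\<And>N. N \<ge> 1 \<Longrightarrow> \<alpha> N > 0" "filterlim \<alpha> at_top sequentially" "(\<lambda>N. \<alpha> N / real N) \<longlonglongrightarrow> 0"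
    and f: "\<And>p. p < m \<Longrightarrow> f p \<in> bounded_meas (E p)"
  shows "exp_rate \<alpha> (\<lambda>N. \<integral>\<omega>. exp (log_weight \<alpha> m f N \<omega>) \<partial>M N) (1/2 * (\<Sum>p<m. limit_cov K \<eta>0 p (f p) (f p)))"
  using f
proof (induction m arbitrary: f)
  case 0
  have "\<forall>\<^sub>F N in sequentially. exp (\<alpha> N * (0 - \<epsilon>)) \<le> (\<integral>\<omega>. exp (log_weight \<alpha> 0 f N \<omega>) \<partial>M N)
      \<and> (\<integral>\<omega>. exp (log_weight \<alpha> 0 f N \<omega>) \<partial>M N) \<le> exp (\<alpha> N * (0 + \<epsilon>))" if "\<epsilon> > 0" for \<epsilon>
    using eventually_ge_at_top[of 1]
  proof eventually_elim
    case (elim N)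
    interpret P: particles E K \<eta>0 N "M N" "\<xi> N" using elim by (rule particles)
    show ?case using \<alpha>(1)[OF elim] that by (simp add: log_weight_def P.prob_space)
  qed
  then show ?case by (simp add: exp_rate_def)
next
  case (Suc m)
  have fm: "f p \<in> bounded_meas (E p)" if "p < m" for p using Suc.prems that by simp
  have fM: "f m \<in> bounded_meas (E m)" using Suc.prems by simp
  obtain b where fmm: "f m \<in> borel_measurable (E m)" and b0: "0 \<le> b" and b: "\<And>x. x \<in> space (E m) \<Longrightarrow> \<bar>f m x\<bar> \<le> b"
    using fM by (rule bounded_measE) blast
  define \<Lambda> where "\<Lambda> = 1/2 * (\<Sum>p<m. limit_cov K \<eta>0 p (f p) (f p))"
  have \<Lambda>0: "0 \<le> \<Lambda>" by (simp add: \<Lambda>_def sum_nonneg limit_cov_nonneg)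
  have IH: "exp_rate \<alpha> (\<lambda>N. \<integral>\<omega>. exp (log_weight \<alpha> m f N \<omega>) \<partial>M N) \<Lambda>"
    unfolding \<Lambda>_def by (rule Suc.IH[OF fm])
  have fm2: "(\<lambda>x. 2 * f p x) \<in> bounded_meas (E p)" if "p < m" for p
    using bounded_meas_sum[of "{()}" "\<lambda>_. f p" p "\<lambda>_. 2"] fm[OF that] by simp
  define V where "V = limit_cov K \<eta>0 m (f m) (f m)"
  define cv where "cv N \<omega> = cond_var N m (f m) (\<lambda>k. \<xi> N k \<omega>)" for N \<omega>
  define S where "S = log_weight \<alpha> m f"
  \<comment> \<open>The exponent of the earlier times with the conditional variance of time m
    centred at its limit V. In this form \<open>exp_rate_perturb\<close> shows that Y has the same
    rate as S.\<close>
  define Y where "Y N \<omega> = S N \<omega> + \<alpha> N / 2 * (cv N \<omega> - V)" for N \<omega>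
  define X where "X N \<omega> = \<bar>cv N \<omega> - V\<bar>" for N \<omega>
  obtain C c where Cc: "0 \<le> C" "0 \<le> c" "\<And>N t. N \<ge> 1 \<Longrightarrow> 0 \<le> t \<Longrightarrow>
    (\<integral>\<^sup>+\<omega>. ennreal (exp (t * X N \<omega>)) \<partial>M N) \<le> ennreal (C * exp (c * t\<^sup>2 / real N))"
    unfolding X_def cv_def V_def using fM by (rule cond_var_conc) blast
  have cvp: "cv N \<omega> = cond_var N m (f m) (particles.path (\<xi> N) m \<omega>)" if N: "N \<ge> 1" for N \<omega>
  proof -
    interpret P: particles E K \<eta>0 N "M N" "\<xi> N" using N by (rule particles)
    show ?thesis by (simp add: cv_def cond_var_def P.law_path)
  qed
  have cvm: "cv N \<in> borel_measurable (M N)" if N: "N \<ge> 1" for N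
  proof -
    interpret P: particles E K \<eta>0 N "M N" "\<xi> N" using N by (rule particles)
    show ?thesis using measurable_compose[OF P.path_measurable cond_var_measurable[OF N fM]] cvp[OF N]
      by (simp cong: measurable_cong)
  qed
  have cvb: "\<bar>cv N \<omega>\<bar> \<le> (2 * b)\<^sup>2" if N: "N \<ge> 1" and w: "\<omega> \<in> space (M N)" for N \<omega>
  proof -
    interpret P: particles E K \<eta>0 N "M N" "\<xi> N" using N by (rule particles)
    let ?l = "law N m (P.path m \<omega>)"
    have "\<bar>\<integral>y. (f m y - (\<integral>z. f m z \<partial>?l i))\<^sup>2 \<partial>?l i\<bar> \<le> (2 * b)\<^sup>2" if i: "i \<in> {1..N}" for i
    proof (rule Prob_integral_bound[OF law_Prob[OF N i P.path_in[OF w]]])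
      show "(\<lambda>y. (f m y - (\<integral>z. f m z \<partial>?l i))\<^sup>2) \<in> borel_measurable (E m)" using fmm by measurable
      fix y assume y: "y \<in> space (E m)"
      have "\<bar>f m y - (\<integral>z. f m z \<partial>?l i)\<bar> \<le> 2 * b"
        using b[OF y] Prob_integral_bound[OF law_Prob[OF N i P.path_in[OF w]] fmm b] by linarith
      then show "\<bar>(f m y - (\<integral>z. f m z \<partial>?l i))\<^sup>2\<bar> \<le> (2 * b)\<^sup>2"
        using power_mono[of "\<bar>f m y - (\<integral>z. f m z \<partial>?l i)\<bar>" "2 * b" 2] by simp
    qed
    then have "\<bar>\<Sum>i\<in>{1..N}. \<integral>y. (f m y - (\<integral>z. f m z \<partial>?l i))\<^sup>2 \<partial>?l i\<bar> \<le> (\<Sum>i\<in>{1..N}. (2 * b)\<^sup>2)"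
      by (intro order_trans[OF sum_abs] sum_mono)
    then show ?thesis unfolding cvp[OF N] cond_var_def using N by (simp add: abs_divide divide_le_eq mult.commute)
  qed
  have intS: "integrable (M N) (\<lambda>\<omega>. exp (S N \<omega>))" "integrable (M N) (\<lambda>\<omega>. exp (2 * S N \<omega>))" if N: "N \<ge> 1" for N
    using integrable_exp_log_weight[OF fm N, where D="\<lambda>_. 0" and d=0 and c=1] integrable_exp_log_weight[OF fm N, where D="\<lambda>_. 0" and d=0 and c=2]
    by (auto simp: S_def)
  have intY: "integrable (M N) (\<lambda>\<omega>. exp (Y N \<omega>))" if N: "N \<ge> 1" for N
  proof -
    have bd: "\<bar>\<alpha> N / 2 * (cv N \<omega> - V)\<bar> \<le> \<alpha> N / 2 * ((2 * b)\<^sup>2 + \<bar>V\<bar>)" if w: "\<omega> \<in> space (M N)" for \<omega>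
      using cvb[OF N w] \<alpha>(1)[OF N] unfolding abs_mult by (intro mult_mono) auto
    have "(\<lambda>\<omega>. \<alpha> N / 2 * (cv N \<omega> - V)) \<in> borel_measurable (M N)" using cvm[OF N] by measurable
    from integrable_exp_log_weight[OF fm N this bd, where c=1] show ?thesis
      by (simp add: S_def Y_def)
  qed
  have rY: "exp_rate \<alpha> (\<lambda>N. \<integral>\<omega>. exp (Y N \<omega>) \<partial>M N) \<Lambda>"
  proof (rule exp_rate_perturb[OF \<alpha>(2,3), where S=S and X=X and C=C and c=c])
    show "prob_space (M N)" if N: "N \<ge> 1" for N
    proof -
      interpret P: particles E K \<eta>0 N "M N" "\<xi> N" using N by (rule particles)
      show ?thesis by unfold_locales
    qed
    show "0 \<le> X N \<omega> \<and> \<bar>Y N \<omega> - S N \<omega>\<bar> \<le> \<alpha> N * X N \<omega>" if N: "N \<ge> 1" for N \<omega>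
      using \<alpha>(1)[OF N] by (simp add: X_def Y_def abs_mult)
    show "X N \<in> borel_measurable (M N)" if N: "N \<ge> 1" for N
      unfolding X_def[abs_def] using cvm[OF N] by measurable
    show "exp_rate \<alpha> (\<lambda>N. \<integral>\<omega>. exp (S N \<omega>) \<partial>M N) \<Lambda>" using IH by (simp add: S_def)
    \<comment> \<open>The second moment required by the perturbation is the induction hypothesis for
      the doubled functions; hence the induction is over arbitrary f.\<close>
    show "exp_rate \<alpha> (\<lambda>N. \<integral>\<omega>. exp (2 * S N \<omega>) \<partial>M N) (1/2 * (\<Sum>p<m. limit_cov K \<eta>0 p (\<lambda>x. 2 * f p x) (\<lambda>x. 2 * f p x)))"
      using Suc.IH[OF fm2] unfolding log_weight_scale S_def .
  qed (use Cc intS intY \<Lambda>0 in auto)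
  \<comment> \<open>The tilt per particle. It satisfies
    \<open>real N * (s N)^2 = \<alpha> N\<close>, and since it tends to 0 the cubic error
    \<open>24 * b^3 * s N\<close> disappears from the rate.\<close>
  define s where "s N = sqrt (\<alpha> N / real N)" for N
  have s0: "s \<longlonglongrightarrow> 0" unfolding s_def[abs_def] using tendsto_real_sqrt[OF \<alpha>(3)] by simp
  have "exp_rate \<alpha> (\<lambda>N. \<integral>\<omega>. exp (log_weight \<alpha> (Suc m) f N \<omega>) \<partial>M N) (\<Lambda> + V / 2)"
  proof (rule exp_rate_shift[OF rY])
    show "\<forall>\<^sub>F N in sequentially. 0 \<le> \<alpha> N" using eventually_ge_at_top[of 1] by eventually_elim (simp add: \<alpha>(1) less_imp_le)
    show "(\<lambda>N. 24 * b ^ 3 * s N) \<longlonglongrightarrow> 0" using tendsto_mult_right_zero[OF s0] by simp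
    have "(\<lambda>N. 4 * b * s N) \<longlonglongrightarrow> 0" using tendsto_mult_right_zero[OF s0] by simp
    then have ev: "\<forall>\<^sub>F N in sequentially. 4 * b * s N < 1" by (rule order_tendstoD) simp
    show "\<forall>\<^sub>F N in sequentially. exp (\<alpha> N * (V / 2 - 24 * b ^ 3 * s N)) * (\<integral>\<omega>. exp (Y N \<omega>) \<partial>M N)
          \<le> (\<integral>\<omega>. exp (log_weight \<alpha> (Suc m) f N \<omega>) \<partial>M N)
        \<and> (\<integral>\<omega>. exp (log_weight \<alpha> (Suc m) f N \<omega>) \<partial>M N)
          \<le> exp (\<alpha> N * (V / 2 + 24 * b ^ 3 * s N)) * (\<integral>\<omega>. exp (Y N \<omega>) \<partial>M N)"
      using ev eventually_ge_at_top[of 1]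
    proof eventually_elim
      case (elim N)
      note N = elim(2)
      have N0: "real N > 0" using N by simp
      have a0: "\<alpha> N > 0" using \<alpha>(1)[OF N] .
      interpret P: particles E K \<eta>0 N "M N" "\<xi> N" using N by (rule particles)
      have sN: "0 \<le> s N" using a0 by (simp add: s_def)
      have "0 \<le> \<alpha> N / real N" using a0 by (simp add: zero_le_divide_iff)
      then have ss: "real N * (s N)\<^sup>2 = \<alpha> N" using N0 by (simp add: s_def)
      have sss: "real N * (s N) ^ 3 = \<alpha> N * s N"
        using ss by (simp add: power3_eq_cube power2_eq_square mult.assoc[symmetric])
      \<comment> \<open>The weight of the earlier times as a function on trajectories, the form
        expected by \<open>tilted_mgf\<close>.\<close>
      define g where "g x = exp (\<Sum>p<m. s N * fluct_sum N p x (f p))" for x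
      have gm: "g \<in> borel_measurable (traj N m)" unfolding g_def[abs_def]
        using fm by (intro borel_measurable_exp[THEN measurable_compose[rotated]] borel_measurable_sum
            borel_measurable_times borel_measurable_const fluct_sum_traj_measurable N) (auto simp: bounded_meas_def)
      have fsp: "fluct_sum N p (P.path m \<omega>) (f p) = fluct_sum N p (\<lambda>k. \<xi> N k \<omega>) (f p)" if "p < m" for p \<omega>
      proof -
        have "law N p (P.path m \<omega>) i = law N p (\<lambda>k. \<xi> N k \<omega>) i" for i
          using that by (intro law_cong) (simp add: P.path_def)
        then show ?thesis using that by (simp add: fluct_sum_def P.path_def)
      qed
      have gp: "g (P.path m \<omega>) = exp (S N \<omega>)" for \<omega>
        unfolding g_def S_def log_weight_def s_def[symmetric] using fsp by (intro arg_cong[where f=exp] sum.cong) auto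
      have eS: "exp (log_weight \<alpha> (Suc m) f N \<omega>) = exp (S N \<omega>) * exp (s N * fluct_sum N m (\<lambda>k. \<xi> N k \<omega>) (f m))" for \<omega>
        by (simp add: log_weight_def S_def s_def exp_add)
      have cb: "exp (Y N \<omega>) * exp (\<alpha> N * (V / 2 - 24 * b ^ 3 * s N)) \<le> exp (S N \<omega>) * cond_mgf N m (s N) (f m) (P.path m \<omega>)
        \<and> exp (S N \<omega>) * cond_mgf N m (s N) (f m) (P.path m \<omega>) \<le> exp (Y N \<omega>) * exp (\<alpha> N * (V / 2 + 24 * b ^ 3 * s N))"
        if w: "\<omega> \<in> space (M N)" for \<omega>
      proof -
        have 1: "real N * ((s N)\<^sup>2 / 2 * cv N \<omega> + k * (s N) ^ 3) = \<alpha> N / 2 * cv N \<omega> + k * (\<alpha> N * s N)" for k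
        proof -
          have "real N * ((s N)\<^sup>2 / 2 * cv N \<omega> + k * (s N) ^ 3) = real N * (s N)\<^sup>2 / 2 * cv N \<omega> + k * (real N * (s N) ^ 3)"
            by (simp add: algebra_simps)
          then show ?thesis by (simp only: ss sss)
        qed
        have 2: "exp (Y N \<omega>) * exp (\<alpha> N * (V / 2 + k * s N)) = exp (S N \<omega>) * exp (\<alpha> N / 2 * cv N \<omega> + k * (\<alpha> N * s N))" for k
        proof -
          have "Y N \<omega> + \<alpha> N * (V / 2 + k * s N) = S N \<omega> + (\<alpha> N / 2 * cv N \<omega> + k * (\<alpha> N * s N))"
            by (simp add: Y_def field_simps)
          then show ?thesis by (simp only: exp_add[symmetric])
        qed
        note e = cond_mgf_expansion[OF N P.path_in[OF w] fmm b sN less_imp_le[OF elim(1)], unfolded cvp[OF N, symmetric]]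
        have "exp (\<alpha> N / 2 * cv N \<omega> + - (24 * b ^ 3) * (\<alpha> N * s N)) \<le> cond_mgf N m (s N) (f m) (P.path m \<omega>)"
          using e(1) unfolding 1[symmetric] by simp
        moreover have "cond_mgf N m (s N) (f m) (P.path m \<omega>) \<le> exp (\<alpha> N / 2 * cv N \<omega> + 24 * b ^ 3 * (\<alpha> N * s N))"
          using e(2) unfolding 1[symmetric] .
        ultimately show ?thesis
          using 2[of "- (24 * b ^ 3)"] 2[of "24 * b ^ 3"] by simp
      qed
      define L where "L = (\<integral>\<omega>. exp (log_weight \<alpha> (Suc m) f N \<omega>) \<partial>M N)"
      have intL: "integrable (M N) (\<lambda>\<omega>. exp (log_weight \<alpha> (Suc m) f N \<omega>))"
        using integrable_exp_log_weight[OF Suc.prems N, where D="\<lambda>_. 0" and d=0 and c=1] by simp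
      have "ennreal L = (\<integral>\<^sup>+\<omega>. ennreal (exp (log_weight \<alpha> (Suc m) f N \<omega>)) \<partial>M N)"
        unfolding L_def by (rule nn_integral_eq_integral[symmetric, OF intL]) simp
      also have "\<dots> = (\<integral>\<^sup>+\<omega>. ennreal (g (P.path m \<omega>) * exp (s N * fluct_sum N m (\<lambda>k. \<xi> N k \<omega>) (f m))) \<partial>M N)"
        by (simp only: eS gp)
      also have "\<dots> = (\<integral>\<^sup>+\<omega>. ennreal (g (P.path m \<omega>) * cond_mgf N m (s N) (f m) (P.path m \<omega>)) \<partial>M N)"
        using intS(1)[OF N] by (intro P.tilted_mgf gm fM) (auto simp: gp, simp add: g_def)
      finally have L: "ennreal L = (\<integral>\<^sup>+\<omega>. ennreal (exp (S N \<omega>) * cond_mgf N m (s N) (f m) (P.path m \<omega>)) \<partial>M N)"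
        by (simp only: gp)
      have L0: "0 \<le> L" by (simp add: L_def)
      have EY: "0 \<le> (\<integral>\<omega>. exp (Y N \<omega>) \<partial>M N)" by simp
      have nnY: "(\<integral>\<^sup>+\<omega>. ennreal (exp (Y N \<omega>) * exp k) \<partial>M N) = ennreal (exp k * (\<integral>\<omega>. exp (Y N \<omega>) \<partial>M N))" for k
        using intY[OF N] by (subst nn_integral_eq_integral) (auto simp: mult.commute)
      have "ennreal (exp (\<alpha> N * (V / 2 - 24 * b ^ 3 * s N)) * (\<integral>\<omega>. exp (Y N \<omega>) \<partial>M N)) \<le> ennreal L"
        unfolding L nnY[symmetric] using cb by (intro nn_integral_mono ennreal_leI) blast
      moreover have "ennreal L \<le> ennreal (exp (\<alpha> N * (V / 2 + 24 * b ^ 3 * s N)) * (\<integral>\<omega>. exp (Y N \<omega>) \<partial>M N))"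
        unfolding L nnY[symmetric] using cb by (intro nn_integral_mono ennreal_leI) blast
      ultimately show ?case
        unfolding L_def[symmetric] using L0 EY by (simp only: ennreal_le_iff mult_nonneg_nonneg exp_ge_zero)
    qed
  qed
  then show ?case by (simp add: \<Lambda>_def V_def add_divide_distrib)
qed

end

section \<open>The moderate deviation principle\<close>

text \<open>Each \<open>F p\<close> reads only its own block of coordinates, so near-maximisers of
  the different blocks can be glued into one argument. The suprema may be infinite, hence the
  formulation in extended reals.\<close>

lemma sum_SUP_blocks:
  fixes F :: "'p \<Rightarrow> ('p \<times> 'i \<Rightarrow> real) \<Rightarrow> real" and A :: "'p \<Rightarrow> 'i set"
  assumes P: "finite P" and zero: "\<And>p. p \<in> P \<Longrightarrow> F p (\<lambda>_. 0) = 0"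
    and cong: "\<And>p u u'. p \<in> P \<Longrightarrow> (\<And>i. i \<in> A p \<Longrightarrow> u (p, i) = u' (p, i)) \<Longrightarrow> F p u = F p u'"
  shows "(\<Sum>p\<in>P. SUP u\<in>Sigma P A \<rightarrow>\<^sub>E UNIV. ereal (F p u)) = (SUP u\<in>Sigma P A \<rightarrow>\<^sub>E UNIV. ereal (\<Sum>p\<in>P. F p u))"
proof (rule antisym)
  let ?U = "Sigma P A \<rightarrow>\<^sub>E (UNIV :: real set)"
  have cond: "(\<lambda>(p, i)\<in>Sigma P A. if c p then u (p, i) else u' (p, i)) \<in> ?U" for c u u' by auto
  have F_if: "F p (\<lambda>(p, i)\<in>Sigma P A. if c p then u (p, i) else u' (p, i)) = (if c p then F p u else F p u')"
    if "p \<in> P" for p c u u'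
    using that by (auto intro: cong)
  have r0: "(\<lambda>_\<in>Sigma P A. 0) \<in> ?U" by auto
  have F0: "F p (\<lambda>_\<in>Sigma P A. 0) = 0" if "p \<in> P" for p
    using cong[OF that, of "\<lambda>_\<in>Sigma P A. 0" "\<lambda>_. 0"] zero[OF that] that by auto
  \<comment> \<open>The exchange of sum and supremum is available for nonnegative terms. Passing to
    \<open>max 0\<close> is harmless because a block with negative value can be replaced by the zero
    block, where \<open>F p\<close> is 0.\<close>
  have "(\<Sum>p\<in>P. SUP u\<in>?U. ereal (F p u)) \<le> (\<Sum>p\<in>P. SUP u\<in>?U. ereal (max 0 (F p u)))"
    by (intro sum_mono SUP_mono bexI) auto
  also have "\<dots> = (SUP u\<in>?U. \<Sum>p\<in>P. ereal (max 0 (F p u)))"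
  proof (rule SUP_ereal_sum_directed[symmetric])
    show "?U \<noteq> {}" using r0 by auto
    fix Q u u' assume Q: "Q \<subseteq> P" and u: "u \<in> ?U" "u' \<in> ?U"
    show "\<exists>k\<in>?U. \<forall>p\<in>Q. ereal (max 0 (F p u)) \<le> ereal (max 0 (F p k)) \<and> ereal (max 0 (F p u')) \<le> ereal (max 0 (F p k))"
    \<comment> \<open>Directedness: from u and u' the better one is taken in each block.\<close>
    proof (rule bexI[OF _ cond[of "\<lambda>p. F p u' \<le> F p u" u u']], rule ballI)
      fix p assume "p \<in> Q"
      with Q have p: "p \<in> P" by auto
      show "ereal (max 0 (F p u)) \<le> ereal (max 0 (F p (\<lambda>(p, i)\<in>Sigma P A. if F p u' \<le> F p u then u (p, i) else u' (p, i))))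
        \<and> ereal (max 0 (F p u')) \<le> ereal (max 0 (F p (\<lambda>(p, i)\<in>Sigma P A. if F p u' \<le> F p u then u (p, i) else u' (p, i))))"
        unfolding F_if[OF p, of "\<lambda>p. F p u' \<le> F p u" u u'] ereal_less_eq by auto
    qed
  qed (simp add: zero_ereal_def le_max_iff_disj)
  also have "\<dots> \<le> (SUP u\<in>?U. ereal (\<Sum>p\<in>P. F p u))"
  proof (rule SUP_least)
    fix u assume "u \<in> ?U"
    let ?k = "\<lambda>(p, i)\<in>Sigma P A. if 0 \<le> F p u then u (p, i) else (\<lambda>_\<in>Sigma P A. 0) (p, i)"
    have "(\<Sum>p\<in>P. ereal (max 0 (F p u))) = ereal (\<Sum>p\<in>P. max 0 (F p u))" by (rule sum_ereal)
    also have "(\<Sum>p\<in>P. max 0 (F p u)) = (\<Sum>p\<in>P. F p ?k)"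
    proof (rule sum.cong[OF refl])
      fix p assume p: "p \<in> P"
      show "max 0 (F p u) = F p ?k"
        unfolding F_if[OF p, of "\<lambda>p. 0 \<le> F p u" u "\<lambda>_\<in>Sigma P A. 0"] F0[OF p] by simp
    qed
    also have "\<dots> \<le> (SUP u\<in>?U. ereal (\<Sum>p\<in>P. F p u))"
      by (rule SUP_upper[OF cond])
    finally show "(\<Sum>p\<in>P. ereal (max 0 (F p u))) \<le> (SUP u\<in>?U. ereal (\<Sum>p\<in>P. F p u))" .
  qed
  finally show "(\<Sum>p\<in>P. SUP u\<in>?U. ereal (F p u)) \<le> (SUP u\<in>?U. ereal (\<Sum>p\<in>P. F p u))" .
  show "(SUP u\<in>?U. ereal (\<Sum>p\<in>P. F p u)) \<le> (\<Sum>p\<in>P. SUP u\<in>?U. ereal (F p u))"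
    unfolding sum_ereal[symmetric] by (intro SUP_least sum_mono SUP_upper)
qed

lemma centered_gaussian_square_integrable:
  assumes "prob_space \<Omega>" "centered_gaussian \<Omega> X"
  shows "integrable \<Omega> (\<lambda>\<omega>. (X \<omega>)\<^sup>2)"
proof -
  interpret prob_space \<Omega> by fact
  have [measurable]: "X \<in> borel_measurable \<Omega>" using assms by (simp add: centered_gaussian_def)
  from assms(2) consider \<sigma> where "\<sigma> > 0" "distributed \<Omega> lborel X (normal_density 0 \<sigma>)" | "AE \<omega> in \<Omega>. X \<omega> = 0"
    by (auto simp: centered_gaussian_def)
  then show ?thesis
  proof cases
    case 1
    have "integrable lborel (\<lambda>x. normal_density 0 \<sigma> x * (x - 0) ^ 2)"
      by (rule integrable_normal_moment[OF 1(1)])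
    then show ?thesis using distributed_integrable[OF 1(2), of "\<lambda>x. x\<^sup>2"] by simp
  next
    case 2
    have "integrable \<Omega> (\<lambda>\<omega>. 0 :: real)" by simp
    also have "?this \<longleftrightarrow> ?thesis" using 2 by (intro integrable_cong_AE) auto
    finally show ?thesis .
  qed
qed

text \<open>Identifies the second moment in \<open>rate\<close> with the quadratic form of
  \<open>limit_cov\<close>. Finite second moments of the Gaussian variables make the products
  integrable, so that the square may be multiplied out under the integral.\<close>

lemma limit_fields_second_moment:
  fixes g :: "'i \<Rightarrow> 'a \<Rightarrow> real"
  assumes lf: "limit_fields E K \<eta>0 \<Omega> V" and I: "finite I" and g: "\<And>i. i \<in> I \<Longrightarrow> g i \<in> bounded_meas (E p)"
  shows "(\<integral>\<omega>. (\<Sum>i\<in>I. u i * V p (g i) \<omega>)\<^sup>2 \<partial>\<Omega>) = (\<Sum>i\<in>I. \<Sum>j\<in>I. u i * u j * limit_cov K \<eta>0 p (g i) (g j))"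
proof -
  have \<Omega>: "prob_space \<Omega>" and gf: "centered_gaussian_field \<Omega> (bounded_meas (E p)) (V p)"
    and cov: "\<And>f g. f \<in> bounded_meas (E p) \<Longrightarrow> g \<in> bounded_meas (E p) \<Longrightarrow>
      (\<integral>\<omega>. V p f \<omega> * V p g \<omega> \<partial>\<Omega>) = limit_cov K \<eta>0 p f g"
    using lf by (auto simp: limit_fields_def)
  have cg: "centered_gaussian \<Omega> (V p (g i))" if "i \<in> I" for i
  proof -
    have "centered_gaussian \<Omega> (\<lambda>\<omega>. \<Sum>f\<in>{g i}. 1 * V p f \<omega>)"
      using gf g[OF that] unfolding centered_gaussian_field_def
      by (elim allE[of _ "{g i}"] allE[of _ "\<lambda>_. 1"]) auto
    then show ?thesis by simp
  qed
  have int: "integrable \<Omega> (\<lambda>\<omega>. V p (g i) \<omega> * V p (g j) \<omega>)" if ij: "i \<in> I" "j \<in> I" for i j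
  proof (rule Bochner_Integration.integrable_bound)
    show "integrable \<Omega> (\<lambda>\<omega>. (V p (g i) \<omega>)\<^sup>2 + (V p (g j) \<omega>)\<^sup>2)"
      using centered_gaussian_square_integrable[OF \<Omega> cg] ij by auto
    show "(\<lambda>\<omega>. V p (g i) \<omega> * V p (g j) \<omega>) \<in> borel_measurable \<Omega>"
      using cg[OF ij(1)] cg[OF ij(2)] by (auto simp: centered_gaussian_def)
    have "\<bar>a * b\<bar> \<le> a\<^sup>2 + b\<^sup>2" for a b :: real
    proof -
      have "2 * (\<bar>a\<bar> * \<bar>b\<bar>) \<le> a\<^sup>2 + b\<^sup>2" using sum_squares_bound[of "\<bar>a\<bar>" "\<bar>b\<bar>"] by (simp add: mult.assoc)
      moreover have "0 \<le> \<bar>a\<bar> * \<bar>b\<bar>" by simp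
      ultimately show ?thesis unfolding abs_mult by linarith
    qed
    then show "AE \<omega> in \<Omega>. norm (V p (g i) \<omega> * V p (g j) \<omega>) \<le> norm ((V p (g i) \<omega>)\<^sup>2 + (V p (g j) \<omega>)\<^sup>2)"
      by (intro AE_I2) simp
  qed
  have "(\<integral>\<omega>. (\<Sum>i\<in>I. u i * V p (g i) \<omega>)\<^sup>2 \<partial>\<Omega>) = (\<integral>\<omega>. (\<Sum>i\<in>I. \<Sum>j\<in>I. u i * u j * (V p (g i) \<omega> * V p (g j) \<omega>)) \<partial>\<Omega>)"
    by (simp add: power2_eq_square sum_product mult_ac)
  also have "\<dots> = (\<Sum>i\<in>I. \<Sum>j\<in>I. u i * u j * limit_cov K \<eta>0 p (g i) (g j))"
    using int by (simp add: cov[OF g g])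
  finally show ?thesis .
qed

theorem corollary2p6:
  fixes E :: "nat \<Rightarrow> 'a measure"
    and K :: "nat \<Rightarrow> 'a measure \<Rightarrow> 'a \<Rightarrow> 'a measure"
    and \<eta>0 :: "'a measure"
    and M :: "nat \<Rightarrow> 'w measure"
    and \<xi> :: "nat \<Rightarrow> nat \<Rightarrow> 'w \<Rightarrow> nat \<Rightarrow> 'a"
    and \<Omega> :: "'v measure"
    and V :: "nat \<Rightarrow> ('a \<Rightarrow> real) \<Rightarrow> 'v \<Rightarrow> real"
    and n :: nat
    and d :: "nat \<Rightarrow> nat"
    and f :: "nat \<Rightarrow> nat \<Rightarrow> 'a \<Rightarrow> real"
    and \<alpha> :: "nat \<Rightarrow> real"
  assumes "mean_field_model E K \<eta>0"
    and H1: "\<And>k. cond_K (E k) (E (Suc k)) (K (Suc k))"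
            "\<And>k. Upsilon (E k) (E (Suc k)) (Phi K (Suc k))"
    and "\<And>N. N \<ge> 1 \<Longrightarrow> particle_system E K \<eta>0 N (M N) (\<xi> N)"
    and "limit_fields E K \<eta>0 \<Omega> V"
    and "\<And>p. p \<le> n \<Longrightarrow> d p \<ge> 1"
    and "\<And>p i. p \<le> n \<Longrightarrow> i \<in> {1..d p} \<Longrightarrow> f p i \<in> bounded_meas (E p)"
    and "\<And>N. N \<ge> 1 \<Longrightarrow> \<alpha> N > 0"
    and "mono_on {1..} \<alpha>"
    and "filterlim \<alpha> at_top sequentially"
    and "(\<lambda>N. \<alpha> N / real N) \<longlonglongrightarrow> 0"
  shows "MDP (SIGMA p:{0..n}. {1..d p}) M
           (\<lambda>N \<omega>. \<lambda>(p, i). fluctuation E K \<eta>0 N (\<lambda>k. \<xi> N k \<omega>) p (f p i))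
           \<alpha>
           (\<lambda>v. \<Sum>p=0..n. rate \<Omega> (V p) (d p) (f p) (\<lambda>i\<in>{1..d p}. v (p, i)))"
proof -
  interpret particle_sequence E K \<eta>0 M \<xi>
    by unfold_locales (use assms in auto)
  note fb = assms(7)
  note apos = assms(8)
  define J where "J = (SIGMA p:{0..n}. {1..d p})"
  \<comment> \<open>Block diagonal in time: fluctuations at different times decouple in the
    limit.\<close>
  define S where "S = (\<lambda>(p, i) (q, j). if p = q then limit_cov K \<eta>0 p (f p i) (f p j) else 0)"
  define Z where "Z N \<omega> = (\<lambda>j\<in>J. (case j of (p, i) \<Rightarrow> fluctuation E K \<eta>0 N (\<lambda>k. \<xi> N k \<omega>) p (f p i)) / sqrt (\<alpha> N))" for N \<omega>
  define g where "g u p x = (\<Sum>i\<in>{1..d p}. u (p, i) * f p i x)" for u :: "nat \<times> nat \<Rightarrow> real" and p x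
  have finJ: "finite J" by (simp add: J_def)
  have gb: "g u p \<in> bounded_meas (E p)" if "p \<le> n" for u p
    unfolding g_def[abs_def] using fb that by (intro bounded_meas_sum) auto
  have SJ: "(\<Sum>x\<in>J. h x) = (\<Sum>p\<in>{0..n}. \<Sum>i\<in>{1..d p}. h (p, i))" for h :: "nat \<times> nat \<Rightarrow> real"
    unfolding J_def by (subst sum.Sigma) (auto intro: sum.cong)
  have mv: "mat_vec J S u (p, i) = (\<Sum>j\<in>{1..d p}. limit_cov K \<eta>0 p (f p i) (f p j) * u (p, j))" if "p \<le> n" for u p i
  proof -
    have "mat_vec J S u (p, i) = (\<Sum>q\<in>{0..n}. if p = q then (\<Sum>j\<in>{1..d q}. limit_cov K \<eta>0 p (f p i) (f p j) * u (q, j)) else 0)"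
      unfolding mat_vec_def SJ S_def by (intro sum.cong refl) auto
    also have "\<dots> = (\<Sum>j\<in>{1..d p}. limit_cov K \<eta>0 p (f p i) (f p j) * u (p, j))"
      using that by (subst sum.delta') auto
    finally show ?thesis .
  qed
  have quadratic: "inner_on J u (mat_vec J S u) = (\<Sum>p\<in>{0..n}. limit_cov K \<eta>0 p (g u p) (g u p))" for u
  proof -
    have "inner_on J u (mat_vec J S u)
        = (\<Sum>p\<in>{0..n}. \<Sum>i\<in>{1..d p}. \<Sum>j\<in>{1..d p}. u (p, i) * u (p, j) * limit_cov K \<eta>0 p (f p i) (f p j))"
      unfolding inner_on_def SJ using mv by (intro sum.cong refl) (simp add: sum_distrib_left mult_ac)
    also have "\<dots> = (\<Sum>p\<in>{0..n}. limit_cov K \<eta>0 p (g u p) (g u p))"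
    proof (rule sum.cong[OF refl])
      fix p assume "p \<in> {0..n}"
      then have "\<And>i. i \<in> {1..d p} \<Longrightarrow> f p i \<in> bounded_meas (E p)" using fb by simp
      from limit_cov_sum[OF finite_atLeastAtMost this, where c="\<lambda>i. u (p, i)"]
      show "(\<Sum>i\<in>{1..d p}. \<Sum>j\<in>{1..d p}. u (p, i) * u (p, j) * limit_cov K \<eta>0 p (f p i) (f p j)) = limit_cov K \<eta>0 p (g u p) (g u p)"
        unfolding g_def[abs_def] by simp
    qed
    finally show ?thesis .
  qed
  \<comment> \<open>By linearity the functions at time p merge into the single function
    \<open>g u p\<close>, so the Laplace transform at u is an instance of
    \<open>log_mgf_limit\<close>.\<close>
  have lw: "\<alpha> N * inner_on J u (Z N \<omega>) = log_weight \<alpha> (Suc n) (g u) N \<omega>" if N: "N \<ge> 1" and w: "\<omega> \<in> space (M N)" for N \<omega> u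
  proof -
    have a0: "0 < \<alpha> N" using apos[OF N] .
    have fl: "fluctuation E K \<eta>0 N (\<lambda>k. \<xi> N k \<omega>) p (f p i) = fluct_sum N p (\<lambda>k. \<xi> N k \<omega>) (f p i) / sqrt (real N)"
      if "p \<le> n" "i \<in> {1..d p}" for p i
      using xi_conf[OF N w] fb[OF that] by (intro fluctuation_eq N)
    have "inner_on J u (Z N \<omega>) = (\<Sum>p\<in>{0..n}. \<Sum>i\<in>{1..d p}.
        u (p, i) * (fluct_sum N p (\<lambda>k. \<xi> N k \<omega>) (f p i) / sqrt (real N) / sqrt (\<alpha> N)))"
      unfolding inner_on_def SJ Z_def by (intro sum.cong refl) (auto simp: J_def fl)
    also have "\<dots> = (\<Sum>p\<in>{0..n}. fluct_sum N p (\<lambda>k. \<xi> N k \<omega>) (g u p) / sqrt (real N) / sqrt (\<alpha> N))"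
    proof (rule sum.cong[OF refl])
      fix p assume p: "p \<in> {0..n}"
      interpret P: particles E K \<eta>0 N "M N" "\<xi> N" using N by (rule particles)
      have "fluct_sum N p (\<lambda>k. \<xi> N k \<omega>) (g u p) = (\<Sum>i\<in>{1..d p}. u (p, i) * fluct_sum N p (\<lambda>k. \<xi> N k \<omega>) (f p i))"
      proof -
        have "(\<integral>y. g u p y \<partial>law N p (P.path p \<omega>) k) = (\<Sum>i\<in>{1..d p}. u (p, i) * (\<integral>y. f p i y \<partial>law N p (P.path p \<omega>) k))"
          if "k \<in> {1..N}" for k
          unfolding g_def using Prob_integrable[OF law_Prob[OF N that P.path_in[OF w]] fb] p
          by (subst Bochner_Integration.integral_sum) auto
        then have "fluct_sum N p (\<lambda>k. \<xi> N k \<omega>) (g u p) = (\<Sum>k\<in>{1..N}. \<Sum>i\<in>{1..d p}.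
            u (p, i) * (f p i (\<xi> N p \<omega> k) - (\<integral>y. f p i y \<partial>law N p (P.path p \<omega>) k)))"
          unfolding P.fluct_sum_path
          by (intro sum.cong refl) (simp add: g_def[abs_def] sum_subtractf right_diff_distrib)
        also have "\<dots> = (\<Sum>i\<in>{1..d p}. \<Sum>k\<in>{1..N}.
            u (p, i) * (f p i (\<xi> N p \<omega> k) - (\<integral>y. f p i y \<partial>law N p (P.path p \<omega>) k)))"
          by (rule sum.swap)
        finally show ?thesis unfolding P.fluct_sum_path by (simp only: sum_distrib_left)
      qed
      then show "(\<Sum>i\<in>{1..d p}. u (p, i) * (fluct_sum N p (\<lambda>k. \<xi> N k \<omega>) (f p i) / sqrt (real N) / sqrt (\<alpha> N)))
          = fluct_sum N p (\<lambda>k. \<xi> N k \<omega>) (g u p) / sqrt (real N) / sqrt (\<alpha> N)"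
        by (simp add: sum_divide_distrib)
    qed
    finally have ip: "inner_on J u (Z N \<omega>) = (\<Sum>p\<in>{0..n}. fluct_sum N p (\<lambda>k. \<xi> N k \<omega>) (g u p) / sqrt (real N) / sqrt (\<alpha> N))" .
    have c: "\<alpha> N * (x / sqrt (real N) / sqrt (\<alpha> N)) = sqrt (\<alpha> N / real N) * x" for x
    proof -
      have "\<alpha> N / sqrt (\<alpha> N) = sqrt (\<alpha> N)" using a0 by (simp add: real_div_sqrt)
      have "\<alpha> N * (x / sqrt (real N) / sqrt (\<alpha> N)) = \<alpha> N / sqrt (\<alpha> N) * (x / sqrt (real N))" by simp
      also have "\<dots> = sqrt (\<alpha> N) * (x / sqrt (real N))" by (simp only: \<open>\<alpha> N / sqrt (\<alpha> N) = sqrt (\<alpha> N)\<close>)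
      finally show ?thesis by (simp add: real_sqrt_divide)
    qed
    show ?thesis unfolding ip log_weight_def sum_distrib_left c
      by (rule sum.cong) auto
  qed
  interpret L: gaussian_mgf_limit J S M Z \<alpha>
  proof (intro gaussian_mgf_limit.intro psd_form.intro gaussian_mgf_limit_axioms.intro)
    show "finite J" by (rule finJ)
    show "S i j = S j i" for i j by (auto simp: S_def limit_cov_commute split: prod.splits)
    show "0 \<le> inner_on J u (mat_vec J S u)" for u
      unfolding quadratic by (intro sum_nonneg limit_cov_nonneg)
    show "filterlim \<alpha> at_top sequentially" by fact
    have gb': "g u p \<in> bounded_meas (E p)" if "p < Suc n" for u p using gb that by simp
    show "exp_rate \<alpha> (\<lambda>N. \<integral>\<omega>. exp (\<alpha> N * inner_on J u (Z N \<omega>)) \<partial>M N) (1/2 * inner_on J u (mat_vec J S u))" for u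
    proof -
      have r: "exp_rate \<alpha> (\<lambda>N. \<integral>\<omega>. exp (log_weight \<alpha> (Suc n) (g u) N \<omega>) \<partial>M N)
          (1/2 * (\<Sum>p<Suc n. limit_cov K \<eta>0 p (g u p) (g u p)))"
        by (rule log_mgf_limit[OF apos assms(10,11) gb'])
      have e: "(\<integral>\<omega>. exp (log_weight \<alpha> (Suc n) (g u) N \<omega>) \<partial>M N) = (\<integral>\<omega>. exp (\<alpha> N * inner_on J u (Z N \<omega>)) \<partial>M N)"
        if "N \<ge> 1" for N using lw[OF that] by (intro Bochner_Integration.integral_cong) auto
      have "(\<Sum>p<Suc n. limit_cov K \<eta>0 p (g u p) (g u p)) = (\<Sum>p\<in>{0..n}. limit_cov K \<eta>0 p (g u p) (g u p))"
        by (rule sum.cong) auto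
      with exp_rate_cong[OF r eventually_mono[OF eventually_ge_at_top[of 1] e]] show ?thesis
        by (simp only: quadratic)
    qed
    fix N :: nat assume N: "N \<ge> 1"
    interpret P: particles E K \<eta>0 N "M N" "\<xi> N" using N by (rule particles)
    show "prob_space (M N)" by unfold_locales
    show "0 < \<alpha> N" by (rule apos[OF N])
    show "Z N \<in> M N \<rightarrow>\<^sub>M PiM J (\<lambda>_. borel)"
      unfolding Z_def[abs_def]
    proof (rule measurable_restrict)
      fix x assume "x \<in> J"
      then obtain p i where x: "x = (p, i)" "p \<le> n" "i \<in> {1..d p}" by (auto simp: J_def)
      have m: "f p i \<in> borel_measurable (E p)" using fb[OF x(2,3)] by (simp add: bounded_meas_def)
      have "(\<lambda>\<omega>. fluct_sum N p (\<lambda>k. \<xi> N k \<omega>) (f p i) / sqrt (real N) / sqrt (\<alpha> N)) \<in> borel_measurable (M N)"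
        using P.fluct_sum_measurable[OF m] by measurable
      also have "?this \<longleftrightarrow> (\<lambda>\<omega>. (case x of (p, i) \<Rightarrow> fluctuation E K \<eta>0 N (\<lambda>k. \<xi> N k \<omega>) p (f p i)) / sqrt (\<alpha> N)) \<in> borel_measurable (M N)"
        using fluctuation_eq[OF N _ fb[OF x(2,3)]] xi_conf[OF N] by (intro measurable_cong) (simp add: x)
      finally show "(\<lambda>\<omega>. (case x of (p, i) \<Rightarrow> fluctuation E K \<eta>0 N (\<lambda>k. \<xi> N k \<omega>) p (f p i)) / sqrt (\<alpha> N)) \<in> borel_measurable (M N)" .
    qed
    show "integrable (M N) (\<lambda>\<omega>. exp (\<alpha> N * inner_on J u (Z N \<omega>)))" for u
    proof -
      have "integrable (M N) (\<lambda>\<omega>. exp (1 * log_weight \<alpha> (Suc n) (g u) N \<omega> + 0))"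
        by (rule integrable_exp_log_weight[OF gb' N, where d=0]) auto
      also have "?this \<longleftrightarrow> ?thesis" using lw[OF N] by (intro Bochner_Integration.integrable_cong) auto
      finally show ?thesis .
    qed
  qed
  have rates: "L.legendre v = (\<Sum>p=0..n. rate \<Omega> (V p) (d p) (f p) (\<lambda>i\<in>{1..d p}. v (p, i)))" for v
  proof -
    \<comment> \<open>The contribution of time p to the concave functional under the supremum,
      viewed as a function of the full vector u although it reads only block p.\<close>
    define F where "F p u = (\<Sum>i=1..d p. u (p, i) * v (p, i)) - 1/2 * (\<integral>\<omega>. (\<Sum>i=1..d p. u (p, i) * V p (f p i) \<omega>)\<^sup>2 \<partial>\<Omega>)"
      for p and u :: "nat \<times> nat \<Rightarrow> real"
    have Fq: "F p u = (\<Sum>i=1..d p. u (p, i) * v (p, i)) - 1/2 * limit_cov K \<eta>0 p (g u p) (g u p)" if "p \<le> n" for p u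
    proof -
      have fp: "\<And>i. i \<in> {1..d p} \<Longrightarrow> f p i \<in> bounded_meas (E p)" using fb that by simp
      show ?thesis
        using limit_fields_second_moment[OF assms(5) finite_atLeastAtMost fp, where u="\<lambda>i. u (p, i)"]
          limit_cov_sum[OF finite_atLeastAtMost fp, where c="\<lambda>i. u (p, i)"]
        by (simp only: F_def g_def[abs_def])
    qed
    have "L.legendre v = (SUP u\<in>J \<rightarrow>\<^sub>E UNIV. ereal (\<Sum>p\<in>{0..n}. F p u))"
      unfolding L.legendre_def L.quad_def quadratic
    proof (intro SUP_cong refl arg_cong[where f=ereal])
      fix u
      show "inner_on J u v - 1/2 * (\<Sum>p\<in>{0..n}. limit_cov K \<eta>0 p (g u p) (g u p)) = (\<Sum>p\<in>{0..n}. F p u)"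
        unfolding inner_on_def SJ sum_distrib_left sum_subtractf[symmetric] by (intro sum.cong refl) (simp add: Fq)
    qed
    also have "\<dots> = (\<Sum>p\<in>{0..n}. SUP u\<in>J \<rightarrow>\<^sub>E UNIV. ereal (F p u))"
      unfolding J_def
    proof (rule sum_SUP_blocks[symmetric])
      show "F p u = F p u'" if "\<And>i. i \<in> {1..d p} \<Longrightarrow> u (p, i) = u' (p, i)" for p u u'
        using that by (simp add: F_def)
    qed (auto simp: F_def)
    also have "\<dots> = (\<Sum>p=0..n. rate \<Omega> (V p) (d p) (f p) (\<lambda>i\<in>{1..d p}. v (p, i)))"
    proof (rule sum.cong[OF refl])
      fix p assume p: "p \<in> {0..n}"
      define G where "G w = ereal ((\<Sum>i=1..d p. w i * (\<lambda>i\<in>{1..d p}. v (p, i)) i) - 1/2 * (\<integral>\<omega>. (\<Sum>i=1..d p. w i * V p (f p i) \<omega>)\<^sup>2 \<partial>\<Omega>))" for w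
      \<comment> \<open>A vector on block p extends to all of J by repeating it in every block,
        since the other blocks do not affect \<open>F p\<close>; conversely, restriction to block p
        loses nothing.\<close>
      have "(\<lambda>u. ereal (F p u)) ` (J \<rightarrow>\<^sub>E UNIV) = G ` ({1..d p} \<rightarrow>\<^sub>E UNIV)"
      proof (intro equalityI subsetI)
        fix y assume "y \<in> (\<lambda>u. ereal (F p u)) ` (J \<rightarrow>\<^sub>E UNIV)"
        then obtain u where "y = ereal (F p u)" by auto
        then have "y = G (\<lambda>i\<in>{1..d p}. u (p, i))" by (simp add: F_def G_def)
        moreover have "(\<lambda>i\<in>{1..d p}. u (p, i)) \<in> {1..d p} \<rightarrow>\<^sub>E UNIV" by auto
        ultimately show "y \<in> G ` ({1..d p} \<rightarrow>\<^sub>E UNIV)" by (simp only: imageI)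
      next
        fix y assume "y \<in> G ` ({1..d p} \<rightarrow>\<^sub>E UNIV)"
        then obtain u where "y = G u" by auto
        then have "y = ereal (F p (\<lambda>(q, i)\<in>J. u i))" using p by (simp add: F_def G_def J_def)
        moreover have "(\<lambda>(q, i)\<in>J. u i) \<in> J \<rightarrow>\<^sub>E UNIV" by auto
        ultimately show "y \<in> (\<lambda>u. ereal (F p u)) ` (J \<rightarrow>\<^sub>E UNIV)" unfolding image_iff by blast
      qed
      then show "(SUP u\<in>J \<rightarrow>\<^sub>E UNIV. ereal (F p u)) = rate \<Omega> (V p) (d p) (f p) (\<lambda>i\<in>{1..d p}. v (p, i))"
        unfolding rate_def G_def by simp
    qed
    finally show ?thesis .
  qed
  have "L.legendre = (\<lambda>v. \<Sum>p=0..n. rate \<Omega> (V p) (d p) (f p) (\<lambda>i\<in>{1..d p}. v (p, i)))"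
    using rates by (rule ext)
  with L.gaussian_LDP show ?thesis
    unfolding MDP_def Z_def[abs_def] J_def by simp
qed

end
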